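(* Let $\mathfrak g$ be a finite-dimensional simple Lie algebra over $\mathbb C$ of rank $n\ge3$. Then $$\bigcap_{\underline w_0\in R(w_0)}\mathcal D^q_{\underline w_0}=\emptyset,$$ where $\mathcal D^q_{\underline w_0}\subset\mathbb R^{\Delta_+}_{\ge0}$ is the quantum degree cone associated to the reduced decomposition $\underline w_0$ of the longest Weyl group element $w_0$.
   Context: Conventions: $\mathbb N=\{0,1,2,\dots\}$. $\mathfrak g=\mathfrak n^+\oplus\mathfrak h\oplus\mathfrak n^-$ is a simple Lie algebra of rank $n$ with simple roots $\alpha_1,\dots,\alpha_n$, positive roots $\Delta_+$, $N=|\Delta_+|$, Weyl group $W$ generated by the simple reflections $s_1,\dots,s_n$, longest element $w_0$; $R(w_0)$ is the set of reduced decompositions of $w_0$. For a function $\mathbf d$ on $\Delta_+$ write $d_\beta=\mathbf d(\beta)$; $\mathbb R^{\Delta_+}_{\ge0}$ is the set of non-negative real functions on $\Delta_+$. Quantum group: $C=(c_{ij})$ is the Cartan matrix, $\epsilon_1,\dots,\epsilon_n$ the minimal positive integers with $(\epsilon_ic_{ij})$ symmetric, $(\cdot,\cdot)$ the symmetric bilinear form on the root lattice with $(\alpha_i,\alpha_j)=\epsilon_ic_{ij}$, $q_i=q^{\epsilon_i}$. $U_q(\mathfrak g)$ is the $\mathbb C(q)$-algebra generated by $E_i,F_i,K_i^{\pm1}$ ($1\le i\le n$) with relations: the $K_i$ commute, $K_iE_jK_i^{-1}=q_i^{c_{ij}}E_j$, $K_iF_jK_i^{-1}=q_i^{-c_{ij}}F_j$,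 $E_iF_j-F_jE_i=\delta_{ij}\frac{K_i-K_i^{-1}}{q_i-q_i^{-1}}$, and the quantum Serre relations $\sum_{r=0}^{1-c_{ij}}(-1)^rX_i^{(1-c_{ij}-r)}X_jX_i^{(r)}=0$ ($i\ne j$, $X=E$ or $F$), where $X_i^{(m)}=X_i^m/[m]_{q_i}!$ and $[m]_q!=\prod_{k=1}^m\frac{q^k-q^{-k}}{q-q^{-1}}$. $U_q(\mathfrak n^-)$ is the subalgebra generated by the $F_i$. Lusztig's automorphisms $T_i=T''_{i,1}$ are: $T_i(E_i)=-F_iK_i$, $T_i(F_i)=-K_i^{-1}E_i$, $T_i(K_j)=K_jK_i^{-c_{ij}}$, and for $j\ne i$, $T_i(E_j)=\sum_{r+s=-c_{ij}}(-1)^rq_i^{-r}E_i^{(s)}E_jE_i^{(r)}$, $T_i(F_j)=\sum_{r+s=-c_{ij}}(-1)^rq_i^{r}F_i^{(r)}F_jF_i^{(s)}$. PBW root vectors: for $\underline w_0=s_{i_1}\cdots s_{i_N}\in R(w_0)$ put $\beta_t=s_{i_1}\cdots s_{i_{t-1}}(\alpha_{i_t})$ and $F_{\beta_t}=T_{i_1}\cdots T_{i_{t-1}}(F_{i_t})\in U_q(\mathfrak n^-)$. Then $\Delta_+=\{\beta_1,\dots,\beta_N\}$, and the monomials $F_{\beta_1}^{t_1}\cdots F_{\beta_N}^{t_N}$ form a $\mathbb C(q)$-basis of $U_q(\mathfrak n^-)$. For $i<j$ there is a unique expression (Levendorskii–Soibelman formula) $$F_{\beta_j}F_{\beta_i}-q^{-(\beta_i,\beta_j)}F_{\beta_i}F_{\beta_j}=\sum_{n_{i+1},\dots,n_{j-1}\ge0}c(n_{i+1},\dots,n_{j-1})F_{\beta_{i+1}}^{n_{i+1}}\cdots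 F_{\beta_{j-1}}^{n_{j-1}}$$ with coefficients $c(\cdot)\in\mathbb C(q)$ (depending on $i,j,\underline w_0$), almost all zero. Quantum degree cone: $\mathcal D^q_{\underline w_0}$ is the set of $(d_\beta)\in\mathbb R_{\ge0}^{\Delta_+}$ such that for all $i<j$ one has $d_{\beta_i}+d_{\beta_j}>\sum_{k=i+1}^{j-1}n_kd_{\beta_k}$ whenever $c(n_{i+1},\dots,n_{j-1})\ne0$ in this formula. *)

theory Defs
  imports
    Complex_Main
    "HOL-Library.FuncSet"
    "HOL-Library.Poly_Mapping"
    "HOL-Computational_Algebra.Polynomial"
    "HOL-Computational_Algebra.Fraction_Field"
begin

section \<open>Simple complex Lie algebras and their root data\<close>

locale complex_lie_algebra = vector_space scale
  for scale :: "complex \<Rightarrow> 'g::ab_group_add \<Rightarrow> 'g" +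
  fixes bracket :: "'g \<Rightarrow> 'g \<Rightarrow> 'g"
  assumes bracket_add_left: "bracket (x + y) z = bracket x z + bracket y z"
    and bracket_add_right: "bracket x (y + z) = bracket x y + bracket x z"
    and bracket_scale_left: "bracket (scale a x) y = scale a (bracket x y)"
    and bracket_scale_right: "bracket x (scale a y) = scale a (bracket x y)"
    and bracket_self: "bracket x x = 0"
    and jacobi: "bracket x (bracket y z) + bracket y (bracket z x) + bracket z (bracket x y) = 0"
begin

definition lie_ideal :: "'g set \<Rightarrow> bool" where
  "lie_ideal I \<longleftrightarrow> subspace I \<and> (\<forall>x. \<forall>y\<in>I. bracket x y \<in> I)"

definition ad_diagonalizable :: "'g \<Rightarrow> bool" where
  "ad_diagonalizable h \<longleftrightarrow> span {x. \<exists>c. bracket h x = scale c x} = UNIV"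

text \<open>The definition of Cartan subalgebras customary for semisimple Lie algebras: a
  maximal abelian subalgebra whose elements are ad-diagonalizable.\<close>

definition cartan_subalgebra :: "'g set \<Rightarrow> bool" where
  "cartan_subalgebra H \<longleftrightarrow>
     subspace H \<and>
     (\<forall>x\<in>H. \<forall>y\<in>H. bracket x y = 0) \<and>
     (\<forall>x. (\<forall>h\<in>H. bracket h x = 0) \<longrightarrow> x \<in> H) \<and>
     (\<forall>h\<in>H. ad_diagonalizable h)"

text \<open>Functionals on the Cartan subalgebra \<open>H\<close> are represented by functions on the whole
  Lie algebra, of which only the values on \<open>H\<close> matter.  The existence of a nonzero root
  vector forces linearity on \<open>H\<close>.\<close>

definition root_space :: "'g set \<Rightarrow> ('g \<Rightarrow> complex) \<Rightarrow> 'g set" where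
  "root_space H \<mu> = {x. \<forall>h\<in>H. bracket h x = scale (\<mu> h) x}"

definition is_root :: "'g set \<Rightarrow> ('g \<Rightarrow> complex) \<Rightarrow> bool" where
  "is_root H \<mu> \<longleftrightarrow> (\<exists>h\<in>H. \<mu> h \<noteq> 0) \<and> (\<exists>x\<in>root_space H \<mu>. x \<noteq> 0)"

definition simple_roots :: "'g set \<Rightarrow> ('i::finite \<Rightarrow> 'g \<Rightarrow> complex) \<Rightarrow> bool" where
  "simple_roots H \<alpha> \<longleftrightarrow>
     (\<forall>i. is_root H (\<alpha> i)) \<and>
     (\<forall>a. (\<forall>h\<in>H. (\<Sum>i\<in>UNIV. a i * \<alpha> i h) = 0) \<longrightarrow> (\<forall>i. a i = 0)) \<and>
     (\<forall>\<mu>. is_root H \<mu> \<longrightarrow>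
        (\<exists>m :: 'i \<Rightarrow> int. ((\<forall>i. 0 \<le> m i) \<or> (\<forall>i. m i \<le> 0)) \<and>
           (\<forall>h\<in>H. \<mu> h = (\<Sum>i\<in>UNIV. of_int (m i) * \<alpha> i h))))"

text \<open>The coroot of \<open>\<mu>\<close> is the element \<open>h\<close> of \<open>[\<gg>\<^sub>\<mu>, \<gg>\<^sub>-\<^sub>\<mu>]\<close> with \<open>\<mu>(h) = 2\<close>.\<close>

definition is_coroot :: "'g set \<Rightarrow> ('g \<Rightarrow> complex) \<Rightarrow> 'g \<Rightarrow> bool" where
  "is_coroot H \<mu> h \<longleftrightarrow>
     h \<in> span {bracket x y |x y. x \<in> root_space H \<mu> \<and> y \<in> root_space H (\<lambda>h. - \<mu> h)} \<and>
     \<mu> h = 2"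

text \<open>\<open>C i j = \<alpha>\<^sub>j(h\<^sub>i)\<close>, where \<open>h\<^sub>i\<close> is the coroot of \<open>\<alpha>\<^sub>i\<close>, i.e.
  \<open>C i j = 2(\<alpha>\<^sub>i,\<alpha>\<^sub>j)/(\<alpha>\<^sub>i,\<alpha>\<^sub>i)\<close>.\<close>

definition cartan_matrix ::
  "'g set \<Rightarrow> ('i::finite \<Rightarrow> 'g \<Rightarrow> complex) \<Rightarrow> ('i \<Rightarrow> 'i \<Rightarrow> int) \<Rightarrow> bool" where
  "cartan_matrix H \<alpha> C \<longleftrightarrow>
     (\<forall>i. \<exists>h. is_coroot H (\<alpha> i) h \<and> (\<forall>j. \<alpha> j h = of_int (C i j)))"

text \<open>Elements of the root lattice are coordinate vectors with respect to the simple roots.\<close>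

definition positive_roots :: "'g set \<Rightarrow> ('i::finite \<Rightarrow> 'g \<Rightarrow> complex) \<Rightarrow> ('i \<Rightarrow> int) set" where
  "positive_roots H \<alpha> =
     {\<beta>. (\<forall>i. 0 \<le> \<beta> i) \<and> is_root H (\<lambda>h. \<Sum>i\<in>UNIV. of_int (\<beta> i) * \<alpha> i h)}"

end

locale simple_lie_algebra = complex_lie_algebra +
  assumes finite_dimensional: "\<exists>B. finite B \<and> span B = UNIV"
    and nonabelian: "\<exists>x y. bracket x y \<noteq> 0"
    and simple: "lie_ideal I \<Longrightarrow> I = {0} \<or> I = UNIV"


section \<open>The Weyl group\<close>

definition simple_root :: "'i \<Rightarrow> 'i \<Rightarrow> int" where
  "simple_root i = (\<lambda>j. if j = i then 1 else 0)"

definition simple_reflection ::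
  "('i::finite \<Rightarrow> 'i \<Rightarrow> int) \<Rightarrow> 'i \<Rightarrow> ('i \<Rightarrow> int) \<Rightarrow> ('i \<Rightarrow> int)" where
  "simple_reflection C i v = (\<lambda>j. v j - (\<Sum>k\<in>UNIV. C i k * v k) * simple_root i j)"

definition weyl_prod :: "('i::finite \<Rightarrow> 'i \<Rightarrow> int) \<Rightarrow> 'i list \<Rightarrow> ('i \<Rightarrow> int) \<Rightarrow> ('i \<Rightarrow> int)" where
  "weyl_prod C ws = foldr (\<lambda>i f. simple_reflection C i \<circ> f) ws id"

definition weyl_group :: "('i::finite \<Rightarrow> 'i \<Rightarrow> int) \<Rightarrow> (('i \<Rightarrow> int) \<Rightarrow> ('i \<Rightarrow> int)) set" where
  "weyl_group C = range (weyl_prod C)"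

definition weyl_length :: "('i::finite \<Rightarrow> 'i \<Rightarrow> int) \<Rightarrow> (('i \<Rightarrow> int) \<Rightarrow> ('i \<Rightarrow> int)) \<Rightarrow> nat" where
  "weyl_length C w = (LEAST l. \<exists>ws. length ws = l \<and> weyl_prod C ws = w)"

definition longest_element :: "('i::finite \<Rightarrow> 'i \<Rightarrow> int) \<Rightarrow> ('i \<Rightarrow> int) \<Rightarrow> ('i \<Rightarrow> int)" where
  "longest_element C = arg_max (weyl_length C) (\<lambda>w. w \<in> weyl_group C)"

definition reduced_decompositions ::
  "('i::finite \<Rightarrow> 'i \<Rightarrow> int) \<Rightarrow> (('i \<Rightarrow> int) \<Rightarrow> ('i \<Rightarrow> int)) \<Rightarrow> 'i list set" where
  "reduced_decompositions C w = {ws. weyl_prod C ws = w \<and> length ws = weyl_length C w}"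


section \<open>The quantum group\<close>

text \<open>\<open>LEAST\<close> refers to the pointwise order on functions.\<close>

definition symmetrizer :: "('i \<Rightarrow> 'i \<Rightarrow> int) \<Rightarrow> ('i \<Rightarrow> nat) \<Rightarrow> bool" where
  "symmetrizer C e \<longleftrightarrow> (\<forall>i. 0 < e i) \<and> (\<forall>i j. int (e i) * C i j = int (e j) * C j i)"

definition eps :: "('i \<Rightarrow> 'i \<Rightarrow> int) \<Rightarrow> 'i \<Rightarrow> nat" where
  "eps C = (LEAST e. symmetrizer C e)"

definition root_form :: "('i::finite \<Rightarrow> 'i \<Rightarrow> int) \<Rightarrow> ('i \<Rightarrow> int) \<Rightarrow> ('i \<Rightarrow> int) \<Rightarrow> int" where
  "root_form C \<beta> \<gamma> = (\<Sum>i\<in>UNIV. \<Sum>j\<in>UNIV. int (eps C i) * C i j * \<beta> i * \<gamma> j)"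

type_synonym ratfun = "complex poly fract"

definition q_var :: ratfun where
  "q_var = Fract [:0, 1:] 1"

definition qi :: "('i \<Rightarrow> 'i \<Rightarrow> int) \<Rightarrow> 'i \<Rightarrow> ratfun" where
  "qi C i = q_var ^ eps C i"

definition qfact :: "ratfun \<Rightarrow> nat \<Rightarrow> ratfun" where
  "qfact p m = (\<Prod>k = 1..m. (p ^ k - inverse p ^ k) / (p - inverse p))"

text \<open>Words form a monoid under concatenation, so finitely supported functions on words
  with the convolution product of \<open>Poly_Mapping\<close> form the free algebra.\<close>

instantiation list :: (type) monoid_add
begin
definition zero_list :: "'a list" where "zero_list = []"
definition plus_list :: "'a list \<Rightarrow> 'a list \<Rightarrow> 'a list" where "plus_list = (@)"
instance by standard (simp_all add: zero_list_def plus_list_def)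
end

datatype 'i generator = GE 'i | GF 'i | GK 'i | GKinv 'i

type_synonym 'i free_alg = "'i generator list \<Rightarrow>\<^sub>0 ratfun"

definition scalar :: "ratfun \<Rightarrow> 'i free_alg" where
  "scalar c = Poly_Mapping.single [] c"

definition gen :: "'i generator \<Rightarrow> 'i free_alg" where
  "gen g = Poly_Mapping.single [g] 1"

abbreviation (input) "genE i \<equiv> gen (GE i)"
abbreviation (input) "genF i \<equiv> gen (GF i)"
abbreviation (input) "genK i \<equiv> gen (GK i)"
abbreviation (input) "genKinv i \<equiv> gen (GKinv i)"

definition Kpow :: "'i \<Rightarrow> int \<Rightarrow> 'i free_alg" where
  "Kpow i m = (if 0 \<le> m then genK i ^ nat m else genKinv i ^ nat (- m))"

definition divpow :: "('i \<Rightarrow> 'i \<Rightarrow> int) \<Rightarrow> 'i \<Rightarrow> 'i free_alg \<Rightarrow> nat \<Rightarrow> 'i free_alg" where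
  "divpow C i x m = scalar (inverse (qfact (qi C i) m)) * x ^ m"

definition serre ::
  "('i \<Rightarrow> 'i \<Rightarrow> int) \<Rightarrow> ('i \<Rightarrow> 'i free_alg) \<Rightarrow> 'i \<Rightarrow> 'i \<Rightarrow> 'i free_alg" where
  "serre C X i j =
     (\<Sum>r\<le>nat (1 - C i j).
        (- 1) ^ r * divpow C i (X i) (nat (1 - C i j) - r) * X j * divpow C i (X i) r)"

inductive_set Uq_relations :: "('i \<Rightarrow> 'i \<Rightarrow> int) \<Rightarrow> 'i free_alg set"
  for C :: "'i \<Rightarrow> 'i \<Rightarrow> int" where
  "genK i * genKinv i - 1 \<in> Uq_relations C"
| "genKinv i * genK i - 1 \<in> Uq_relations C"
| "genK i * genK j - genK j * genK i \<in> Uq_relations C"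
| "genK i * genE j * genKinv i - scalar (qi C i powi C i j) * genE j \<in> Uq_relations C"
| "genK i * genF j * genKinv i - scalar (qi C i powi (- C i j)) * genF j \<in> Uq_relations C"
| "genE i * genF j - genF j * genE i -
     (if i = j then scalar (inverse (qi C i - inverse (qi C i))) * (genK i - genKinv i) else 0)
   \<in> Uq_relations C"
| "i \<noteq> j \<Longrightarrow> serre C (\<lambda>i. genE i) i j \<in> Uq_relations C"
| "i \<noteq> j \<Longrightarrow> serre C (\<lambda>i. genF i) i j \<in> Uq_relations C"

text \<open>The two-sided ideal generated by the relations.  \<open>U\<^sub>q(\<gg>)\<close> is the quotient of the free
  algebra by it; since the quotient depends on \<open>C\<close>, it is not made into a type, and equality
  in \<open>U\<^sub>q(\<gg>)\<close> is congruence modulo this ideal.\<close>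

inductive_set Uq_ideal :: "('i \<Rightarrow> 'i \<Rightarrow> int) \<Rightarrow> 'i free_alg set"
  for C :: "'i \<Rightarrow> 'i \<Rightarrow> int" where
  Uq_ideal_zero: "0 \<in> Uq_ideal C"
| Uq_ideal_rel: "r \<in> Uq_relations C \<Longrightarrow> a * r * b \<in> Uq_ideal C"
| Uq_ideal_add: "x \<in> Uq_ideal C \<Longrightarrow> y \<in> Uq_ideal C \<Longrightarrow> x + y \<in> Uq_ideal C"

definition Uq_eq :: "('i \<Rightarrow> 'i \<Rightarrow> int) \<Rightarrow> 'i free_alg \<Rightarrow> 'i free_alg \<Rightarrow> bool" where
  "Uq_eq C x y \<longleftrightarrow> x - y \<in> Uq_ideal C"

text \<open>The algebra endomorphism of the free algebra with given values on the generators.\<close>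

definition extend_hom :: "('i generator \<Rightarrow> 'i free_alg) \<Rightarrow> 'i free_alg \<Rightarrow> 'i free_alg" where
  "extend_hom \<phi> x =
     (\<Sum>w\<in>Poly_Mapping.keys x. scalar (Poly_Mapping.lookup x w) * prod_list (map \<phi> w))"

text \<open>Lusztig's automorphisms \<open>T\<^sub>i = T''\<^sub>i\<^sub>,\<^sub>1\<close>, lifted to the free algebra.\<close>

fun T_gen :: "('i \<Rightarrow> 'i \<Rightarrow> int) \<Rightarrow> 'i \<Rightarrow> 'i generator \<Rightarrow> 'i free_alg" where
  "T_gen C i (GE j) =
     (if j = i then - (genF i * genK i)
      else \<Sum>r\<le>nat (- C i j). (- 1) ^ r * scalar (inverse (qi C i) ^ r) *
             divpow C i (genE i) (nat (- C i j) - r) * genE j * divpow C i (genE i) r)"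
| "T_gen C i (GF j) =
     (if j = i then - (genKinv i * genE i)
      else \<Sum>r\<le>nat (- C i j). (- 1) ^ r * scalar (qi C i ^ r) *
             divpow C i (genF i) r * genF j * divpow C i (genF i) (nat (- C i j) - r))"
| "T_gen C i (GK j) = genK j * Kpow i (- C i j)"
| "T_gen C i (GKinv j) = Kpow i (C i j) * genKinv j"

definition lusztig_T :: "('i \<Rightarrow> 'i \<Rightarrow> int) \<Rightarrow> 'i \<Rightarrow> 'i free_alg \<Rightarrow> 'i free_alg" where
  "lusztig_T C i = extend_hom (T_gen C i)"


section \<open>Quantum degree cones\<close>

text \<open>Positions in a reduced decomposition are counted from \<open>0\<close>.\<close>

definition pbw_root :: "('i::finite \<Rightarrow> 'i \<Rightarrow> int) \<Rightarrow> 'i list \<Rightarrow> nat \<Rightarrow> ('i \<Rightarrow> int)" where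
  "pbw_root C ws t = weyl_prod C (take t ws) (simple_root (ws ! t))"

definition pbw_vector :: "('i::finite \<Rightarrow> 'i \<Rightarrow> int) \<Rightarrow> 'i list \<Rightarrow> nat \<Rightarrow> 'i free_alg" where
  "pbw_vector C ws t = foldr (lusztig_T C) (take t ws) (genF (ws ! t))"

definition pbw_monomial ::
  "('i::finite \<Rightarrow> 'i \<Rightarrow> int) \<Rightarrow> 'i list \<Rightarrow> nat \<Rightarrow> nat \<Rightarrow> (nat \<Rightarrow>\<^sub>0 nat) \<Rightarrow> 'i free_alg" where
  "pbw_monomial C ws i j n =
     prod_list (map (\<lambda>k. pbw_vector C ws k ^ Poly_Mapping.lookup n k) [Suc i..<j])"

text \<open>\<open>c\<close> is the family of coefficients in the Levendorskii--Soibelman formula for the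
  positions \<open>i < j\<close>.  The exponents \<open>(n\<^sub>i\<^sub>+\<^sub>1,\<dots>,n\<^sub>j\<^sub>-\<^sub>1)\<close> are functions supported in \<open>{i<..<j}\<close>.\<close>

definition LS_coefficients ::
  "('i::finite \<Rightarrow> 'i \<Rightarrow> int) \<Rightarrow> 'i list \<Rightarrow> nat \<Rightarrow> nat \<Rightarrow> ((nat \<Rightarrow>\<^sub>0 nat) \<Rightarrow>\<^sub>0 ratfun) \<Rightarrow> bool" where
  "LS_coefficients C ws i j c \<longleftrightarrow>
     (\<forall>n\<in>Poly_Mapping.keys c. Poly_Mapping.keys n \<subseteq> {i<..<j}) \<and>
     Uq_eq C
       (pbw_vector C ws j * pbw_vector C ws i -
          scalar (q_var powi (- root_form C (pbw_root C ws i) (pbw_root C ws j))) *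
            pbw_vector C ws i * pbw_vector C ws j)
       (\<Sum>n\<in>Poly_Mapping.keys c. scalar (Poly_Mapping.lookup c n) * pbw_monomial C ws i j n)"

text \<open>By the PBW theorem there is exactly one \<open>c\<close> with \<open>LS_coefficients C ws i j c\<close>, so the
  quantification over \<open>c\<close> only names the coefficients.\<close>

definition quantum_degree_cone ::
  "('i \<Rightarrow> int) set \<Rightarrow> ('i::finite \<Rightarrow> 'i \<Rightarrow> int) \<Rightarrow> 'i list \<Rightarrow> (('i \<Rightarrow> int) \<Rightarrow> real) set" where
  "quantum_degree_cone \<Delta>p C ws =
     {d \<in> \<Delta>p \<rightarrow>\<^sub>E {0..}.
        \<forall>i j c n. i < j \<longrightarrow> j < length ws \<longrightarrow> LS_coefficients C ws i j c \<longrightarrow>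
          Poly_Mapping.lookup c n \<noteq> 0 \<longrightarrow>
          d (pbw_root C ws i) + d (pbw_root C ws j) >
            (\<Sum>k\<in>{i<..<j}. real (Poly_Mapping.lookup n k) * d (pbw_root C ws k))}"

end

theory Submission
  imports Defs
begin

text \<open>A Dynkin diagram of rank at least 3 contains a path \<open>i\<^sub>1, i\<^sub>2, i\<^sub>3\<close> of type \<open>A\<^sub>3\<close>, \<open>B\<^sub>3\<close> or
  \<open>C\<^sub>3\<close>, labelled so that the edge between \<open>i\<^sub>1\<close> and \<open>i\<^sub>2\<close> is simple; let \<open>-m\<close> and \<open>-b\<close> be the
  Cartan entries of the other edge. Write \<open>\<gamma> = s\<^sub>2 \<alpha>\<^sub>3\<close>, \<open>\<gamma>' = s\<^sub>1 \<gamma>\<close> and \<open>\<theta> = s\<^sub>2 s\<^sub>1 s\<^sub>3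
  \<alpha>\<^sub>2\<close>. For a reduced word of the longest element starting with \<open>2132\<close> the q-commutator of the
  root vectors of \<open>\<alpha>\<^sub>2\<close> and \<open>\<theta>\<close> is a nonzero multiple of a single monomial, so \<open>d(\<alpha>\<^sub>2) + d(\<theta>)
  > d(\<alpha>\<^sub>1 + \<alpha>\<^sub>2) + b d(\<gamma>)\<close>; a word starting with \<open>12132\<close> gives the image of this under \<open>s\<^sub>1\<close>,
  \<open>d(\<alpha>\<^sub>1 + \<alpha>\<^sub>2) + d(s\<^sub>1 \<theta>) > d(\<alpha>\<^sub>2) + b d(\<gamma>')\<close>. In type \<open>A\<^sub>3\<close>, where \<open>s\<^sub>1 \<theta> = \<gamma>\<close> and \<open>\<theta> = \<gamma>'\<close>,
  these contradict each other. Otherwise \<open>s\<^sub>1 \<theta> = \<theta>\<close>, so that \<open>2 d(\<theta>) > b (d(\<gamma>) + d(\<gamma>'))\<close>,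
  whereas a word starting with \<open>21323\<close> gives \<open>d(\<gamma>) + d(\<gamma>') > m d(\<theta>)\<close>, and \<open>m b = 2\<close>. Only the
  existence of these expansions matters, so the PBW theorem is not needed.\<close>

section \<open>Identities in rings with a central unit\<close>

text \<open>The monomials match by weight: alpha_2 + theta = (alpha_1 + alpha_2) + b gamma and, when
  m b = 2, gamma + gamma' = m theta. The work lies in the coefficients, which come out as products
  of factors such as q^n - 1 and their inverses; these are nonzero because q is not a root of unity.
  The q-integers caused by divided powers are multiplied out and cancelled for the same reason. The
  maps T_i live on the free algebra and are evaluated from the outside in: some T's followed by the
  passage to U_q form a homomorphism, and the formula for the next T_i(F_j) is inserted into it.
  Calculating with abstract elements f1, f2, f3 subject to a few relations serves both f_i = F_i and
  f_i = T_1(F_i), hence both kinds of words. A word with a prescribed beginning exists because a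
  word all of whose roots are positive can be completed, by exchange, to a reduced word of the
  longest element. The root system needed for this is extracted from the Lie algebra by sl2-strings,
  and its Cartan matrix is restricted by a positive definite form obtained by summing over the Weyl
  group.\<close>

lemma mult_assoc_rule: "a * b = c \<Longrightarrow> a * (b * y) = c * (y :: 'a::semigroup_mult)"
  by (metis mult.assoc)

locale central_unit =
  fixes z z' :: "'a::ring_1"
  assumes zz': "z * z' = 1" and z_comm: "x * z = z * x" and z'_comm: "x * z' = z' * x"
begin

lemma z'z: "z' * z = 1" using zz' z_comm by metis

lemmas z_rules = zz' z'z mult_assoc_rule[OF zz'] mult_assoc_rule[OF z'z]

lemma z_move: "x * (z * y) = z * (x * y)" "x * (z' * y) = z' * (x * y)"
  by (metis mult.assoc z_comm, metis mult.assoc z'_comm)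

lemmas zr = z_comm z'_comm z_move

text \<open>In the next two lemmas the Serre relation for \<open>f2, f3\<close> is transformed by the \<open>q\<close>-commutators
  with \<open>f1\<close>, twisted so that they act as skew derivations sending \<open>f2\<close> to \<open>x\<close>, and \<open>x\<close> and
  \<open>f3\<close> to \<open>0\<close>.\<close>

lemma serre_lift1:
  assumes 21: "f2 * f1 = z * f1 * f2 + x" and x1: "x * f1 = z' * f1 * x" and 31: "f3 * f1 = f1 * f3"
    and S: "f2 * f2 * f3 - (z + z') * f2 * f3 * f2 + f3 * f2 * f2 = 0"
  shows "(z + z') * (x * x * f3 - (z + z') * x * f3 * x + f3 * x * x) = 0"
proof -
  note r = algebra_simps z_rules 21 x1 31 21[THEN mult_assoc_rule] x1[THEN mult_assoc_rule] 31[THEN mult_assoc_rule]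
    zr[of f1] zr[of f2] zr[of f3] zr[of x]
  let ?S = "f2 * f2 * f3 - (z + z') * f2 * f3 * f2 + f3 * f2 * f2"
  have "(z + z') * (x * x * f3 - (z + z') * x * f3 * x + f3 * x * x) =
     (?S * f1 - z*z*f1*?S) * f1 - f1 * (?S * f1 - z*z*f1*?S)"
    by (simp add: r)
  then show ?thesis using S by simp
qed

lemma serre_lift2:
  assumes 21: "f2 * f1 = z * f1 * f2 + x" and x1: "x * f1 = z' * f1 * x" and 31: "f3 * f1 = f1 * f3"
    and S: "f2*f2*f2*f3 - (z*z+1+z'*z') * f2*f2*f3*f2 + (z*z+1+z'*z') * f2*f3*f2*f2 - f3*f2*f2*f2 = 0"
  shows "(z*z+1+z'*z') * (z + z') *
    (x*x*x*f3 - (z*z+1+z'*z') * x*x*f3*x + (z*z+1+z'*z') * x*f3*x*x - f3*x*x*x) = 0"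
proof -
  note r = algebra_simps z_rules 21 x1 31 21[THEN mult_assoc_rule] x1[THEN mult_assoc_rule] 31[THEN mult_assoc_rule]
    zr[of f1] zr[of f2] zr[of f3] zr[of x]
  let ?S = "f2*f2*f2*f3 - (z*z+1+z'*z') * f2*f2*f3*f2 + (z*z+1+z'*z') * f2*f3*f2*f2 - f3*f2*f2*f2"
  let ?S1 = "?S * f1 - z*z*z*f1*?S"
  let ?S2 = "?S1*f1 - z*f1*?S1"
  have "(z*z+1+z'*z') * (z + z') *
    (x*x*x*f3 - (z*z+1+z'*z') * x*x*f3*x + (z*z+1+z'*z') * x*f3*x*x - f3*x*x*x) = ?S2 * f1 - z' * f1 * ?S2"
    by (simp add: r)
  then show ?thesis using S by simp
qed

text \<open>Here skew derivations given by \<open>q\<close>-commutators with \<open>f2\<close> are applied to \<open>f1 * f3 - f3 * f1\<close>.\<close>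

lemma serre_comm1:
  assumes 12: "f1 * f2 = z * f2 * f1 + y" and y2: "y * f2 = z' * f2 * y"
    and 32: "f3 * f2 = z * f2 * f3 + x" and x2: "x * f2 = z' * f2 * x"
    and 13: "f1 * f3 = f3 * f1"
  shows "(z + z') * (y * x - x * y) = 0"
proof -
  note r = algebra_simps z_rules 12 y2 32 x2 12[THEN mult_assoc_rule] y2[THEN mult_assoc_rule]
     32[THEN mult_assoc_rule] x2[THEN mult_assoc_rule]
    zr[of f1] zr[of f2] zr[of f3] zr[of x] zr[of y]
  let ?D = "f1 * f3 - f3 * f1"
  have "(z + z') * (y * x - x * y) = (?D * f2 - z*z*f2*?D) * f2 - f2 * (?D * f2 - z*z*f2*?D)"
    by (simp add: r)
  then show ?thesis using 13 by simp
qed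

lemma serre_comm2:
  assumes 12: "f1 * f2 = z * f2 * f1 + y" and y2: "y * f2 = z' * f2 * y"
    and 32: "f3 * f2 = z * z * f2 * f3 + r" and r2: "r * f2 = f2 * r + x" and x2: "x * f2 = z' * z' * f2 * x"
    and 13: "f1 * f3 = f3 * f1"
  shows "(z * z + 1 + z' * z') * (y * x - x * y) = 0"
proof -
  note r = algebra_simps z_rules 12 y2 32 r2 x2 12[THEN mult_assoc_rule] y2[THEN mult_assoc_rule]
     32[THEN mult_assoc_rule] r2[THEN mult_assoc_rule] x2[THEN mult_assoc_rule]
    zr[of f1] zr[of f2] zr[of f3] zr[of x] zr[of y] zr[of r]
  let ?D = "f1 * f3 - f3 * f1"
  let ?D1 = "?D * f2 - z*z*z*f2*?D"
  let ?D2 = "?D1 * f2 - z*f2*?D1"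
  have "(z * z + 1 + z' * z') * (y * x - x * y) = ?D2 * f2 - z' * f2 * ?D2"
    by (simp add: r)
  then show ?thesis using 13 by simp
qed

text \<open>Moving \<open>f2\<close> to the left past \<open>Q\<close> costs a scalar only, past
  \<open>f1\<close> it also creates \<open>y\<close>. The two copies of \<open>y * Q\<close> so
  created carry the coefficients \<open>w'\<close> and \<open>- w\<close>, and they combine because
  \<open>y\<close> and \<open>Q\<close> commute.\<close>

lemma q_commutator_b1:
  assumes c: "central_unit w w'"
    and 12: "f1 * f2 = z * f2 * f1 + y" and Q2: "Q * f2 = w' * f2 * Q" and yQ: "y * Q = Q * y"
  shows "(f1 * Q - w * Q * f1) * f2 = w' * z * f2 * (f1 * Q - w * Q * f1) + (w' - w) * y * Q"
proof -
  interpret w: central_unit w w' by fact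
  show ?thesis
    by (simp add: algebra_simps z_rules w.z_rules 12 Q2 yQ 12[THEN mult_assoc_rule] Q2[THEN mult_assoc_rule]
        yQ[THEN mult_assoc_rule]
    zr[of f1] zr[of f2] zr[of y] zr[of Q] w.zr[of f1] w.zr[of f2] w.zr[of y] w.zr[of Q] w.zr[of z] w.zr[of z'])
qed

text \<open>Three copies of \<open>y * Q * Q\<close> arise, with coefficients z'^4, -(z^2 + 1) z'^2
  and z^2; their sum is the product displayed, nonzero for generic z.\<close>

lemma q_commutator_b2:
  assumes 12: "f1 * f2 = z * z * f2 * f1 + y" and Q2: "Q * f2 = z' * z' * f2 * Q" and yQ: "y * Q = Q * y"
  shows "(f1*Q*Q - z*(z+z')*Q*f1*Q + z*z*Q*Q*f1) * f2 =
     z' * z' * f2 * (f1*Q*Q - z*(z+z')*Q*f1*Q + z*z*Q*Q*f1) + z'*z'*z'*z'*(1-z*z)*(1-z*z*z*z) * y * Q * Q"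
    by (simp add: algebra_simps z_rules 12 Q2 yQ 12[THEN mult_assoc_rule] Q2[THEN mult_assoc_rule] yQ[THEN
        mult_assoc_rule]
    zr[of f1] zr[of f2] zr[of y] zr[of Q])

text \<open>The quadratic Serre expression is a nested q-commutator, the inner one with parameter
  \<open>z\<close> and the outer one with \<open>z'\<close>. Its vanishing is therefore a
  q-commutation rule for the inner q-commutator.\<close>

lemma serre_q1:
  assumes S: "f2 * f2 * f3 - (z + z') * f2 * f3 * f2 + f3 * f2 * f2 = 0"
  shows "(f3 * f2 - z * f2 * f3) * f2 = z' * f2 * (f3 * f2 - z * f2 * f3)"
    "f2 * (f2 * f3 - z * f3 * f2) = z' * (f2 * f3 - z * f3 * f2) * f2"
proof -
  have "(f3 * f2 - z * f2 * f3) * f2 - z' * f2 * (f3 * f2 - z * f2 * f3)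
    = f2 * f2 * f3 - (z + z') * f2 * f3 * f2 + f3 * f2 * f2"
    "f2 * (f2 * f3 - z * f3 * f2) - z' * (f2 * f3 - z * f3 * f2) * f2
    = f2 * f2 * f3 - (z + z') * f2 * f3 * f2 + f3 * f2 * f2"
    by (simp_all add: algebra_simps z_rules zr[of f2] zr[of f3])
  then show "(f3 * f2 - z * f2 * f3) * f2 = z' * f2 * (f3 * f2 - z * f2 * f3)"
    "f2 * (f2 * f3 - z * f3 * f2) = z' * (f2 * f3 - z * f3 * f2) * f2"
    using S by simp_all
qed

lemma serre_q2:
  fixes f2 f3
  defines "x \<equiv> f3*f2*f2 - z*(z+z')*f2*f3*f2 + z*z*f2*f2*f3"
  assumes S: "f2*f2*f2*f3 - (z*z+1+z'*z') * f2*f2*f3*f2 + (z*z+1+z'*z') * f2*f3*f2*f2 - f3*f2*f2*f2 = 0"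
  shows "x * f2 = z' * z' * f2 * x"
proof -
  have "x * f2 - z' * z' * f2 * x = 
   - (f2*f2*f2*f3 - (z*z+1+z'*z') * f2*f2*f3*f2 + (z*z+1+z'*z') * f2*f3*f2*f2 - f3*f2*f2*f2)"
    unfolding x_def by (simp add: algebra_simps z_rules zr[of f2] zr[of f3])
  then show ?thesis using S by simp
qed

lemma r_step:
  "(f3 * f2 - z*z*f2*f3) * f2 = f2 * (f3 * f2 - z*z*f2*f3) + (f3*f2*f2 - z*(z+z')*f2*f3*f2 + z*z*f2*f2*f3)"
  by (simp add: algebra_simps z_rules zr[of f2] zr[of f3])

text \<open>The element f1 x - z^2 x f1 is rewritten through \<open>r\<close> and \<open>y\<close>,
  both of which q-commute with \<open>x\<close>.\<close>

lemma C3_q_commute: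
  assumes 12: "f1 * f2 = z * f2 * f1 + y" and y2: "y * f2 = z' * f2 * y"
    and 32: "f3 * f2 = z * z * f2 * f3 + r" and r2: "r * f2 = f2 * r + x" and x2: "x * f2 = z' * z' * f2 * x"
    and 13: "f1 * f3 = f3 * f1" and yx: "y * x = x * y"
    and S: "f3 * f3 * f2 - (z*z+z'*z') * f3 * f2 * f3 + f2 * f3 * f3 = 0"
  shows "(f1 * x - z*z*x*f1) * x = z' * z' * x * (f1 * x - z*z*x*f1)"
proof -
  have r_def: "r = f3 * f2 - z*z*f2*f3" using 32 by simp
  have f3r: "f3 * r - z'*z'*r*f3 = 0"
    using S unfolding r_def by (simp add: algebra_simps z_rules zr[of f2] zr[of f3])
  note rr = algebra_simps z_rules 12 y2 32 r2 x2 12[THEN mult_assoc_rule] y2[THEN mult_assoc_rule]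
     32[THEN mult_assoc_rule] r2[THEN mult_assoc_rule] x2[THEN mult_assoc_rule]
    zr[of f1] zr[of f2] zr[of f3] zr[of x] zr[of y] zr[of r]
  let ?D = "f3 * r - z'*z'*r*f3"
  let ?D1 = "?D * f2 - z*z*f2*?D"
  \<comment> \<open>Two skew derivations by \<open>f2\<close> replace f3 by r and r by x in the
    Serre relation f3 r = z'^2 r f3.\<close>
  have "r * x - z'*z'*x*r = ?D1 * f2 - f2 * ?D1" by (simp add: rr)
  then have rx: "r * x = z'*z'*x*r" using f3r by simp
  let ?E = "f1 * f3 - f3 * f1"
  \<comment> \<open>The twists z^3 and z are the scalars that \<open>f2\<close> picks up on the
    leading terms, as in the cubic case of the skew derivations above.\<close>
  let ?E1 = "?E * f2 - z*z*z*f2*?E"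
  have "(f1 * x - z*z*x*f1) - (z+z')*(r * y - z * y * r) = ?E1 * f2 - z * f2 * ?E1" by (simp add: rr)
  then have g: "f1 * x - z*z*x*f1 = (z+z')*(r * y - z * y * r)" using 13 by simp
  show ?thesis unfolding g
    by (simp add: algebra_simps z_rules zr[of r] zr[of x] zr[of y] rx rx[THEN mult_assoc_rule] yx yx[THEN
        mult_assoc_rule])
qed

text \<open>The scalars for moving \<open>Q\<close> past \<open>A\<close> and past two factors
  \<open>G\<close> multiply to 1. Each passage through \<open>A\<close> leaves k (1 - M): the
  \<open>M\<close> parts of the three terms cancel, and the remaining parts add up to (z^2 - 1)(1 -
  z'^4) G^2.\<close>

lemma C3_commutator:
  assumes AQ: "A * Q = z*z*z*z * Q * A + k * (1 - M)" and GQ: "G * Q = z' * z' * Q * G"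
    and MG: "M * G = z*z*z*z * G * M" and k: "\<And>x. x * k = k * x"
  shows "(A*G*G - z*(z+z')*G*A*G + z*z*G*G*A) * Q = 
    Q * (A*G*G - z*(z+z')*G*A*G + z*z*G*G*A) + k*(z*z-1)*(1-z'*z'*z'*z')*G*G"
proof -
  have k2: "x * (k * y) = k * (x * y)" for x y by (metis k mult.assoc)
  show ?thesis 
   by (simp add: algebra_simps z_rules zr[of A] zr[of Q] zr[of G] zr[of M] zr[of k] AQ AQ[THEN mult_assoc_rule]
     GQ GQ[THEN mult_assoc_rule] MG MG[THEN mult_assoc_rule] k[of A] k[of Q] k[of G] k[of M] k2[of A] k2[of Q]
         k2[of G] k2[of M])
qed

text \<open>With g = f1 Q - z^2 Q f1 one has G = g Q - Q g. The inner q-commutator of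
  \<open>A\<close> and \<open>G\<close> is a multiple of g, so its commutator with \<open>Q\<close>
  is the same multiple of \<open>G\<close>.\<close>

lemma B3_commutator:
  assumes AQ: "A * Q = z*z * Q * A + k * (1 - M)" and A1: "A * f1 = z' * z' * f1 * A"
    and MQ: "M * Q = z*z*z*z * Q * M" and M1: "M * f1 = z'*z'*z'*z' * f1 * M" and k: "\<And>x. x * k = k * x"
  defines "G \<equiv> f1*Q*Q - z*(z+z')*Q*f1*Q + z*z*Q*Q*f1"
  shows "(A*G - z*z*G*A) * Q = Q * (A*G - z*z*G*A) + k*(z*z+1)*(z'*z'-1)*G"
proof -
  have k2: "x * (k * y) = k * (x * y)" for x y by (metis k mult.assoc)
  note r = algebra_simps z_rules zr[of A] zr[of Q] zr[of f1] zr[of M] zr[of k] AQ AQ[THEN mult_assoc_rule]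
     A1 A1[THEN mult_assoc_rule] M1 M1[THEN mult_assoc_rule] 
     MQ MQ[THEN mult_assoc_rule] k[of A] k[of Q] k[of f1] k[of M] k2[of A] k2[of Q] k2[of f1] k2[of M]
  have P: "A*G - z*z*G*A = k*(z*z+1)*(z'*z'-1)*(f1*Q - z*z*Q*f1)"
    unfolding G_def by (simp add: r)
  show ?thesis unfolding P unfolding G_def by (simp add: r)
qed

text \<open>This evaluates T_a T_c F_a for a simple edge, with \<open>e\<close> a multiple of E_a.
  Only e F1 - F1 e = K - K' contributes; its \<open>K'\<close> part cancels and its \<open>K\<close>
  part loses its torus factor against the \<open>K'\<close> in front.\<close>

lemma lusztig_pair_identity:
  assumes eF1: "e * F1 = F1 * e + K - K'" and eF2: "e * F2 = F2 * e"
   and K: "K * K' = 1" "K' * K = 1"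
   and KF: "K * F1 = z'*z'*F1*K" "K' * F1 = z*z*F1*K'" "K * F2 = z*F2*K" "K' * F2 = z'*F2*K'"
 shows "- (K' * e) * (F2 * F1 - z * F1 * F2) - z * (F2 * F1 - z * F1 * F2) * - (K' * e) = (z - z') * F2"
  by (simp add: algebra_simps z_rules zr[of e] zr[of F1] zr[of F2] zr[of K] zr[of K'] eF1 eF1[THEN mult_assoc_rule]
    eF2 eF2[THEN mult_assoc_rule] KF KF[THEN mult_assoc_rule] K K[THEN mult_assoc_rule])

lemma lusztig_triple_identity:
  assumes eF: "e1 * F2 = F2 * e1" "e2 * F2 = F2 * e2 + K2 - K2'"
   and K: "K2 * K2' = 1" "K2' * K2 = 1" "K1' * K2 = K2 * K1'" "K2' * K1' = K1' * K2'"
   and KF: "K1' * F2 = z'*F2*K1'" "K2' * F2 = z*z*F2*K2'"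
   and eK: "e1 * K2 = z * K2 * e1" "e1 * K2' = z' * K2' * e1"
 shows "- (K1' * K2' * (e1 * e2 - z' * e2 * e1)) * F2 - z * F2 * - (K1' * K2' * (e1 * e2 - z' * e2 * e1))
   = (z - z') * - (K1' * e1)"
  by (simp add: algebra_simps z_rules zr[of e1] zr[of e2] zr[of F2] zr[of K2] zr[of K1'] zr[of K2'] eF eF[THEN
      mult_assoc_rule]
    KF KF[THEN mult_assoc_rule] K K[THEN mult_assoc_rule] eK eK[THEN mult_assoc_rule])

text \<open>The elements are opposite root vectors for alpha_2 + alpha_3 in type B_3, built from
  rescaled E's, with z = q_3. The next lemma is the analogue for 2 alpha_2 + alpha_3 in type C_3,
  with z = q_2 and the factors of both root vectors multiplied out by [2].\<close>

lemma root_vector_commutator1: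
  assumes eF: "e2 * F2 = F2 * e2 + K2 - K2'" "e3 * F3 = F3 * e3 + K3 - K3'" "e2 * F3 = F3 * e2" "e3 * F2 = F2 * e3"
   and K: "K2 * K2' = 1" "K2' * K2 = 1" "K3 * K3' = 1" "K3' * K3 = 1"
       "K3 * K2 = K2 * K3" "K3' * K2 = K2 * K3'" "K3 * K2' = K2' * K3" "K3' * K2' = K2' * K3'"
   and KF: "K2 * F2 = z'*z'*z'*z'*F2*K2" "K2' * F2 = z*z*z*z*F2*K2'"
     "K3 * F3 = z'*z'*F3*K3" "K3' * F3 = z*z*F3*K3'"
     "K2 * F3 = z*z*F3*K2" "K2' * F3 = z'*z'*F3*K2'"
     "K3 * F2 = z*z*F2*K3" "K3' * F2 = z'*z'*F2*K3'"
   and eK: "e2 * K2 = z'*z'*z'*z'*K2*e2" "e2 * K2' = z*z*z*z*K2'*e2"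
     "e3 * K3 = z'*z'*K3*e3" "e3 * K3' = z*z*K3'*e3"
     "e3 * K2 = z*z*K2*e3" "e3 * K2' = z'*z'*K2'*e3"
     "e2 * K3 = z*z*K3*e2" "e2 * K3' = z'*z'*K3'*e2"
 shows "(e2*e3 - z'*z'*e3*e2) * (F3*F2 - z*z*F2*F3) = (F3*F2 - z*z*F2*F3) * (e2*e3 - z'*z'*e3*e2)
    + (z*z-z'*z')*(K3 * K2 - K2' * K3')"
  by (simp add: algebra_simps z_rules zr[of e3] zr[of e2] zr[of F2] zr[of F3] zr[of K2] zr[of K3] zr[of K2']
      zr[of K3'] eF eF[THEN mult_assoc_rule]
    KF KF[THEN mult_assoc_rule] K K[THEN mult_assoc_rule] eK eK[THEN mult_assoc_rule])

lemma root_vector_commutator2: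
  assumes eF: "e2 * F2 = F2 * e2 + K2 - K2'" "e3 * F3 = F3 * e3 + K3 - K3'" "e2 * F3 = F3 * e2" "e3 * F2 = F2 * e3"
   and K: "K2 * K2' = 1" "K2' * K2 = 1" "K3 * K3' = 1" "K3' * K3 = 1"
       "K3 * K2 = K2 * K3" "K3' * K2 = K2 * K3'" "K3 * K2' = K2' * K3" "K3' * K2' = K2' * K3'"
   and KF: "K2 * F2 = z'*z'*F2*K2" "K2' * F2 = z*z*F2*K2'"
     "K3 * F3 = z'*z'*z'*z'*F3*K3" "K3' * F3 = z*z*z*z*F3*K3'"
     "K2 * F3 = z*z*F3*K2" "K2' * F3 = z'*z'*F3*K2'"
     "K3 * F2 = z*z*F2*K3" "K3' * F2 = z'*z'*F2*K3'"
   and eK: "e2 * K2 = z'*z'*K2*e2" "e2 * K2' = z*z*K2'*e2"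
     "e3 * K3 = z'*z'*z'*z'*K3*e3" "e3 * K3' = z*z*z*z*K3'*e3"
     "e3 * K2 = z*z*K2*e3" "e3 * K2' = z'*z'*K2'*e3"
     "e2 * K3 = z*z*K3*e2" "e2 * K3' = z'*z'*K3'*e2"
 shows "(e2*e2*e3 - z'*(z+z')*e2*e3*e2 + z'*z'*e3*e2*e2) * (F3*F2*F2 - z*(z+z')*F2*F3*F2 + z*z*F2*F2*F3)
    = (F3*F2*F2 - z*(z+z')*F2*F3*F2 + z*z*F2*F2*F3) * (e2*e2*e3 - z'*(z+z')*e2*e3*e2 + z'*z'*e3*e2*e2)
    + (z*z-z'*z')*(z*z-z'*z')*(K3 * K2 * K2 - K2' * K2' * K3')"
  by (simp add: algebra_simps z_rules zr[of e3] zr[of e2] zr[of F2] zr[of F3] zr[of K2] zr[of K3] zr[of K2']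
      zr[of K3'] eF eF[THEN mult_assoc_rule]
    KF KF[THEN mult_assoc_rule] K K[THEN mult_assoc_rule] eK eK[THEN mult_assoc_rule] mult_2)
end

section \<open>The algebras \<open>U\<^sub>q\<close> as homomorphic images in one ring\<close>

lemma scalar_0 [simp]: "scalar 0 = 0"
  and scalar_1 [simp]: "scalar 1 = 1"
  and scalar_add: "scalar (a + b) = scalar a + scalar b"
  and scalar_mult: "scalar (a * b) = scalar a * scalar b"
  by (simp_all add: scalar_def single_add mult_single zero_list_def plus_list_def flip: single_one)

lemma scalar_minus: "scalar (- a) = - scalar a"
  using scalar_add[of a "-a"] by (simp add: eq_neg_iff_add_eq_0 add.commute)

lemma scalar_diff: "scalar (a - b) = scalar a - scalar b"
  using scalar_add[of a "-b"] by (simp add: scalar_minus)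

lemma scalar_power: "scalar (a ^ n) = scalar a ^ n"
  by (induction n) (simp_all add: scalar_mult)

lemma free_alg_induct [case_names single add]:
  fixes x :: "'i free_alg"
  assumes "\<And>w c. P (Poly_Mapping.single w c)" "\<And>x y. P x \<Longrightarrow> P y \<Longrightarrow> P (x + y)"
  shows "P x"
proof -
  have "P (\<Sum>w\<in>A. Poly_Mapping.single w (Poly_Mapping.lookup x w))" if "finite A" for A
    using that
  proof (induction A)
    case empty
    show ?case using assms(1)[of "[]" 0] by simp
  qed (simp add: assms)
  moreover have "(\<Sum>w\<in>Poly_Mapping.keys x. Poly_Mapping.single w (Poly_Mapping.lookup x w)) = x"
    by (rule poly_mapping_eqI) (simp add: lookup_sum lookup_single when_def not_in_keys_iff_lookup_eq_zero)
  ultimately show ?thesis by (metis finite_keys)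
qed

lemma scalar_commute: "x * scalar c = scalar c * x"
  by (induction x rule: free_alg_induct)
    (simp_all add: scalar_def mult_single plus_list_def mult.commute distrib_left distrib_right)

lemma scalar_left_commute: "x * (scalar c * y) = scalar c * (x * y)"
  by (simp add: scalar_commute flip: mult.assoc)

lemma extend_hom_superset:
  assumes "finite A" "Poly_Mapping.keys x \<subseteq> A"
  shows "extend_hom \<phi> x = (\<Sum>w\<in>A. scalar (Poly_Mapping.lookup x w) * prod_list (map \<phi> w))"
  unfolding extend_hom_def using assms
  by (intro sum.mono_neutral_left) (auto simp: not_in_keys_iff_lookup_eq_zero)

lemma extend_hom_single: "extend_hom \<phi> (Poly_Mapping.single w c) = scalar c * prod_list (map \<phi> w)"
  by (cases "c = 0") (simp_all add: extend_hom_def)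

lemma extend_hom_add: "extend_hom \<phi> (x + y) = extend_hom \<phi> x + extend_hom \<phi> y"
proof -
  let ?A = "Poly_Mapping.keys x \<union> Poly_Mapping.keys y"
  show ?thesis
    using keys_add[of x y]
    by (simp add: extend_hom_superset[of ?A] lookup_add scalar_add distrib_right sum.distrib)
qed

lemma extend_hom_mult: "extend_hom \<phi> (x * y) = extend_hom \<phi> x * extend_hom \<phi> y"
proof (induction x rule: free_alg_induct)
  case (single w c)
  show ?case
  proof (induction y rule: free_alg_induct)
    case (single w' c')
    show ?case
      by (simp add: mult_single extend_hom_single plus_list_def scalar_mult mult.assoc scalar_left_commute[of
          "prod_list (map \<phi> w)"])
  qed (simp add: distrib_left extend_hom_add)
qed (simp add: distrib_right extend_hom_add)

lemma extend_hom_scalar [simp]: "extend_hom \<phi> (scalar c) = scalar c"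
  by (simp add: scalar_def extend_hom_single)

lemma extend_hom_gen [simp]: "extend_hom \<phi> (gen g) = \<phi> g"
  by (simp add: gen_def extend_hom_single)

lemma extend_hom_0 [simp]: "extend_hom \<phi> 0 = 0" and extend_hom_1 [simp]: "extend_hom \<phi> 1 = 1"
  using extend_hom_scalar[of \<phi> 0] extend_hom_scalar[of \<phi> 1] by simp_all

lemma extend_hom_minus: "extend_hom \<phi> (- x) = - extend_hom \<phi> x"
  using extend_hom_add[of \<phi> x "-x"] by (simp add: eq_neg_iff_add_eq_0 add.commute)

lemma extend_hom_diff: "extend_hom \<phi> (x - y) = extend_hom \<phi> x - extend_hom \<phi> y"
  using extend_hom_add[of \<phi> x "-y"] by (simp add: extend_hom_minus)

lemma extend_hom_power: "extend_hom \<phi> (x ^ n) = extend_hom \<phi> x ^ n"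
  by (induction n) (simp_all add: extend_hom_mult)

lemma extend_hom_sum: "extend_hom \<phi> (sum f A) = (\<Sum>a\<in>A. extend_hom \<phi> (f a))"
  by (induction A rule: infinite_finite_induct) (simp_all add: extend_hom_add)

lemmas extend_hom_simps = extend_hom_minus extend_hom_diff extend_hom_power extend_hom_sum
  extend_hom_add extend_hom_mult

section \<open>Congruence modulo the ideal and the product ring\<close>

lemma Uq_ideal_mult_left: "x \<in> Uq_ideal C \<Longrightarrow> a * x \<in> Uq_ideal C"
proof (induction rule: Uq_ideal.induct)
  case (Uq_ideal_rel r b c)
  then show ?case using Uq_ideal.Uq_ideal_rel[of r C "a * b" c] by (simp add: mult.assoc)
qed (simp_all add: Uq_ideal.intros distrib_left)

lemma Uq_ideal_mult_right: "x \<in> Uq_ideal C \<Longrightarrow> x * a \<in> Uq_ideal C"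
proof (induction rule: Uq_ideal.induct)
  case (Uq_ideal_rel r b c)
  then show ?case using Uq_ideal.Uq_ideal_rel[of r C b "c * a"] by (simp add: mult.assoc)
qed (simp_all add: Uq_ideal.intros distrib_right)

lemma Uq_ideal_minus: "x \<in> Uq_ideal C \<Longrightarrow> - x \<in> Uq_ideal C"
  using Uq_ideal_mult_left[of x C "-1"] by simp

lemma Uq_ideal_relation: "r \<in> Uq_relations C \<Longrightarrow> r \<in> Uq_ideal C"
  using Uq_ideal_rel[of r C 1 1] by simp

lemma Uq_eq_refl [simp]: "Uq_eq C x x"
  by (simp add: Uq_eq_def Uq_ideal_zero)

lemma Uq_eq_sym: "Uq_eq C x y \<Longrightarrow> Uq_eq C y x"
  unfolding Uq_eq_def using Uq_ideal_minus by fastforce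

lemma Uq_eq_trans: "Uq_eq C x y \<Longrightarrow> Uq_eq C y z \<Longrightarrow> Uq_eq C x z"
  unfolding Uq_eq_def using Uq_ideal_add[of "x - y" C "y - z"] by simp

lemma Uq_eq_add: "Uq_eq C x y \<Longrightarrow> Uq_eq C x' y' \<Longrightarrow> Uq_eq C (x + x') (y + y')"
  unfolding Uq_eq_def using Uq_ideal_add[of "x - y" C "x' - y'"] by (simp add: algebra_simps)

lemma Uq_eq_minus: "Uq_eq C x y \<Longrightarrow> Uq_eq C (- x) (- y)"
  unfolding Uq_eq_def using Uq_ideal_minus[of "x - y" C] by (simp add: algebra_simps)

lemma Uq_eq_mult: "Uq_eq C x y \<Longrightarrow> Uq_eq C x' y' \<Longrightarrow> Uq_eq C (x * x') (y * y')"
proof -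
  assume "Uq_eq C x y" "Uq_eq C x' y'"
  then have "(x - y) * x' + y * (x' - y') \<in> Uq_ideal C"
    unfolding Uq_eq_def by (intro Uq_ideal_add Uq_ideal_mult_left Uq_ideal_mult_right)
  then show ?thesis by (simp add: Uq_eq_def algebra_simps)
qed

text \<open>A quotient type cannot depend on the matrix \<open>C\<close>. The following ring is the product of all
  the algebras \<open>U\<^sub>q\<close>, with one further factor that makes it visibly nonzero; the algebra for a
  given \<open>C\<close> is studied through the homomorphism whose other components are the counit.\<close>

quotient_type 'i uq = "('i \<Rightarrow> 'i \<Rightarrow> int) option \<Rightarrow> 'i free_alg" /
  "\<lambda>f g. f None = g None \<and> (\<forall>C. Uq_eq C (f (Some C)) (g (Some C)))"
proof (rule equivpI)
  show "reflp (\<lambda>f g :: ('i \<Rightarrow> 'i \<Rightarrow> int) option \<Rightarrow> 'i free_alg. f None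
      = g None \<and> (\<forall>C. Uq_eq C (f (Some C)) (g (Some C))))"
    by (rule reflpI) simp
  show "symp (\<lambda>f g :: ('i \<Rightarrow> 'i \<Rightarrow> int) option \<Rightarrow> 'i free_alg. f None
      = g None \<and> (\<forall>C. Uq_eq C (f (Some C)) (g (Some C))))"
    by (rule sympI) (auto intro: Uq_eq_sym)
  show "transp (\<lambda>f g :: ('i \<Rightarrow> 'i \<Rightarrow> int) option \<Rightarrow> 'i free_alg. f
      None = g None \<and> (\<forall>C. Uq_eq C (f (Some C)) (g (Some C))))"
    by (rule transpI) (auto intro: Uq_eq_trans)
qed

instantiation uq :: (type) ring_1
begin

lift_definition zero_uq :: "'a uq" is "\<lambda>_. 0" .
lift_definition one_uq :: "'a uq" is "\<lambda>_. 1" .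
lift_definition plus_uq :: "'a uq \<Rightarrow> 'a uq \<Rightarrow> 'a uq" is "\<lambda>f g c. f c + g c"
  by (simp add: Uq_eq_add)
lift_definition uminus_uq :: "'a uq \<Rightarrow> 'a uq" is "\<lambda>f c. - f c"
  by (simp add: Uq_eq_minus)
lift_definition minus_uq :: "'a uq \<Rightarrow> 'a uq \<Rightarrow> 'a uq" is "\<lambda>f g c. f c - g c"
  by (metis Uq_eq_add Uq_eq_minus add_uminus_conv_diff)
lift_definition times_uq :: "'a uq \<Rightarrow> 'a uq \<Rightarrow> 'a uq" is "\<lambda>f g c. f c * g c"
  by (simp add: Uq_eq_mult)

instance
  by standard (transfer; simp add: algebra_simps)+

end

fun counit_gen :: "'i generator \<Rightarrow> 'i free_alg" where
  "counit_gen (GE i) = 0"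
| "counit_gen (GF i) = 0"
| "counit_gen (GK i) = 1"
| "counit_gen (GKinv i) = 1"

lemma counit_relation: "r \<in> Uq_relations C \<Longrightarrow> extend_hom counit_gen r = 0"
  by (induction rule: Uq_relations.induct)
    (simp_all add: extend_hom_simps serre_def)

text \<open>The counit rather than 0 fills the other components, so that 1 goes to 1 and a scalar
  becomes the same scalar in every component, which makes it central.\<close>

lift_definition ev :: "('i \<Rightarrow> 'i \<Rightarrow> int) \<Rightarrow> 'i free_alg \<Rightarrow> 'i uq" is
  "\<lambda>C x c. if c = Some C then x else extend_hom counit_gen x" .

lemma ev_add: "ev C (x + y) = ev C x + ev C y"
  and ev_minus: "ev C (- x) = - ev C x"
  and ev_diff: "ev C (x - y) = ev C x - ev C y"
  and ev_mult: "ev C (x * y) = ev C x * ev C y"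
  and ev_0 [simp]: "ev C 0 = 0"
  and ev_1 [simp]: "ev C 1 = 1"
  by (transfer; simp add: extend_hom_simps)+

lemma ev_power: "ev C (x ^ n) = ev C x ^ n"
  by (induction n) (simp_all add: ev_mult)

lemma ev_sum: "ev C (sum f A) = (\<Sum>a\<in>A. ev C (f a))"
  by (induction A rule: infinite_finite_induct) (simp_all add: ev_add)

lemma ev_eqD: "ev C x = ev C y \<Longrightarrow> Uq_eq C x y"
proof transfer
  fix C :: "'i \<Rightarrow> 'i \<Rightarrow> int" and x y
  let ?f = "\<lambda>x c. if c = Some C then x else extend_hom counit_gen x"
  assume "?f x None = ?f y None \<and> (\<forall>C'. Uq_eq C' (?f x (Some C')) (?f y (Some C')))"
  then have "Uq_eq C (?f x (Some C)) (?f y (Some C))" by blast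
  then show "Uq_eq C x y" by simp
qed

text \<open>In the component of \<open>C\<close> the relation lies in the ideal. In all others,
  including \<open>None\<close> where equality is literal, the counit sends it to 0.\<close>

lemma ev_relation: "r \<in> Uq_relations C \<Longrightarrow> ev C r = 0"
proof (transfer, safe)
  fix r :: "'i free_alg" and C C' :: "'i \<Rightarrow> 'i \<Rightarrow> int"
  assume "r \<in> Uq_relations C"
  then show "Uq_eq C' (if Some C' = Some C then r else extend_hom counit_gen r) 0"
    by (simp add: counit_relation Uq_eq_def Uq_ideal_relation Uq_ideal_zero)
qed (simp add: counit_relation)

lemmas ev_simps = ev_add ev_minus ev_diff ev_mult ev_power ev_sum

lemma ev_scalar_commute: "x * ev C (scalar c) = ev C (scalar c) * x"
  by transfer (simp add: scalar_commute)

lemma ev_scalar_cancel: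
  assumes "c \<noteq> 0" "ev C (scalar c) * x = 0"
  shows "x = 0"
proof -
  have "ev C (scalar (inverse c * c)) * x = 0"
    by (simp only: scalar_mult ev_mult mult.assoc assms mult_zero_right)
  then show ?thesis using assms(1) by simp
qed

abbreviation sc :: "('i \<Rightarrow> 'i \<Rightarrow> int) \<Rightarrow> ratfun \<Rightarrow> 'i uq" where
  "sc C c \<equiv> ev C (scalar c)"

lemma sc_add: "sc C (a + b) = sc C a + sc C b"
  and sc_diff: "sc C (a - b) = sc C a - sc C b"
  and sc_minus: "sc C (- a) = - sc C a"
  and sc_mult: "sc C (a * b) = sc C a * sc C b"
  and sc_power: "sc C (a ^ n) = sc C a ^ n"
  by (simp_all add: scalar_add scalar_diff scalar_minus scalar_mult scalar_power ev_simps)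

lemmas sc_simps = sc_add sc_diff sc_minus sc_mult sc_power

lemma sc_left_commute: "x * (sc C c * y) = sc C c * (x * y)"
  by (simp add: ev_scalar_commute[of x] flip: mult.assoc)

lemma sc_inverse: "c \<noteq> 0 \<Longrightarrow> sc C c * sc C (inverse c) = 1"
  by (simp flip: sc_mult)

lemma sc_central_unit: "c \<noteq> 0 \<Longrightarrow> central_unit (sc C c) (sc C (inverse c))"
  by standard (erule sc_inverse, rule ev_scalar_commute, rule ev_scalar_commute)

lemma sc_cancel: "c \<noteq> 0 \<Longrightarrow> sc C c * x = sc C c * y \<Longrightarrow> x = y"
  using ev_scalar_cancel[of c C "x - y"] by (simp add: right_diff_distrib)

section \<open>Parameters that are not roots of unity, and small divided powers\<close>

definition generic :: "ratfun \<Rightarrow> bool" where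
  "generic q \<longleftrightarrow> q \<noteq> 0 \<and> (\<forall>n>0. q ^ n \<noteq> 1)"

lemma generic_power: "generic q \<Longrightarrow> n > 0 \<Longrightarrow> generic (q ^ n)"
  by (simp add: generic_def flip: power_mult)

lemma generic_q_var: "generic q_var"
proof -
  have "q_var ^ n = Fract ([:0, 1:] ^ n) 1" for n
    by (induction n) (simp_all add: q_var_def One_fract_def)
  moreover have "[:0, 1:] ^ n \<noteq> (1 :: complex poly)" if "n > 0" for n
  proof
    assume "[:0, 1:] ^ n = (1 :: complex poly)"
    then have "degree ([:0, 1:] ^ n :: complex poly) = 0" by simp
    then show False using that by (simp add: degree_power_eq)
  qed
  ultimately show ?thesis
    unfolding generic_def q_var_def by (auto simp: One_fract_def Zero_fract_def eq_fract)
qed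

lemma generic_qi: "eps C i > 0 \<Longrightarrow> generic (qi C i)"
  unfolding qi_def by (rule generic_power[OF generic_q_var])

text \<open>Apart from q itself, each quantity is, up to a power of q, a divisor of q^n - 1 for n =
  2, 4 or 6. These are the q-integers to be cancelled and the factors of the coefficients that must
  not vanish.\<close>

lemma genericD:
  assumes "generic q"
  shows "q \<noteq> 0" "q\<^sup>2 \<noteq> 1" "q * q \<noteq> 1" "q - inverse q \<noteq> 0" "q + inverse q \<noteq> 0"
    "q * q + 1 + inverse q * inverse q \<noteq> 0" "q^2 + 1 \<noteq> 0" "q^4 \<noteq> 1"
proof -
  have n: "q ^ n \<noteq> 1" if "n > 0" for n using assms that by (simp add: generic_def)
  show q: "q \<noteq> 0" using assms by (simp add: generic_def)
  show q2: "q\<^sup>2 \<noteq> 1" "q^4 \<noteq> 1" using n[of 2] n[of 4] by simp_all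
  then show "q * q \<noteq> 1" by (simp add: power2_eq_square)
  then show "q - inverse q \<noteq> 0" using q by (simp add: field_simps)
  have "q ^ 4 - 1 = (q * q - 1) * (q * q + 1)" by (simp add: algebra_simps eval_nat_numeral)
  then have p: "q * q + 1 \<noteq> 0" using n[of 4] by auto
  then show "q + inverse q \<noteq> 0" "q^2 + 1 \<noteq> 0" using q by (auto simp: field_simps power2_eq_square)
  have "q ^ 6 - 1 = (q * q - 1) * (q^4 + q * q + 1)" by (simp add: algebra_simps eval_nat_numeral)
  then have "q^4 + q * q + 1 \<noteq> 0" using n[of 6] by auto
  then show "q * q + 1 + inverse q * inverse q \<noteq> 0"
    using q by (auto simp: field_simps eval_nat_numeral)
qed

lemma qfact_small:
  assumes "generic q"
  shows "qfact q 0 = 1" "qfact q (Suc 0) = 1" "qfact q 2 = q + inverse q"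
    "qfact q 3 = (q + inverse q) * (q * q + 1 + inverse q * inverse q)"
proof -
  note q = genericD[OF assms]
  show "qfact q 0 = 1" "qfact q (Suc 0) = 1" using q by (simp_all add: qfact_def)
  have d: "(q * x - inverse q * y) / (q - inverse q) = t" if "q * x - inverse q * y = t * (q - inverse q)" for x y t
    using that q(4) by simp
  have 2: "(q^2 - (inverse q)^2) / (q - inverse q) = q + inverse q"
    unfolding power2_eq_square using q(4) by (simp add: field_simps)
  show "qfact q 2 = q + inverse q" using 2 q by (simp add: qfact_def numeral_2_eq_2)
  have 3: "(q^3 - (inverse q)^3) / (q - inverse q) = q * q + 1 + inverse q * inverse q"
    unfolding power3_eq_cube using q by (simp add: nonzero_divide_eq_eq algebra_simps)
  show "qfact q 3 = (q + inverse q) * (q * q + 1 + inverse q * inverse q)"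
    using 2 3 q by (simp add: qfact_def numeral_3_eq_3 numeral_2_eq_2)
qed

lemmas qfact_Suc = qfact_small(1,2) qfact_small(3)[unfolded numeral_2_eq_2]

definition uq_divpow :: "('i \<Rightarrow> 'i \<Rightarrow> int) \<Rightarrow> ratfun \<Rightarrow> 'i uq
    \<Rightarrow> nat \<Rightarrow> 'i uq" where
  "uq_divpow C p x m = sc C (inverse (qfact p m)) * x ^ m"

text \<open>Lusztig's formula for T_i(F_j), with p = q_i and n = -c_ij, but with arbitrary elements
  in place of F_i and F_j, so that root vectors can be inserted.\<close>

definition lusztig_F :: "('i \<Rightarrow> 'i \<Rightarrow> int) \<Rightarrow> ratfun \<Rightarrow> nat
    \<Rightarrow> 'i uq \<Rightarrow> 'i uq \<Rightarrow> 'i uq" where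
  "lusztig_F C p n x y = (\<Sum>r\<le>n. (- 1) ^ r * sc C (p ^ r) * uq_divpow C p x r * y * uq_divpow C p x (n - r))"

definition uq_serre :: "('i \<Rightarrow> 'i \<Rightarrow> int) \<Rightarrow> ratfun \<Rightarrow> nat
    \<Rightarrow> 'i uq \<Rightarrow> 'i uq \<Rightarrow> 'i uq" where
  "uq_serre C p n x y = (\<Sum>r\<le>n. (- 1) ^ r * uq_divpow C p x (n - r) * y * uq_divpow C p x r)"

lemma lusztig_F_0 [simp]: "generic p \<Longrightarrow> lusztig_F C p 0 x y = y"
  by (simp add: lusztig_F_def uq_divpow_def qfact_small)

lemma lusztig_F_1: "generic p \<Longrightarrow> lusztig_F C p (Suc 0) x y = y * x - sc C p * x * y"
  by (simp add: lusztig_F_def uq_divpow_def qfact_small)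

text \<open>Multiplication by [2] clears the divided powers and produces the polynomial expressions
  to which the identities over a central unit apply.\<close>

lemma lusztig_F_2:
  assumes "generic p"
  shows "sc C (p + inverse p) * lusztig_F C p 2 x y =
    y * x * x - sc C p * (sc C p + sc C (inverse p)) * x * y * x + sc C p * sc C p * x * x * y"
proof -
  let ?t = "sc C (p + inverse p)" and ?t' = "sc C (inverse (p + inverse p))"
  have t: "?t * ?t' = 1" using genericD(5)[OF assms] by (rule sc_inverse)
  have t2: "?t * (?t' * a) = a" for a using t by (simp flip: mult.assoc)
  note [simp] = sc_left_commute[of x] sc_left_commute[of y] sc_left_commute[of "sc C p" C "inverse (p + inverse p)"]
  have "?t * lusztig_F C p 2 x y = ?t * (y * (?t' * (x * x)) - sc C p * x * y * x + sc C p * sc C p * (?t' * (x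
      * x)) * y)"
    using assms by (simp add: lusztig_F_def uq_divpow_def qfact_Suc numeral_2_eq_2 sc_mult mult.assoc)
  also have "\<dots> = y * x * x - sc C p * ?t * x * y * x + sc C p * sc C p * x * x * y"
    by (simp add: right_diff_distrib distrib_left mult.assoc sc_left_commute[of ?t C p] t2)
  finally show ?thesis by (simp add: sc_add)
qed

lemma uq_serre_1: "generic p \<Longrightarrow> uq_serre C p (Suc 0) x y = x * y - y * x"
  by (simp add: uq_serre_def uq_divpow_def qfact_small)

lemma uq_serre_2:
  assumes "generic p"
  shows "sc C (p + inverse p) * uq_serre C p 2 x y =
    x * x * y - (sc C p + sc C (inverse p)) * x * y * x + y * x * x"
proof -
  let ?t = "sc C (p + inverse p)" and ?t' = "sc C (inverse (p + inverse p))"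
  have t: "?t * ?t' = 1" using genericD(5)[OF assms] by (rule sc_inverse)
  have t2: "?t * (?t' * a) = a" for a using t by (simp flip: mult.assoc)
  have "?t * uq_serre C p 2 x y = ?t * (?t' * (x * x) * y - x * y * x + y * (?t' * (x * x)))"
    using assms by (simp add: uq_serre_def uq_divpow_def qfact_Suc numeral_2_eq_2 mult.assoc)
  also have "\<dots> = x * x * y - ?t * x * y * x + y * x * x"
    by (simp add: right_diff_distrib distrib_left mult.assoc sc_left_commute[of y] t2)
  finally show ?thesis by (simp add: sc_add)
qed

lemma uq_serre_3:
  fixes C :: "'i \<Rightarrow> 'i \<Rightarrow> int" and x y :: "'i uq"
  assumes "generic p"
  defines "t \<equiv> sc C p * sc C p + 1 + sc C (inverse p) * sc C (inverse p)"
  shows "sc C (qfact p 3) * uq_serre C p 3 x y =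
    x * x * x * y - t * x * x * y * x + t * x * y * x * x - y * x * x * x"
proof -
  let ?u = "sc C (qfact p 3)" and ?u' = "sc C (inverse (qfact p 3))" 
  let ?v' = "sc C (inverse (qfact p 2))"
  have nz: "qfact p 3 \<noteq> 0" "qfact p 2 \<noteq> 0" using genericD[OF assms(1)] by (simp_all add:
      qfact_small[OF assms(1)])
  have "?u * ?u' = 1" using nz(1) by (rule sc_inverse)
  then have u: "?u * (?u' * a) = a" for a by (simp flip: mult.assoc)
  have "qfact p 3 * inverse (qfact p 2) = p * p + 1 + inverse p * inverse p"
    using nz by (simp add: qfact_small[OF assms(1)])
  then have "?u * ?v' = t" unfolding t_def by (metis sc_add sc_mult ev_1 scalar_1)
  then have v: "?u * (?v' * a) = t * a" for a by (simp flip: mult.assoc)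
  have "?u * uq_serre C p 3 x y = ?u * (?u' * (x * (x * x)) * y - ?v' * (x * x) * y * x + x * y * (?v' * (x *
      x)) - y * (?u' * (x * (x * x))))"
    using assms by (simp add: uq_serre_def uq_divpow_def qfact_small(1,2)[OF assms(1)] eval_nat_numeral mult.assoc)
  also have "\<dots> = x * x * x * y - t * x * x * y * x + t * x * y * x * x - y * x * x * x"
    by (simp add: right_diff_distrib distrib_left mult.assoc sc_left_commute[of y] sc_left_commute[of x] u v)
  finally show ?thesis .
qed

section \<open>Lusztig's formulas in rank two and three\<close>

lemma sc_split: "t \<noteq> 0 \<Longrightarrow> sc C k = sc C t * sc C (inverse t * k)"
  by (simp flip: sc_mult mult.assoc)

text \<open>\<open>q\<^sub>2\<close> and \<open>q\<^sub>3\<close> belong to two nodes joined by an edge with Cartan entries \<open>-m\<close> and \<open>-b\<close>.\<close>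

definition rank2_edge :: "ratfun \<Rightarrow> ratfun \<Rightarrow> nat \<Rightarrow> nat \<Rightarrow> bool" where
  "rank2_edge q2 q3 m b \<longleftrightarrow> generic q2 \<and> generic q3 \<and>
     (m = 1 \<and> b = 1 \<and> q3 = q2 \<or> m = 1 \<and> b = 2 \<and> q2 = q3 * q3 \<or> m = 2 \<and> b = 1
         \<and> q3 = q2 * q2)"

lemma rank2_edge_m: "rank2_edge q2 q3 m b \<Longrightarrow> m = 1 \<or> m = 2"
  by (auto simp: rank2_edge_def)

lemma uq_serre_2_iff:
  assumes "generic q"
  shows "uq_serre C q 2 x y = 0 \<longleftrightarrow> x * x * y - (sc C q + sc C (inverse q)) * x * y * x + y *
      x * x = 0"
  using uq_serre_2[OF assms, of C x y] genericD(5)[OF assms] by (metis ev_scalar_cancel mult_zero_right)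

lemma uq_serre_3_iff:
  assumes "generic q"
  shows "uq_serre C q 3 x y = 0 \<longleftrightarrow> x * x * x * y - (sc C q * sc C q + 1 + sc C (inverse q) *
      sc C (inverse q)) * x * x * y * x
     + (sc C q * sc C q + 1 + sc C (inverse q) * sc C (inverse q)) * x * y * x * x - y * x * x * x = 0"
proof -
  have "qfact q 3 \<noteq> 0" using genericD[OF assms] by (simp add: qfact_small[OF assms])
  then show ?thesis using uq_serre_3[OF assms, of C x y] by (metis ev_scalar_cancel mult_zero_right)
qed

text \<open>For the word starting with 12132 the role of F_2 is played by T_1(F_2), which is
  \<open>x\<close> here; its Serre relation with F_3 is derived from that of F_2.\<close>

lemma uq_serre_lift:
  assumes q: "generic q" and m: "m = 1 \<or> m = 2"
    and 21: "x = f2 * f1 - sc C q * f1 * f2" and x1: "x * f1 = sc C (inverse q) * f1 * x" and 31: "f3 * f1 = f1 * f3"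
    and S: "uq_serre C q (Suc m) f2 f3 = 0"
  shows "uq_serre C q (Suc m) x f3 = 0"
proof -
  interpret central_unit "sc C q" "sc C (inverse q)" using genericD(1)[OF q] by (rule sc_central_unit)
  have f21: "f2 * f1 = sc C q * f1 * f2 + x" using 21 by simp
  from m show ?thesis
  proof
    assume m: "m = 1"
    show ?thesis
      using serre_lift1[OF f21 x1 31] S genericD(5)[OF q] uq_serre_2_iff[OF q]
      by (auto simp: m numeral_2_eq_2 simp flip: sc_add dest!: ev_scalar_cancel[rotated])
  next
    assume m: "m = 2"
    let ?t = "q * q + 1 + inverse q * inverse q"
    have "?t * (q + inverse q) \<noteq> 0" using genericD[OF q] by simp
    moreover have "sc C (?t * (q + inverse q)) = 
      (sc C q * sc C q + 1 + sc C (inverse q) * sc C (inverse q)) * (sc C q + sc C (inverse q))"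
      by (simp add: sc_add sc_mult)
    ultimately show ?thesis
      using serre_lift2[OF f21 x1 31] S uq_serre_3_iff[OF q, of C]
      by (metis Suc_1 eval_nat_numeral(3) ev_scalar_cancel m)
  qed
qed

text \<open>The second conclusion is the Serre relation read as a q-commutation rule; the first
  comes from applying skew derivations by \<open>f2\<close> to f1 f3 - f3 f1 = 0. For m = 2 both are
  obtained for [2] Q, and [2] is then cancelled.\<close>

lemma lusztig_F_commutations:
  assumes q: "generic q" and m: "m = 1 \<or> m = 2"
    and 12: "f1 * f2 = sc C q * f2 * f1 + y" and y2: "y * f2 = sc C (inverse q) * f2 * y"
    and 13: "f1 * f3 = f3 * f1" and S: "uq_serre C q (Suc m) f2 f3 = 0"
  defines "Q \<equiv> lusztig_F C q m f2 f3"
  shows "y * Q = Q * y" "Q * f2 = sc C (inverse (q ^ m)) * f2 * Q"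
proof -
  interpret central_unit "sc C q" "sc C (inverse q)" using genericD(1)[OF q] by (rule sc_central_unit)
  have "y * Q = Q * y \<and> Q * f2 = sc C (inverse (q ^ m)) * f2 * Q"
    using m
  proof
    assume m: "m = 1"
    have Q: "Q = f3 * f2 - sc C q * f2 * f3" unfolding Q_def m using lusztig_F_1[OF q] by simp
    have S': "f2 * f2 * f3 - (sc C q + sc C (inverse q)) * f2 * f3 * f2 + f3 * f2 * f2 = 0"
      using S uq_serre_2_iff[OF q, of C f2 f3] by (simp add: m numeral_2_eq_2)
    have Q2: "Q * f2 = sc C (inverse q) * f2 * Q"
      using serre_q1(1)[OF S'] by (simp add: Q)
    have "(sc C q + sc C (inverse q)) * (y * Q - Q * y) = 0"
      by (rule serre_comm1[OF 12 y2 _ Q2 13]) (simp add: Q)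
    then have "y * Q - Q * y = 0" using genericD(5)[OF q] ev_scalar_cancel by (metis sc_add)
    with Q2 m show ?thesis by simp
  next
    assume m: "m = 2"
    let ?x = "sc C (q + inverse q) * Q"
    have Q: "?x = f3 * f2 * f2 - sc C q * (sc C q + sc C (inverse q)) * f2 * f3 * f2 + sc C q * sc C q * f2 * f2 * f3"
      unfolding Q_def m by (rule lusztig_F_2[OF q])
    have S': "f2*f2*f2*f3 - (sc C q * sc C q + 1 + sc C (inverse q) * sc C (inverse q)) * f2*f2*f3*f2 + (sc C q
        * sc C q + 1 + sc C (inverse q) * sc C (inverse q)) * f2*f3*f2*f2 - f3*f2*f2*f2 = 0"
      using S uq_serre_3_iff[OF q, of C f2 f3] by (simp add: m eval_nat_numeral)
    have x2: "?x * f2 = sc C (inverse q) * sc C (inverse q) * f2 * ?x"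
      using serre_q2[OF S'] by (simp add: Q)
    have "(sc C q * sc C q + 1 + sc C (inverse q) * sc C (inverse q)) * (y * ?x - ?x * y) = 0"
      by (rule serre_comm2[OF 12 y2 _ _ x2 13, of "f3 * f2 - sc C q * sc C q * f2 * f3"])
        (simp, unfold Q, rule r_step)
    then have "sc C (q * q + 1 + inverse q * inverse q) * (y * ?x - ?x * y) = 0"
      by (simp add: sc_add sc_mult)
    then have "y * ?x - ?x * y = 0" using genericD(6)[OF q] ev_scalar_cancel by blast
    then have "sc C (q + inverse q) * (y * Q) = sc C (q + inverse q) * (Q * y)"
      by (simp add: sc_left_commute[of y] mult.assoc)
    then have yQ: "y * Q = Q * y" using genericD(5)[OF q] sc_cancel by blast
    have "sc C (q + inverse q) * (Q * f2) = sc C (q + inverse q) * (sc C (inverse (q ^ m)) * f2 * Q)"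
      using x2 by (simp add: m mult.assoc sc_left_commute[of f2] power2_eq_square sc_mult
          sc_left_commute[of "sc C (inverse q)" C "q + inverse q"])
    then have "Q * f2 = sc C (inverse (q ^ m)) * f2 * Q" using genericD(5)[OF q] sc_cancel by blast
    with yQ show ?thesis by simp
  qed
  then show "y * Q = Q * y" "Q * f2 = sc C (inverse (q ^ m)) * f2 * Q" by simp_all
qed

text \<open>Common source of the inequalities for the words starting with 2132 and 12132: the right
  side beyond the q-commutation term is one monomial, \<open>y\<close> times the b-th power of
  \<open>Q\<close>.\<close>

lemma lusztig_F_q_commutator:
  assumes e: "rank2_edge q2 q3 m b"
    and 12: "f1 * f2 = sc C q2 * f2 * f1 + y" and y2: "y * f2 = sc C (inverse q2) * f2 * y"
    and 13: "f1 * f3 = f3 * f1" and S: "uq_serre C q2 (Suc m) f2 f3 = 0"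
  defines "Q \<equiv> lusztig_F C q2 m f2 f3"
  defines "G \<equiv> lusztig_F C q3 b Q f1"
  shows "\<exists>k. k \<noteq> 0 \<and> G * f2 = sc C (if m * b = 1 then 1 else inverse q2) * f2 * G + sc C k
      * (y * Q ^ b)"
proof -
  have q: "generic q2" "generic q3" and m: "m = 1 \<or> m = 2" using e by (auto simp: rank2_edge_def)
  note c = lusztig_F_commutations[OF q(1) m 12 y2 13 S, folded Q_def]
  interpret q2: central_unit "sc C q2" "sc C (inverse q2)" using genericD(1)[OF q(1)] by (rule sc_central_unit)
  interpret q3: central_unit "sc C q3" "sc C (inverse q3)" using genericD(1)[OF q(2)] by (rule sc_central_unit)
  show ?thesis
  proof (cases "b = 1")
    case True
    \<comment> \<open>The case b = 1 covers A_3 (m = 1) and C_3 (m = 2).\<close>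
    have w: "q2 ^ m = q3" using e by (auto simp: rank2_edge_def True power2_eq_square)
    have G: "G = f1 * Q - sc C q3 * Q * f1" unfolding G_def True using lusztig_F_1[OF q(2)] by simp
    have "inverse q3 - q3 \<noteq> 0" using genericD(4)[OF q(2)] by (metis diff_eq_diff_eq diff_self)
    moreover have "G * f2 = sc C (inverse q3) * sc C q2 * f2 * G + (sc C (inverse q3) - sc C q3) * y * Q"
      unfolding G
      by (rule q2.q_commutator_b1[OF q3.central_unit_axioms 12 _ c(1)]) (use c(2) w in simp)
    moreover have "inverse q3 * q2 = (if m * b = 1 then 1 else inverse q2)"
      using genericD(1)[OF q(1)] m by (auto simp: True w[symmetric] power2_eq_square)
    ultimately show ?thesis using True by (intro exI[of _ "inverse q3 - q3"]) (simp add: sc_diff mult.assoc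
        flip: sc_mult)
  next
    case False
    then have [simp]: "b = 2" "m = 1" "q2 = q3 * q3" using e by (auto simp: rank2_edge_def)
    \<comment> \<open>The constant of \<open>q_commutator_b2\<close>, which describes [2] G;
      dividing it by [2] gives the coefficient for \<open>G\<close> itself.\<close>
    let ?k = "inverse q3 ^ 4 * (1 - q3 ^ 2) * (1 - q3 ^ 4)" and ?t = "q3 + inverse q3"
    have G: "sc C ?t * G = f1 * Q * Q - sc C q3 * (sc C q3 + sc C (inverse q3)) * Q * f1 * Q + sc C q3 * sc C
        q3 * Q * Q * f1"
      unfolding G_def using lusztig_F_2[OF q(2)] by simp
    have t: "?t \<noteq> 0" using genericD(5)[OF q(2)] .
    have "sc C ?t * G * f2 = sc C (inverse q3) * sc C (inverse q3) * f2 * (sc C ?t * G) + sc C (inverse q3) *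
        sc C (inverse q3) * 
      sc C (inverse q3) * sc C (inverse q3) * (1 - sc C q3 * sc C q3) * (1 - sc C q3 * sc C q3 * sc C q3 * sc C
          q3) * y * Q * Q"
      unfolding G
      by (rule q3.q_commutator_b2[OF _ _ c(1)]) (use 12 c(2) in \<open>simp_all add: sc_mult\<close>)
    also have "\<dots> = sc C (inverse q2) * f2 * (sc C ?t * G) + sc C ?k * (y * Q ^ b)"
      by (simp add: sc_simps power2_eq_square mult.assoc eval_nat_numeral)
    also have "\<dots> = sc C ?t * (sc C (inverse q2) * f2 * G + sc C (inverse ?t * ?k) * (y * Q ^ b))"
    proof -
      have "sc C ?k = sc C ?t * sc C (inverse ?t * ?k)"  using t by (rule sc_split)
      then show ?thesis
        by (simp add: distrib_left mult.assoc sc_left_commute[of f2] sc_left_commute[of "sc C (inverse (q3 *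
            q3))" C ?t]
          del: inverse_mult_distrib)
    qed
    finally have "G * f2 = sc C (inverse q2) * f2 * G + sc C (inverse ?t * ?k) * (y * Q ^ b)"
      using sc_cancel[OF t, of C] by (simp add: mult.assoc)
    moreover have "inverse ?t * ?k \<noteq> 0" using t genericD[OF q(2)] by simp
    ultimately show ?thesis by (intro exI[of _ "inverse ?t * ?k"]) simp
  qed
qed

lemma lusztig_F_q_commute_C3:
  assumes q: "generic q"
    and 12: "f1 * f2 = sc C q * f2 * f1 + y" and y2: "y * f2 = sc C (inverse q) * f2 * y"
    and 13: "f1 * f3 = f3 * f1" and S: "uq_serre C q 3 f2 f3 = 0" and S': "uq_serre C (q * q) 2 f3 f2 = 0"
  defines "Q \<equiv> lusztig_F C q 2 f2 f3"
  defines "G \<equiv> lusztig_F C (q * q) 1 Q f1"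
  shows "G * Q = sc C (inverse q) * sc C (inverse q) * Q * G"
proof -
  interpret central_unit "sc C q" "sc C (inverse q)" using genericD(1)[OF q] by (rule sc_central_unit)
  note qq = generic_power[OF q, of 2, unfolded power2_eq_square, simplified]
  note c = lusztig_F_commutations[OF q _ 12 y2 13, of 2, folded Q_def, simplified, OF S]
  let ?t = "q + inverse q"
  let ?x = "sc C ?t * Q"
  have Q: "?x = f3 * f2 * f2 - sc C q * (sc C q + sc C (inverse q)) * f2 * f3 * f2 + sc C q * sc C q * f2 * f2 * f3"
    unfolding Q_def by (rule lusztig_F_2[OF q])
  have G: "G = f1 * Q - sc C q * sc C q * Q * f1" unfolding G_def using lusztig_F_1[OF qq] by (simp add: sc_mult)
  have x: "f1 * ?x - sc C q * sc C q * ?x * f1 = sc C ?t * G"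
    by (simp add: G right_diff_distrib mult.assoc sc_left_commute[of f1] sc_left_commute[of "sc C q" C ?t])
  have x2: "?x * f2 = sc C (inverse q) * sc C (inverse q) * f2 * ?x"
    using c(2) by (simp add: mult.assoc sc_left_commute[of f2] power2_eq_square sc_mult
          sc_left_commute[of "sc C (inverse q)" C "q + inverse q"])
  have yx: "y * ?x = ?x * y" using c(1) by (simp add: sc_left_commute[of y] mult.assoc)
  have S'': "f3 * f3 * f2 - (sc C q * sc C q + sc C (inverse q) * sc C (inverse q)) * f3 * f2 * f3 + f2 * f3 * f3 = 0"
    using S' unfolding uq_serre_2_iff[OF qq] by (simp add: sc_mult)
  have "sc C ?t * G * ?x = sc C (inverse q) * sc C (inverse q) * ?x * (sc C ?t * G)"
    unfolding x[symmetric]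
    by (rule C3_q_commute[OF 12 y2 _ _ x2 13 yx S'', of "f3 * f2 - sc C q * sc C q * f2 * f3"])
        (simp, unfold Q, rule r_step)
  then have "sc C ?t * (sc C ?t * (G * Q)) = sc C ?t * (sc C ?t * (sc C (inverse q) * sc C (inverse q) * Q * G))"
    by (simp add: mult.assoc sc_left_commute[of G] sc_left_commute[of Q]  sc_left_commute[of "sc C (inverse q)" C ?t])
  then show ?thesis using genericD(5)[OF q] sc_cancel by blast
qed

text \<open>In this lemma and the next, \<open>A\<close> stands for the value of T_2 T_1 T_3 F_3 and
  \<open>M\<close> for the square of its torus factor; the term k (1 - M) comes from the commutator
  of opposite root vectors.\<close>

lemma lusztig_F_commutator_C3:
  assumes q: "generic q"
    and AQ: "A * Q = sc C (q ^ 4) * Q * A + sc C k * (1 - M)" and GQ: "G * Q = sc C (inverse q) * sc C (inverse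
        q) * Q * G"
    and MG: "M * G = sc C (q ^ 4) * G * M" and k: "k \<noteq> 0"
  shows "\<exists>k. k \<noteq> 0 \<and> lusztig_F C q 2 G A * Q = Q * lusztig_F C q 2 G A + sc C k * G\<^sup>2"
proof -
  interpret central_unit "sc C q" "sc C (inverse q)" using genericD(1)[OF q] by (rule sc_central_unit)
  let ?t = "q + inverse q" and ?k = "k * (q^2-1) * (1-inverse q ^ 4)"
  have t: "?t \<noteq> 0" using genericD(5)[OF q] .
  have q4: "sc C (q ^ 4) = sc C q * sc C q * sc C q * sc C q" by (simp add: sc_mult eval_nat_numeral mult.assoc)
  have "sc C ?t * lusztig_F C q 2 G A * Q = Q * (sc C ?t * lusztig_F C q 2 G A) +
     sc C k * (sc C q * sc C q - 1) * (1 - sc C (inverse q) * sc C (inverse q) * sc C (inverse q) * sc C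
         (inverse q)) * G * G"
    unfolding lusztig_F_2[OF q]
    by (rule C3_commutator[OF AQ[unfolded q4] GQ MG[unfolded q4] ev_scalar_commute])
  also have "\<dots> = Q * (sc C ?t * lusztig_F C q 2 G A) + sc C ?k * G\<^sup>2"
    by (simp add: sc_simps power2_eq_square mult.assoc eval_nat_numeral)
  also have "\<dots> = sc C ?t * (Q * lusztig_F C q 2 G A + sc C (inverse ?t * ?k) * G\<^sup>2)"
  proof -
    have "sc C ?k = sc C ?t * sc C (inverse ?t * ?k)"  using t by (rule sc_split)
    then show ?thesis
      by (simp add: distrib_left mult.assoc sc_left_commute[of Q])
  qed
  finally have "lusztig_F C q 2 G A * Q = Q * lusztig_F C q 2 G A + sc C (inverse ?t * ?k) * G\<^sup>2"
    using sc_cancel[OF t, of C] by (simp add: mult.assoc)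
  moreover have "inverse ?t * ?k \<noteq> 0" using t genericD[OF q] k by (simp add: power_inverse)
  ultimately show ?thesis by (intro exI[of _ "inverse ?t * ?k"]) simp
qed

lemma lusztig_F_commutator_B3:
  assumes q: "generic q"
    and AQ: "A * Q = sc C (q ^ 2) * Q * A + sc C k * (1 - M)" and A1: "A * f1 = sc C (inverse q) * sc C
        (inverse q) * f1 * A"
    and MQ: "M * Q = sc C (q ^ 4) * Q * M"
    and M1: "M * f1 = sc C (inverse q) * sc C (inverse q) * sc C (inverse q) * sc C (inverse q) * f1 * M" and
        k: "k \<noteq> 0"
  defines "G \<equiv> lusztig_F C q 2 Q f1"
  shows "\<exists>k. k \<noteq> 0 \<and> lusztig_F C (q * q) 1 G A * Q = Q * lusztig_F C (q * q) 1 G A + sc C k * G"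
proof -
  interpret central_unit "sc C q" "sc C (inverse q)" using genericD(1)[OF q] by (rule sc_central_unit)
  note qq = generic_power[OF q, of 2, unfolded power2_eq_square, simplified]
  let ?t = "q + inverse q" and ?k = "k * (q^2+1) * (inverse q ^ 2 - 1)"
  have t: "?t \<noteq> 0" using genericD(5)[OF q] .
  have G: "f1*Q*Q - sc C q *(sc C q + sc C (inverse q))*Q*f1*Q + sc C q * sc C q *Q*Q*f1 = sc C ?t * G"
    unfolding G_def by (rule lusztig_F_2[OF q, symmetric])
  have P: "lusztig_F C (q * q) 1 G A = A * G - sc C q * sc C q * G * A" using lusztig_F_1[OF qq] by (simp add:
      sc_mult)
  have q4: "sc C (q ^ 4) = sc C q * sc C q * sc C q * sc C q" "sc C (q\<^sup>2) = sc C q * sc C q" 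
    by (simp_all add: sc_mult eval_nat_numeral mult.assoc)
  have "(A * (sc C ?t * G) - sc C q * sc C q * (sc C ?t * G) * A) * Q = Q * (A * (sc C ?t * G) - sc C q * sc C
      q * (sc C ?t * G) * A) +
    sc C k * (sc C q * sc C q + 1) * (sc C (inverse q) * sc C (inverse q) - 1) * (sc C ?t * G)"
    unfolding G[symmetric]
    by (rule B3_commutator[OF AQ[unfolded q4] A1 MQ[unfolded q4] M1 ev_scalar_commute])
  then have "sc C ?t * (lusztig_F C (q * q) 1 G A * Q) = sc C ?t * (Q * lusztig_F C (q * q) 1 G A
     + (sc C k * (sc C q * sc C q + 1) * (sc C (inverse q) * sc C (inverse q) - 1)) * G)"
    unfolding P by (simp add: algebra_simps sc_left_commute[of _ C ?t])
  then have "lusztig_F C (q * q) 1 G A * Q = Q * lusztig_F C (q * q) 1 G A + sc C ?k * G"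
    using sc_cancel[OF t, of C] by (simp add: sc_simps power2_eq_square mult.assoc)
  moreover have "?k \<noteq> 0" using genericD[OF q] k by (simp add: power_inverse)
  ultimately show ?thesis by blast
qed

section \<open>Homomorphisms on the free algebra and q-commutation rules\<close>

locale Uq_hom =
  fixes C :: "'i \<Rightarrow> 'i \<Rightarrow> int" and \<psi> :: "'i free_alg \<Rightarrow> 'i uq"
  assumes hom_add: "\<psi> (x + y) = \<psi> x + \<psi> y"
    and hom_mult: "\<psi> (x * y) = \<psi> x * \<psi> y"
    and hom_scalar: "\<psi> (scalar c) = sc C c"
begin

lemma hom_0: "\<psi> 0 = 0" and hom_1: "\<psi> 1 = 1"
  using hom_scalar[of 0] hom_scalar[of 1] by simp_all

lemma hom_minus: "\<psi> (- x) = - \<psi> x"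
  using hom_add[of x "-x"] by (simp add: hom_0 eq_neg_iff_add_eq_0 add.commute)

lemma hom_power: "\<psi> (x ^ n) = \<psi> x ^ n"
  by (induction n) (simp_all add: hom_1 hom_mult)

lemma hom_sum: "\<psi> (sum f A) = (\<Sum>a\<in>A. \<psi> (f a))"
  by (induction A rule: infinite_finite_induct) (simp_all add: hom_0 hom_add)

lemma hom_divpow: "\<psi> (divpow C i x n) = uq_divpow C (qi C i) (\<psi> x) n"
  by (simp add: divpow_def uq_divpow_def hom_mult hom_scalar hom_power)

end

lemma Uq_hom_ev: "Uq_hom C (ev C)"
  by standard (simp_all add: ev_simps)

text \<open>Precomposing with a lifted T_i stays within the class because only homomorphy on the
  free algebra is demanded. Iteration gives the maps through which nested T's are evaluated.\<close>

lemma Uq_hom_lusztig: "Uq_hom C \<psi> \<Longrightarrow> Uq_hom C (\<lambda>x. \<psi> (lusztig_T C i x))"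
  unfolding Uq_hom_def lusztig_T_def by (simp add: extend_hom_simps)

definition lusztig_E :: "('i \<Rightarrow> 'i \<Rightarrow> int) \<Rightarrow> ratfun \<Rightarrow> nat
    \<Rightarrow> 'i uq \<Rightarrow> 'i uq \<Rightarrow> 'i uq" where
  "lusztig_E C p n x y = (\<Sum>r\<le>n. (- 1) ^ r * sc C (inverse p ^ r) * uq_divpow C p x (n - r) * y *
      uq_divpow C p x r)"

context Uq_hom
begin

lemma hom_T_F: "j \<noteq> i \<Longrightarrow>
    \<psi> (lusztig_T C i (genF j)) = lusztig_F C (qi C i) (nat (- C i j)) (\<psi> (genF i)) (\<psi> (genF j))"
  by (simp add: lusztig_T_def lusztig_F_def hom_sum hom_mult hom_divpow hom_scalar hom_power hom_minus hom_1)

lemma hom_T_E: "j \<noteq> i \<Longrightarrow>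
    \<psi> (lusztig_T C i (genE j)) = lusztig_E C (qi C i) (nat (- C i j)) (\<psi> (genE i)) (\<psi> (genE j))"
  by (simp add: lusztig_T_def lusztig_E_def hom_sum hom_mult hom_divpow hom_scalar hom_power hom_minus hom_1)

lemma hom_T_F_self: "\<psi> (lusztig_T C i (genF i)) = - (\<psi> (genKinv i) * \<psi> (genE i))"
  by (simp add: lusztig_T_def hom_mult hom_minus)

lemma hom_T_Kinv: "C i j \<le> 0 \<Longrightarrow>
    \<psi> (lusztig_T C i (genKinv j)) = \<psi> (genKinv i) ^ nat (- C i j) * \<psi> (genKinv j)"
  by (simp add: lusztig_T_def hom_mult hom_power hom_1 Kpow_def)

end

lemma lusztig_E_0: "generic p \<Longrightarrow> lusztig_E C p 0 x y = y"
  by (simp add: lusztig_E_def uq_divpow_def qfact_small)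

lemma lusztig_E_1: "generic p \<Longrightarrow> lusztig_E C p (Suc 0) x y = x * y - sc C (inverse p) * y * x"
  by (simp add: lusztig_E_def uq_divpow_def qfact_small)

lemma lusztig_E_2:
  assumes "generic p"
  shows "sc C (p + inverse p) * lusztig_E C p 2 x y = 
    x * x * y - sc C (inverse p) * (sc C p + sc C (inverse p)) * x * y * x + sc C (inverse p) * sc C (inverse
        p) * y * x * x"
proof -
  let ?t = "sc C (p + inverse p)" and ?t' = "sc C (inverse (p + inverse p))"
  have t: "?t * ?t' = 1" using genericD(5)[OF assms] by (rule sc_inverse)
  have t2: "?t * (?t' * a) = a" for a using t by (simp flip: mult.assoc)
  note [simp] = sc_left_commute[of x] sc_left_commute[of y] sc_left_commute[of "sc C (inverse p)" C "inverse (p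
      + inverse p)"]
  have "?t * lusztig_E C p 2 x y = ?t * (?t' * (x * x * y) - sc C (inverse p) * x * y * x + sc C (inverse p) *
      sc C (inverse p) * y * (?t' * (x * x)))"
    using assms by (simp add: lusztig_E_def uq_divpow_def qfact_Suc numeral_2_eq_2 sc_mult mult.assoc)
  also have "\<dots> = x * x * y - sc C (inverse p) * ?t * x * y * x + sc C (inverse p) * sc C (inverse p) * y
      * x * x"
    by (simp add: right_diff_distrib distrib_left mult.assoc sc_left_commute[of ?t C "inverse p"] t2)
  finally show ?thesis by (simp add: sc_add)
qed

lemma q_commute_mult:
  assumes "l * x = sc C a * x * l" "l * y = sc C c * y * l"
  shows "l * (x * y) = sc C (a * c) * (x * y) * l"
proof -
  have "l * (x * y) = sc C a * (x * (l * y))" using assms(1) by (simp flip: mult.assoc)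
  also have "\<dots> = sc C a * (x * (sc C c * (y * l)))" using assms(2) by (simp add: mult.assoc)
  also have "\<dots> = sc C (a * c) * (x * y) * l" by (simp add: sc_left_commute[of x] sc_mult mult.assoc)
  finally show ?thesis .
qed

lemma q_commute_sc: "l * x = sc C a * x * l \<Longrightarrow> l * (sc C k * x) = sc C a * (sc C k * x) * l"
  by (simp add: sc_left_commute[of l] sc_left_commute[of "sc C a" C k] mult.assoc)

lemma q_commute_power: "l * x = sc C a * x * l \<Longrightarrow> l * x ^ n = sc C (a ^ n) * x ^ n * l"
  by (induction n) (simp_all add: q_commute_mult)

lemma q_commute_sum: "(\<And>i. i \<in> A \<Longrightarrow> l * f i = sc C a * f i * l) \<Longrightarrow> l *
    sum f A = sc C a * sum f A * l"
  by (simp add: sum_distrib_left sum_distrib_right)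

lemma q_commute_sign: "l * x = sc C a * x * l \<Longrightarrow> l * ((-1) ^ r * x) = sc C a * ((-1) ^ r * x) * l"
  by (cases "even r") simp_all

lemma q_commute_uq_divpow: "l * x = sc C a * x * l \<Longrightarrow> l * uq_divpow C p x n = sc C (a ^ n) *
    uq_divpow C p x n * l"
  unfolding uq_divpow_def by (intro q_commute_sc q_commute_power)

text \<open>Every summand contains n factors \<open>x\<close> and one factor \<open>y\<close>, hence
  picks up the same scalar.\<close>

lemma q_commute_lusztig_F:
  assumes x: "l * x = sc C a * x * l" and y: "l * y = sc C c * y * l"
  shows "l * lusztig_F C p n x y = sc C (a ^ n * c) * lusztig_F C p n x y * l"
  unfolding lusztig_F_def
proof (rule q_commute_sum)
  fix r assume "r \<in> {..n}"
  then have "a ^ n * c = a ^ r * (c * a ^ (n - r))" by (simp flip: power_add mult.assoc add: mult.commute)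
  moreover have "l * (uq_divpow C p x r * (y * uq_divpow C p x (n - r))) =
      sc C (a ^ r * (c * a ^ (n - r))) * (uq_divpow C p x r * (y * uq_divpow C p x (n - r))) * l"
    by (intro q_commute_mult q_commute_uq_divpow x y)
  ultimately show "l * ((- 1) ^ r * sc C (p ^ r) * uq_divpow C p x r * y * uq_divpow C p x (n - r)) =
      sc C (a ^ n * c) * ((- 1) ^ r * sc C (p ^ r) * uq_divpow C p x r * y * uq_divpow C p x (n - r)) * l"
    using q_commute_sign[OF q_commute_sc, of l _ C "a ^ r * (c * a ^ (n - r))" r "p ^ r"] by (simp only: mult.assoc)
qed

lemma commute_lusztig_E:
  assumes x: "l * x = x * l" and y: "l * y = y * l"
  shows "l * lusztig_E C p n x y = lusztig_E C p n x y * l"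
proof -
  have d: "l * uq_divpow C p x r = uq_divpow C p x r * l" for r
    using q_commute_uq_divpow[of l x C 1] x by simp
  have "l * lusztig_E C p n x y = sc C 1 * lusztig_E C p n x y * l"
    unfolding lusztig_E_def
  proof (rule q_commute_sum)
    fix r
    have "l * (uq_divpow C p x (n - r) * (y * uq_divpow C p x r)) =
      sc C (1 * (1 * 1)) * (uq_divpow C p x (n - r) * (y * uq_divpow C p x r)) * l"
      by (intro q_commute_mult) (simp_all add: d y)
    then show "l * ((- 1) ^ r * sc C (inverse p ^ r) * uq_divpow C p x (n - r) * y * uq_divpow C p x r) =
      sc C 1 * ((- 1) ^ r * sc C (inverse p ^ r) * uq_divpow C p x (n - r) * y * uq_divpow C p x r) * l"
      using q_commute_sign[OF q_commute_sc, of l _ C 1 r "inverse p ^ r"] by (simp only: mult.assoc mult_1_left)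
  qed
  then show ?thesis by simp
qed

lemma q_commute_left:
  assumes "l * x = sc C a * x * l" "l' * x = sc C c * x * l'"
  shows "(l * l') * x = sc C (a * c) * x * (l * l')"
proof -
  have "(l * l') * x = l * (sc C c * (x * l'))" using assms(2) by (simp add: mult.assoc)
  also have "\<dots> = sc C c * ((l * x) * l')" by (simp add: sc_left_commute[of l] mult.assoc)
  also have "\<dots> = sc C c * (sc C a * (x * (l * l')))" using assms(1) by (simp add: mult.assoc)
  also have "\<dots> = sc C (c * a) * x * (l * l')" by (simp add: sc_mult mult.assoc)
  finally show ?thesis by (simp only: mult.commute)
qed

lemma q_commute_inverse:
  assumes "l * x = sc C a * x * l" "l * l' = 1" "l' * l = 1" "a \<noteq> 0"
  shows "l' * x = sc C (inverse a) * x * l'"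
proof -
  have "x * l' = l' * (l * x) * l'" using assms(3) by (simp flip: mult.assoc)
  also have "\<dots> = l' * (sc C a * (x * (l * l')))" using assms(1) by (simp add: mult.assoc)
  also have "\<dots> = sc C a * (l' * x)" using assms(2) by (simp add: sc_left_commute[of l'])
  finally have "x * l' = sc C a * (l' * x)" .
  then have "sc C (inverse a) * (x * l') = sc C (inverse a * a) * (l' * x)" by (simp only: sc_mult mult.assoc)
  then show ?thesis using assms(4) by (simp add: mult.assoc)
qed

text \<open>The multiples \<open>e i\<close> of the generators \<open>E i\<close> remove the denominator from the commutator of \<open>E
  i\<close> and \<open>F i\<close>.\<close>

locale Uq_presentation =
  fixes C :: "'i::finite \<Rightarrow> 'i \<Rightarrow> int"
  assumes symm: "symmetrizer C (eps C)"
begin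

abbreviation "q \<equiv> qi C"
abbreviation "F i \<equiv> ev C (genF i)"
abbreviation "E i \<equiv> ev C (genE i)"
abbreviation "K i \<equiv> ev C (genK i)"
abbreviation "K' i \<equiv> ev C (genKinv i)"
abbreviation "e i \<equiv> sc C (q i - inverse (q i)) * E i"

lemma generic_q: "generic (q i)"
  using symm by (intro generic_qi) (simp add: symmetrizer_def)

lemma q_nonzero: "q i \<noteq> 0"
  using generic_q genericD(1) by blast

sublocale ev: Uq_hom C "ev C"
  by (rule Uq_hom_ev)

lemma K_inverse: "K i * K' i = 1" "K' i * K i = 1"
  using ev_relation[OF Uq_relations.intros(1)[of i C]] ev_relation[OF Uq_relations.intros(2)[of i C]]
  by (simp_all add: ev_simps)

lemma K_commute: "K i * K j = K j * K i"
  using ev_relation[OF Uq_relations.intros(3)[of i j C]] by (simp add: ev_simps)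

lemma K'_commute: "K' i * K j = K j * K' i"
  using q_commute_inverse[of "K i" "K j" C 1 "K' i"] K_commute[of i j] K_inverse[of i] by simp

lemma K'_K'_commute: "K' i * K' j = K' j * K' i"
  using q_commute_inverse[of "K i" "K' j" C 1 "K' i"] K'_commute[of j i] K_inverse[of i] by simp

lemma K_conj: "K i * x * K' i = y \<Longrightarrow> K i * x = y * K i"
  using K_inverse(2)[of i] by (metis mult.assoc mult.right_neutral)

lemma K_F: "K i * F j = sc C (q i powi (- C i j)) * F j * K i"
  using ev_relation[OF Uq_relations.intros(5)[of i j C]] by (intro K_conj) (simp add: ev_simps)

lemma K_E: "K i * E j = sc C (q i powi C i j) * E j * K i"
  using ev_relation[OF Uq_relations.intros(4)[of i j C]] by (intro K_conj) (simp add: ev_simps)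

lemma K'_F: "K' i * F j = sc C (q i powi C i j) * F j * K' i"
  using q_commute_inverse[OF K_F K_inverse] q_nonzero[of i]
  by (simp add: power_int_minus)

lemma K_e: "K i * e j = sc C (q i powi C i j) * e j * K i"
  by (rule q_commute_sc) (rule K_E)

lemma K'_e: "K' i * e j = sc C (q i powi (- C i j)) * e j * K' i"
  using q_commute_inverse[OF K_e K_inverse, of i j] q_nonzero[of i]
  by (simp add: power_int_minus)

lemma swap_q_commute:
  assumes "l * x = sc C a * x * l" "a \<noteq> 0"
  shows "x * l = sc C (inverse a) * l * x"
proof -
  have "sc C (inverse a) * (l * x) = sc C (inverse a * a) * (x * l)"
    unfolding assms(1) by (simp only: sc_mult mult.assoc)
  then show ?thesis using assms(2) by (simp add: mult.assoc)
qed

lemma e_K: "e j * K i = sc C (q i powi (- C i j)) * K i * e j"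
  using swap_q_commute[OF K_e, of i j] q_nonzero[of i] by (simp add: power_int_minus)

lemma e_K': "e j * K' i = sc C (q i powi C i j) * K' i * e j"
  using swap_q_commute[OF K'_e, of i j] q_nonzero[of i] by (simp add: power_int_minus)

lemma E_F: "E i * F j - F j * E i = (if i = j then sc C (inverse (q i - inverse (q i))) * (K i - K' i) else 0)"
  using ev_relation[OF Uq_relations.intros(6)[of i j C]] by (simp add: ev_simps split: if_splits)

lemma e_F: "i \<noteq> j \<Longrightarrow> e i * F j = F j * e i" "e i * F i = F i * e i + K i - K' i"
proof -
  let ?c = "q i - inverse (q i)"
  have "e i * F j - F j * e i = sc C ?c * (E i * F j - F j * E i)" for j
    by (simp add: right_diff_distrib sc_left_commute[of "F j"] mult.assoc)
  then have *: "e i * F j - F j * e i = (if i = j then sc C ?c * (sc C (inverse ?c) * (K i - K' i)) else 0)" for j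
    unfolding E_F by simp
  show "i \<noteq> j \<Longrightarrow> e i * F j = F j * e i" using *[of j] by simp
  have "sc C ?c * sc C (inverse ?c) = 1" using genericD(4)[OF generic_q] by (rule sc_inverse)
  then show "e i * F i = F i * e i + K i - K' i" using *[of i] by (simp add: algebra_simps flip: mult.assoc)
qed

lemma E_F_commute: "i \<noteq> j \<Longrightarrow> E i * F j = F j * E i"
  using E_F[of i j] by simp

lemma serre_F: "i \<noteq> j \<Longrightarrow> uq_serre C (q i) (nat (1 - C i j)) (F i) (F j) = 0"
  using ev_relation[OF Uq_relations.intros(8)[of i j C]]
  by (simp add: serre_def uq_serre_def ev_simps ev.hom_divpow)

lemma T_E_self: "ev C (lusztig_T C i (genF i)) = - (K' i * E i)"
  by (rule ev.hom_T_F_self)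

context
  fixes a c
  assumes ac: "a \<noteq> c" "C a c = - 1" "C c a = - 1" "C a a = 2" "C c c = 2"
begin

lemma q_eq: "q c = q a"
  using symm ac(2,3) unfolding symmetrizer_def qi_def by (metis mult_cancel_right of_nat_eq_iff
      neg_equal_0_iff_equal one_neq_zero)

lemma K'_Fs: "K' a * F a = sc C (q a) * sc C (q a) * F a * K' a" "K' a * F c = sc C (inverse (q a)) * F c * K' a"
  "K' c * F c = sc C (q a) * sc C (q a) * F c * K' c"
  using K'_F[of a a] K'_F[of a c] K'_F[of c c] ac
  by (simp_all add: sc_mult power2_eq_square power_int_minus q_eq)

lemma K_Fs: "K a * F a = sc C (inverse (q a)) * sc C (inverse (q a)) * F a * K a" "K a * F c = sc C (q a) * F c * K a"
  using K_F[of a a] K_F[of a c] ac by (simp_all add: sc_mult power2_eq_square power_int_minus)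

text \<open>Counterpart of s_a s_c alpha_a = alpha_c. T_c(F_a) is a q-commutator, and T_a turns it
  into a q-commutator of - K'_a E_a with T_a(F_c), from which E_a removes the factor F_a.\<close>

lemma T_T_F: "ev C (lusztig_T C a (lusztig_T C c (genF a))) = F c"
proof -
  interpret central_unit "sc C (q a)" "sc C (inverse (q a))" by (rule sc_central_unit[OF q_nonzero])
  interpret Ta: Uq_hom C "\<lambda>x. ev C (lusztig_T C a x)" by (rule Uq_hom_lusztig[OF Uq_hom_ev])
  let ?d = "sc C (q a - inverse (q a))" and ?x = "F c * F a - sc C (q a) * F a * F c"
  have x: "ev C (lusztig_T C a (genF c)) = ?x"
    using ev.hom_T_F[of c a] ac by (simp add: lusztig_F_1[OF generic_q])
  have "- (K' a * e a) * ?x - sc C (q a) * ?x * - (K' a * e a) = ?d * F c"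
    unfolding sc_diff
    by (rule lusztig_pair_identity) (use e_F[of a] K_inverse K_Fs K'_Fs ac(1) in \<open>simp_all add: sc_diff\<close>)
  moreover have "- (K' a * e a) * ?x - sc C (q a) * ?x * - (K' a * e a) =
      ?d * (- (K' a * E a) * ?x - sc C (q a) * ?x * - (K' a * E a))"
    by (simp add: algebra_simps sc_left_commute[of _ C "q a - inverse (q a)"])
  ultimately have "- (K' a * E a) * ?x - sc C (q a) * ?x * - (K' a * E a) = F c"
    using sc_cancel genericD(4)[OF generic_q] by metis
  then show ?thesis
    using Ta.hom_T_F[of a c] ac by (simp add: x ev.hom_T_F_self q_eq lusztig_F_1[OF generic_q])
qed

text \<open>Formally this is T_a applied to T_c T_a F_c = F_a. As equality in U_q has not been shown
  to be preserved by the lifted T_a, the value is computed directly, with T_a T_c F_a = F_c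
  inserted.\<close>

lemma T_T_T_F: "ev C (lusztig_T C a (lusztig_T C c (lusztig_T C a (genF c)))) = - (K' a * E a)"
proof -
  interpret central_unit "sc C (q a)" "sc C (inverse (q a))" by (rule sc_central_unit[OF q_nonzero])
  interpret Ta: Uq_hom C "\<lambda>x. ev C (lusztig_T C a x)" by (rule Uq_hom_lusztig[OF Uq_hom_ev])
  interpret Tac: Uq_hom C "\<lambda>x. ev C (lusztig_T C a (lusztig_T C c x))"
    by (rule Uq_hom_lusztig[OF Ta.Uq_hom_axioms])
  let ?d = "sc C (q a - inverse (q a))"
  let ?x = "- (K' a * K' c * (E a * E c - sc C (inverse (q a)) * E c * E a))"
  let ?y = "- (K' a * K' c * (E a * e c - sc C (inverse (q a)) * e c * E a))"
  have "E a * K c = sc C (q a) * K c * E a" "E a * K' c = sc C (inverse (q a)) * K' c * E a"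
    using swap_q_commute[OF K_E[of c a]] swap_q_commute[OF q_commute_inverse[OF K_E[of c a] K_inverse]] ac
        q_nonzero[of a]
    by (simp_all add: q_eq power_int_minus)
  then have "?y * F c - sc C (q a) * F c * ?y = ?d * - (K' a * E a)"
    unfolding sc_diff
    by (intro lusztig_triple_identity[of _ _ _ "K c"])
      (use e_F[of c] K_inverse K'_Fs ac(1) E_F_commute[of a c] K'_commute K'_K'_commute in \<open>simp_all add:
          sc_diff q_eq\<close>)
  moreover have "?y * F c - sc C (q a) * F c * ?y = ?d * (?x * F c - sc C (q a) * F c * ?x)"
    by (simp add: algebra_simps q_eq sc_left_commute[of _ C "q a - inverse (q a)"])
  ultimately have *: "?x * F c - sc C (q a) * F c * ?x = - (K' a * E a)"
    using sc_cancel genericD(4)[OF generic_q] by metis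
  have x: "ev C (lusztig_T C a (lusztig_T C c (genF c))) = ?x"
    using ac by (simp add: Ta.hom_T_F_self ev.hom_T_Kinv ev.hom_T_E lusztig_E_1[OF generic_q])
  have "ev C (lusztig_T C a (lusztig_T C c (lusztig_T C a (genF c)))) =
      lusztig_F C (q a) (Suc 0) (F c) ?x"
    using Tac.hom_T_F[of c a] ac by (simp add: T_T_F x)
  then show ?thesis using * by (simp add: lusztig_F_1[OF generic_q])
qed

end

end

section \<open>Root vectors along a path of three nodes\<close>

text \<open>The alternatives in \<open>mb\<close> are A_3, B_3 (alpha_3 short) and C_3 (alpha_3
  long), in this order.\<close>

locale cartan_path = Uq_presentation C for C :: "'i::finite \<Rightarrow> 'i \<Rightarrow> int" +
  fixes i1 i2 i3 :: 'i and m b :: nat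
  assumes distinct: "i1 \<noteq> i2" "i2 \<noteq> i3" "i1 \<noteq> i3"
    and diag: "C i1 i1 = 2" "C i2 i2 = 2" "C i3 i3 = 2"
    and C12: "C i1 i2 = - 1" "C i2 i1 = - 1"
    and C13: "C i1 i3 = 0" "C i3 i1 = 0"
    and C23: "C i2 i3 = - int m" "C i3 i2 = - int b"
    and mb: "m = 1 \<and> b = 1 \<or> m = 1 \<and> b = 2 \<or> m = 2 \<and> b = 1"
begin

lemmas cartan = distinct distinct[symmetric] diag C12 C13 C23

lemma eps_eqs: "eps C i1 = eps C i2" "eps C i2 * m = eps C i3 * b"
proof -
  have s: "int (eps C i) * C i j = int (eps C j) * C j i" for i j
    using symm by (simp add: symmetrizer_def)
  show "eps C i1 = eps C i2" using s[of i1 i2] by (simp add: cartan)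
  have "int (eps C i2 * m) = int (eps C i3 * b)" using s[of i2 i3] by (simp add: cartan)
  then show "eps C i2 * m = eps C i3 * b" by (simp only: of_nat_eq_iff)
qed

lemma q_12: "q i1 = q i2"
  by (simp add: qi_def eps_eqs)

lemma rank2_edge_23: "rank2_edge (q i2) (q i3) m b"
  using mb
proof (elim disjE conjE)
  assume "m = 1" "b = 1"
  then show ?thesis using eps_eqs(2) generic_q[of i2] by (simp add: rank2_edge_def qi_def)
next
  assume "m = 1" "b = 2"
  then have "q i2 = q i3 * q i3" using eps_eqs(2) by (simp add: qi_def mult_2_right power_add)
  then show ?thesis using \<open>m = 1\<close> \<open>b = 2\<close> generic_q[of i2] generic_q[of i3] by (simp
      add: rank2_edge_def)
next
  assume "m = 2" "b = 1"
  then have "eps C i3 = eps C i2 + eps C i2" using eps_eqs(2) by simp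
  then have "q i3 = q i2 * q i2" by (simp add: qi_def power_add)
  then show ?thesis using \<open>m = 2\<close> \<open>b = 1\<close> generic_q[of i2] generic_q[of i3] by (simp
      add: rank2_edge_def)
qed

abbreviation "T1 \<equiv> lusztig_T C i1"
abbreviation "T2 \<equiv> lusztig_T C i2"
abbreviation "T3 \<equiv> lusztig_T C i3"

lemma T2_T1_F2: "ev C (T2 (T1 (genF i2))) = F i1"
  using T_T_F[of i2 i1] cartan by simp

lemma T1_T2_F1: "ev C (T1 (T2 (genF i1))) = F i2"
  using T_T_F[of i1 i2] cartan by simp

lemma T1_T2_T1_F2: "ev C (T1 (T2 (T1 (genF i2)))) = ev C (T1 (genF i1))"
  using T_T_T_F[of i1 i2] cartan by (simp add: T_E_self)

context
  fixes \<psi>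
  assumes \<psi>: "Uq_hom C \<psi>"
begin

interpretation \<psi>: Uq_hom C \<psi> by (rule \<psi>)

lemma hom_T1_F3: "\<psi> (T1 (genF i3)) = \<psi> (genF i3)"
  using \<psi>.hom_T_F[of i3 i1] generic_q by (simp add: cartan)

lemma hom_T1_F2: "\<psi> (T1 (genF i2)) = lusztig_F C (q i1) 1 (\<psi> (genF i1)) (\<psi> (genF i2))"
  using \<psi>.hom_T_F[of i2 i1] by (simp add: cartan)

lemma hom_T2_F1: "\<psi> (T2 (genF i1)) = lusztig_F C (q i2) 1 (\<psi> (genF i2)) (\<psi> (genF i1))"
  using \<psi>.hom_T_F[of i1 i2] by (simp add: cartan)

lemma hom_T2_F3: "\<psi> (T2 (genF i3)) = lusztig_F C (q i2) m (\<psi> (genF i2)) (\<psi> (genF i3))"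
  using \<psi>.hom_T_F[of i3 i2] by (simp add: cartan)

lemma hom_T3_F2: "\<psi> (T3 (genF i2)) = lusztig_F C (q i3) b (\<psi> (genF i3)) (\<psi> (genF i2))"
  using \<psi>.hom_T_F[of i2 i3] by (simp add: cartan)

lemma hom_T1_Kinv3: "\<psi> (T1 (genKinv i3)) = \<psi> (genKinv i3)"
  using \<psi>.hom_T_Kinv[of i1 i3] by (simp add: cartan \<psi>.hom_1)

lemma hom_T2_Kinv3: "\<psi> (T2 (genKinv i3)) = \<psi> (genKinv i2) ^ m * \<psi> (genKinv i3)"
  using \<psi>.hom_T_Kinv[of i2 i3] by (simp add: cartan)

lemma hom_T1_E3: "\<psi> (T1 (genE i3)) = \<psi> (genE i3)"
  using \<psi>.hom_T_E[of i3 i1] lusztig_E_0[OF generic_q] by (simp add: cartan)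

lemma hom_T2_E3: "\<psi> (T2 (genE i3)) = lusztig_E C (q i2) m (\<psi> (genE i2)) (\<psi> (genE i3))"
  using \<psi>.hom_T_E[of i3 i2] by (simp add: cartan)

end

lemmas T_homs = Uq_hom_lusztig[OF Uq_hom_ev] Uq_hom_lusztig[OF Uq_hom_lusztig[OF Uq_hom_ev]]
  Uq_hom_lusztig[OF Uq_hom_lusztig[OF Uq_hom_lusztig[OF Uq_hom_ev]]]

abbreviation "Q \<equiv> lusztig_F C (q i2) m (F i2) (F i3)"
abbreviation "G \<equiv> lusztig_F C (q i3) b Q (F i1)"

text \<open>Each value is obtained by inserting the earlier ones into the formula for the innermost
  T. For the last one this needs T_2 T_1 T_3 F_3, where T_3(F_3) = - K'_3 E_3 turns up raising
  generators.\<close>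

lemma W1_vectors:
  "ev C (T2 (genF i1)) = lusztig_F C (q i2) 1 (F i2) (F i1)"
  "ev C (T2 (T1 (genF i3))) = Q"
  "ev C (T2 (T1 (T3 (genF i2)))) = G"
  "ev C (T2 (T1 (T3 (T2 (genF i3))))) = lusztig_F C (q i2) m G (- (K' i2 ^ m * K' i3 * lusztig_E C (q i2) m (E
      i2) (E i3)))"
proof -
  interpret T21: Uq_hom C "\<lambda>x. ev C (T2 (T1 x))" by (rule T_homs)
  show "ev C (T2 (genF i1)) = lusztig_F C (q i2) 1 (F i2) (F i1)"
    by (rule hom_T2_F1[OF Uq_hom_ev])
  show 2: "ev C (T2 (T1 (genF i3))) = Q"
    by (simp add: hom_T1_F3[OF T_homs(1)] hom_T2_F3[OF Uq_hom_ev])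
  show 3: "ev C (T2 (T1 (T3 (genF i2)))) = G"
    by (simp add: hom_T3_F2[OF T_homs(2)] 2 T2_T1_F2)
  have "ev C (T2 (T1 (T3 (genF i3)))) = - (K' i2 ^ m * K' i3 * lusztig_E C (q i2) m (E i2) (E i3))"
    by (simp add: T21.hom_T_F_self hom_T1_Kinv3[OF T_homs(1)] hom_T1_E3[OF T_homs(1)]
      hom_T2_Kinv3[OF Uq_hom_ev] hom_T2_E3[OF Uq_hom_ev])
  then show "ev C (T2 (T1 (T3 (T2 (genF i3))))) = lusztig_F C (q i2) m G (- (K' i2 ^ m * K' i3 * lusztig_E C (q
      i2) m (E i2) (E i3)))"
    using hom_T2_F3[OF T_homs(3), of i2 i1 i3] by (simp add: 3)
qed

abbreviation "X1 \<equiv> ev C (T1 (genF i1))"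
abbreviation "X2 \<equiv> ev C (T1 (genF i2))"

text \<open>The formulas are those for the word starting with 2132, with T_1(F_1), T_1(F_2) and
  T_1(F_3) = F_3 in place of the F's.\<close>

lemma W2_vectors:
  "ev C (T1 (T2 (genF i1))) = lusztig_F C (q i2) 1 X2 X1"
  "ev C (T1 (T2 (T1 (genF i3)))) = lusztig_F C (q i2) m X2 (F i3)"
  "ev C (T1 (T2 (T1 (T3 (genF i2))))) = lusztig_F C (q i3) b (lusztig_F C (q i2) m X2 (F i3)) X1"
proof -
  show "ev C (T1 (T2 (genF i1))) = lusztig_F C (q i2) 1 X2 X1"
    by (rule hom_T2_F1[OF T_homs(1)])
  show 2: "ev C (T1 (T2 (T1 (genF i3)))) = lusztig_F C (q i2) m X2 (F i3)"
    by (simp add: hom_T1_F3[OF T_homs(2)] hom_T2_F3[OF T_homs(1)] hom_T1_F3[OF Uq_hom_ev])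
  show "ev C (T1 (T2 (T1 (T3 (genF i2))))) = lusztig_F C (q i3) b (lusztig_F C (q i2) m X2 (F i3)) X1"
    by (simp add: hom_T3_F2[OF T_homs(3)] 2 T1_T2_T1_F2)
qed

lemma F1_F3: "F i1 * F i3 = F i3 * F i1"
  using serre_F[of i1 i3] by (simp add: cartan uq_serre_1[OF generic_q])

lemma serre_12: 
  assumes "a = i1 \<and> c = i2 \<or> a = i2 \<and> c = i1"
  shows "F a * F a * F c - (sc C (q i2) + sc C (inverse (q i2))) * F a * F c * F a + F c * F a * F a = 0"
  using serre_F[of a c] assms by (auto simp: cartan uq_serre_2_iff[OF generic_q] q_12)

lemma serre_23: "uq_serre C (q i2) (Suc m) (F i2) (F i3) = 0" "uq_serre C (q i3) (Suc b) (F i3) (F i2) = 0"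
  using serre_F[of i2 i3] serre_F[of i3 i2] by (simp_all add: cartan nat_add_distrib)

lemma unit: "central_unit (sc C (q i)) (sc C (inverse (q i)))"
  by (rule sc_central_unit[OF q_nonzero])

lemma F12: 
  defines "y \<equiv> lusztig_F C (q i2) 1 (F i2) (F i1)"
  shows "F i1 * F i2 = sc C (q i2) * F i2 * F i1 + y" "y * F i2 = sc C (inverse (q i2)) * F i2 * y"
proof -
  have y: "y = F i1 * F i2 - sc C (q i2) * F i2 * F i1"
    unfolding y_def by (simp add: lusztig_F_1[OF generic_q])
  show "F i1 * F i2 = sc C (q i2) * F i2 * F i1 + y" by (simp add: y)
  show "y * F i2 = sc C (inverse (q i2)) * F i2 * y"
    unfolding y by (rule central_unit.serre_q1(1)[OF unit serre_12]) simp
qed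

theorem W1_commutator:
  "\<exists>k. k \<noteq> 0 \<and> G * F i2 = sc C (if m * b = 1 then 1 else inverse (q i2)) * F i2 * G +
     sc C k * (ev C (T2 (genF i1)) * Q ^ b)"
  unfolding W1_vectors
  by (rule lusztig_F_q_commutator[OF rank2_edge_23 F12 F1_F3 serre_23(1)])

text \<open>The relations assumed of f1, f2, f3 in \<open>lusztig_F_q_commutator\<close> are
  verified for the T_1-images one by one.\<close>

theorem W2_commutator:
  defines "V \<equiv> lusztig_F C (q i2) m X2 (F i3)"
  shows "\<exists>k. k \<noteq> 0 \<and> lusztig_F C (q i3) b V X1 * X2 = sc C (if m * b = 1 then 1 else
      inverse (q i2)) * X2 * lusztig_F C (q i3) b V X1 +
     sc C k * (ev C (T1 (T2 (genF i1))) * V ^ b)"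
  unfolding V_def
proof (rule lusztig_F_q_commutator[OF rank2_edge_23])
  have X2: "X2 = F i2 * F i1 - sc C (q i2) * F i1 * F i2"
    using hom_T1_F2[OF Uq_hom_ev] by (simp add: lusztig_F_1[OF generic_q] q_12)
  show "X1 * X2 = sc C (q i2) * X2 * X1 + ev C (T1 (T2 (genF i1)))"
    by (simp add: W2_vectors lusztig_F_1[OF generic_q])
  \<comment> \<open>Since T_1 T_2 F_1 = F_2, this is a Serre relation between F_1 and F_2.\<close>
  show "ev C (T1 (T2 (genF i1))) * X2 = sc C (inverse (q i2)) * X2 * ev C (T1 (T2 (genF i1)))"
    unfolding T1_T2_F1 unfolding X2 by (rule central_unit.serre_q1(2)[OF unit serre_12]) simp
  have "K' i1 * F i3 = F i3 * K' i1" using K'_F[of i1 i3] by (simp add: cartan)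
  then have "K' i1 * E i1 * F i3 = F i3 * (K' i1 * E i1)"
    using E_F_commute[of i1 i3] by (metis cartan(3) mult.assoc)
  then show "X1 * F i3 = F i3 * X1" by (simp add: T_E_self)
  show "uq_serre C (q i2) (Suc m) X2 (F i3) = 0"
  proof (rule uq_serre_lift[OF generic_q rank2_edge_m[OF rank2_edge_23] X2 _ F1_F3[symmetric] serre_23(1)])
    show "X2 * F i1 = sc C (inverse (q i2)) * F i1 * X2"
      unfolding X2 by (rule central_unit.serre_q1(1)[OF unit serre_12]) simp
  qed
qed

section \<open>The additional commutator for a double edge\<close>

definition L' where "L' = K' i2 ^ m * K' i3"

text \<open>\<open>E23\<close> is the value of T_2(E_3), the root vector opposite to
  \<open>Q\<close>, and \<open>L'\<close> is the torus element for -gamma; T_2 T_1 T_3 F_3 is minus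
  their product.\<close>

definition E23 where "E23 = lusztig_E C (q i2) m (E i2) (E i3)"

lemma L'_F: "L' * F j = sc C ((q i2 powi C i2 j) ^ m * q i3 powi C i3 j) * F j * L'"
  unfolding L'_def
proof (rule q_commute_left)
  show "K' i2 ^ m * F j = sc C ((q i2 powi C i2 j) ^ m) * F j * K' i2 ^ m"
  proof (induction m)
    case (Suc m)
    show ?case using q_commute_left[OF K'_F Suc.IH, of i2] by simp
  qed simp
qed (rule K'_F)

lemma sc_mult_sc: "(sc C a * x) * (sc C c * y) = sc C (a * c) * (x * y)"
  by (simp add: sc_mult mult.assoc sc_left_commute[of x])

lemma uq_divpow_scale: "uq_divpow C p (sc C a * x) n = sc C (a ^ n) * uq_divpow C p x n"
proof -
  have "(sc C a * x) ^ n = sc C (a ^ n) * x ^ n"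
    by (induction n) (simp_all only: power_0 power_Suc sc_mult_sc scalar_1 ev_1 mult_1_left)
  then show ?thesis by (simp add: uq_divpow_def sc_left_commute[of "sc C (inverse (qfact p n))" C "a ^ n"])
qed

lemma lusztig_E_scale: "lusztig_E C p n (sc C a * x) (sc C c * y) = sc C (a ^ n * c) * lusztig_E C p n x y"
  unfolding lusztig_E_def uq_divpow_scale sum_distrib_left
proof (rule sum.cong[OF refl])
  fix r assume "r \<in> {..n}"
  then have *: "a ^ (n - r) * c * a ^ r = a ^ n * c" 
    by (simp add: mult.assoc mult.left_commute mult.commute flip: power_add)
  have s: "(- 1) ^ r * sc C k * x = sc C k * ((- 1) ^ r * x)" for k and x :: "'i uq"
    by (cases "even r") simp_all
  have "(- 1) ^ r * sc C (inverse p ^ r) * (sc C (a ^ (n - r)) * uq_divpow C p x (n - r)) * (sc C c * y) * (sc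
      C (a ^ r) * uq_divpow C p x r)
    = (- 1) ^ r * sc C (inverse p ^ r) * ((sc C (a ^ (n - r)) * uq_divpow C p x (n - r)) * (sc C c * y) * (sc C
        (a ^ r) * uq_divpow C p x r))"
    by (simp only: mult.assoc)
  also have "\<dots> = sc C (inverse p ^ r) * ((- 1) ^ r * (sc C (a ^ n * c) * (uq_divpow C p x (n - r) * y *
      uq_divpow C p x r)))"
    unfolding sc_mult_sc * s ..
  also have "\<dots> = sc C (a ^ n * c) * ((- 1) ^ r * sc C (inverse p ^ r) * uq_divpow C p x (n - r) * y *
      uq_divpow C p x r)"
    by (cases "even r") (simp_all add: mult.assoc sc_left_commute[of "sc C (inverse p ^ r)" C "a ^ n * c"])
  finally show "(- 1) ^ r * sc C (inverse p ^ r) * (sc C (a ^ (n - r)) * uq_divpow C p x (n - r)) * (sc C c *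
      y) * (sc C (a ^ r) * uq_divpow C p x r)
    = sc C (a ^ n * c) * ((- 1) ^ r * sc C (inverse p ^ r) * uq_divpow C p x (n - r) * y * uq_divpow C p x r)" .
qed

text \<open>Image under T_2 of the relation between E_3 and F_3, as T_2 sends K_3 to K_3 K_2^m and
  its inverse to \<open>L'\<close>. It is verified for the rescaled generators, whose factors are
  cancelled at the end.\<close>

lemma E23_Q:
  assumes mb2: "m * b = 2"
  shows "E23 * Q = Q * E23 + sc C (inverse (q i3 - inverse (q i3))) * (K i3 * K i2 ^ m - L')"
proof -
  let ?c2 = "q i2 - inverse (q i2)" and ?c3 = "q i3 - inverse (q i3)"
  have c: "?c2 ^ m \<noteq> 0" "?c3 \<noteq> 0" using genericD(4)[OF generic_q] by auto
  have eF: "e i2 * F i2 = F i2 * e i2 + K i2 - K' i2" "e i3 * F i3 = F i3 * e i3 + K i3 - K' i3"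
    "e i2 * F i3 = F i3 * e i2" "e i3 * F i2 = F i2 * e i3"
    using e_F distinct by simp_all
  have K: "K i2 * K' i2 = 1" "K' i2 * K i2 = 1" "K i3 * K' i3 = 1" "K' i3 * K i3 = 1"
       "K i3 * K i2 = K i2 * K i3" "K' i3 * K i2 = K i2 * K' i3" "K i3 * K' i2 = K' i2 * K i3" "K' i3 * K' i2 =
           K' i2 * K' i3"
    by (rule K_inverse K_commute K'_commute K'_K'_commute K'_commute[symmetric])+
  let ?E = "lusztig_E C (q i2) m (e i2) (e i3)" and ?D = "K i3 * K i2 ^ m - L'"
  have E: "?E = sc C (?c2 ^ m * ?c3) * E23"
    unfolding E23_def lusztig_E_scale ..
  have "?E * Q = Q * ?E + sc C (?c2 ^ m) * ?D"
  proof (cases "m = 1")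
    case True
    then have [simp]: "m = 1" "b = 2" and q2: "q i2 = q i3 * q i3" using rank2_edge_23 mb2 by (auto simp:
        rank2_edge_def)
    interpret central_unit "sc C (q i3)" "sc C (inverse (q i3))" by (rule unit)
    have e: "?E = e i2 * e i3 - sc C (inverse (q i3)) * sc C (inverse (q i3)) * e i3 * e i2"
      using lusztig_E_1[OF generic_q[of i2], of C] by (simp add: sc_mult q2)
    have Q: "Q = F i3 * F i2 - sc C (q i3) * sc C (q i3) * F i2 * F i3"
      using lusztig_F_1[OF generic_q[of i2], of C] by (simp add: sc_mult q2)
    have "?E * Q = Q * ?E + (sc C (q i3) * sc C (q i3) - sc C (inverse (q i3)) * sc C (inverse (q i3))) * (K i3
        * K i2 - K' i2 * K' i3)"
      unfolding Q e
      by (rule root_vector_commutator1[OF eF K])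
        (use K_F[of i2 i2] K_F[of i2 i3] K_F[of i3 i2] K_F[of i3 i3] K'_F[of i2 i2] K'_F[of i2 i3] K'_F[of i3
            i2] K'_F[of i3 i3]
             e_K[of i2 i2] e_K[of i2 i3] e_K[of i3 i2] e_K[of i3 i3] e_K'[of i2 i2] e_K'[of i2 i3] e_K'[of i3
                 i2] e_K'[of i3 i3]
         in \<open>simp_all add: cartan q2 sc_mult power2_eq_square power_int_minus mult.assoc\<close>)
    then show ?thesis unfolding L'_def by (simp add: sc_diff sc_mult q2)
  next
    case False
    then have [simp]: "m = 2" "b = 1" and q3: "q i3 = q i2 * q i2" using rank2_edge_23 mb2 by (auto simp:
        rank2_edge_def)
    interpret central_unit "sc C (q i2)" "sc C (inverse (q i2))" by (rule unit)
    let ?t = "q i2 + inverse (q i2)"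
    have t: "?t \<noteq> 0" using genericD(5)[OF generic_q] .
    have "(sc C ?t * ?E) * (sc C ?t * Q) = (sc C ?t * Q) * (sc C ?t * ?E) + 
      (sc C (q i2) * sc C (q i2) - sc C (inverse (q i2)) * sc C (inverse (q i2))) *
      (sc C (q i2) * sc C (q i2) - sc C (inverse (q i2)) * sc C (inverse (q i2))) * (K i3 * K i2 * K i2 - K' i2
          * K' i2 * K' i3)"
      unfolding \<open>m = 2\<close> lusztig_F_2[OF generic_q] lusztig_E_2[OF generic_q]
      by (rule root_vector_commutator2[OF eF K])
        (use K_F[of i2 i2] K_F[of i2 i3] K_F[of i3 i2] K_F[of i3 i3] K'_F[of i2 i2] K'_F[of i2 i3] K'_F[of i3
            i2] K'_F[of i3 i3]
             e_K[of i2 i2] e_K[of i2 i3] e_K[of i3 i2] e_K[of i3 i3] e_K'[of i2 i2] e_K'[of i2 i3] e_K'[of i3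
                 i2] e_K'[of i3 i3]
         in \<open>simp_all add: cartan q3 sc_mult power2_eq_square power_int_minus mult.assoc\<close>)
    moreover have "(sc C (q i2) * sc C (q i2) - sc C (inverse (q i2)) * sc C (inverse (q i2))) *
      (sc C (q i2) * sc C (q i2) - sc C (inverse (q i2)) * sc C (inverse (q i2))) = sc C (?t * ?t) * sc C (?c2 ^ m)"
    proof -
      have "(q i2 * q i2 - inverse (q i2) * inverse (q i2)) * (q i2 * q i2 - inverse (q i2) * inverse (q i2)) =
        (?t * ?t) * ?c2 ^ m" by (simp add: algebra_simps power2_eq_square)
      then show ?thesis by (simp only: flip: sc_mult sc_diff)
    qed
    moreover have "K i3 * K i2 * K i2 - K' i2 * K' i2 * K' i3 = ?D"
      unfolding L'_def by (simp add: power2_eq_square mult.assoc)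
    ultimately have "sc C (?t * ?t) * (?E * Q) = sc C (?t * ?t) * (Q * ?E + sc C (?c2 ^ m) * ?D)"
      unfolding sc_mult_sc by (simp only: distrib_left mult.assoc)
    then show ?thesis using sc_cancel[of "?t * ?t"] t by (metis mult_eq_0_iff)
  qed
  then have "sc C (?c2 ^ m * ?c3) * (E23 * Q) = sc C (?c2 ^ m * ?c3) * (Q * E23) + sc C (?c2 ^ m) * ?D"
    unfolding E by (simp add: sc_left_commute[of Q] mult.assoc)
  also have "sc C (?c2 ^ m) * ?D = sc C (?c2 ^ m * ?c3) * (sc C (inverse ?c3) * ?D)"
    using c(2) by (simp add: mult.assoc flip: sc_mult mult.assoc[of "sc C _"])
  finally show ?thesis
    using sc_cancel[of "?c2 ^ m * ?c3" C "E23 * Q"] c by (simp add: distrib_left)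
qed

theorem W1_commutator_double_edge:
  assumes mb2: "m * b = 2"
  defines "P \<equiv> lusztig_F C (q i2) m G (- (L' * E23))"
  shows "\<exists>k. k \<noteq> 0 \<and> P * Q = Q * P + sc C k * G ^ m"
proof -
  \<comment> \<open>\<open>?k\<close> is the constant in the commutator of \<open>E23\<close> and
    \<open>Q\<close>, with the sign of \<open>?A\<close>; \<open>?M\<close> arises when
    \<open>L'\<close> is multiplied into K_3 K_2^m - L'.\<close>
  let ?A = "- (L' * E23)" and ?k = "- inverse (q i3 - inverse (q i3))" and ?M = "L' * L'"
  have k: "?k \<noteq> 0" using genericD(4)[OF generic_q] by simp
  have LK: "L' * (K i3 * K i2 ^ m) = 1"
  proof -
    have "K' i2 ^ m * K i2 ^ m = 1"
    proof (induction m)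
      case (Suc m)
      have "K' i2 ^ Suc m * K i2 ^ Suc m = K' i2 ^ m * ((K' i2 * K i2) * K i2 ^ m)"
        by (simp only: power_Suc2[of "K' i2"] power_Suc[of "K i2"] mult.assoc)
      then show ?case using Suc.IH by (simp add: K_inverse)
    qed simp
    moreover have "L' * (K i3 * K i2 ^ m) = K' i2 ^ m * ((K' i3 * K i3) * K i2 ^ m)"
      by (simp only: L'_def mult.assoc)
    ultimately show ?thesis by (simp add: K_inverse)
  qed
  \<comment> \<open>The exponent is (gamma, gamma) = (alpha_3, alpha_3), because gamma = s_2
    alpha_3.\<close>
  have LQ: "L' * Q = sc C (q i3 ^ 2) * Q * L'"
  proof -
    have "L' * Q = sc C (((q i2 powi C i2 i2) ^ m * q i3 powi C i3 i2) ^ m * ((q i2 powi C i2 i3) ^ m * q i3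
        powi C i3 i3)) * Q * L'"
      by (rule q_commute_lusztig_F[OF L'_F L'_F])
    also have "((q i2 powi C i2 i2) ^ m * q i3 powi C i3 i2) ^ m * ((q i2 powi C i2 i3) ^ m * q i3 powi C i3
        i3) = q i3 ^ 2"
      using rank2_edge_23 q_nonzero by (auto simp: rank2_edge_def cartan power_int_minus field_simps eval_nat_numeral)
    finally show ?thesis .
  qed
  have LF1: "L' * F i1 = sc C (inverse (q i2 ^ m)) * F i1 * L'"
    using L'_F[of i1] by (simp add: cartan power_int_minus power_inverse)
  have AQ: "?A * Q = sc C (q i3 ^ 2) * Q * ?A + sc C ?k * (1 - ?M)"
  proof -
    let ?i = "sc C (inverse (q i3 - inverse (q i3)))"
    have "L' * E23 * Q = L' * (Q * E23 + ?i * (K i3 * K i2 ^ m - L'))"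
      using E23_Q[OF mb2] by (simp add: mult.assoc)
    also have "\<dots> = (L' * Q) * E23 + ?i * (L' * (K i3 * K i2 ^ m) - L' * L')"
      by (simp add: distrib_left right_diff_distrib sc_left_commute[of L'] mult.assoc)
    also have "\<dots> = sc C (q i3 ^ 2) * Q * (L' * E23) + ?i * (1 - ?M)"
      unfolding LK LQ by (simp add: mult.assoc)
    finally show ?thesis by (simp add: sc_minus)
  qed
  show ?thesis
  proof (cases "m = 1")
    case True
    then have [simp]: "m = 1" "b = 2" and q2: "q i2 = q i3 * q i3" using rank2_edge_23 mb2 by (auto simp:
        rank2_edge_def)
    have EF: "E23 * F i1 = F i1 * E23"
      unfolding E23_def using E_F_commute distinct by (metis commute_lusztig_E)
    have A1: "?A * F i1 = sc C (inverse (q i3)) * sc C (inverse (q i3)) * F i1 * ?A"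
    proof -
      have "L' * E23 * F i1 = L' * F i1 * E23" using EF by (simp add: mult.assoc)
      then show ?thesis unfolding LF1 by (simp add: q2 sc_mult mult.assoc)
    qed
    have MQ: "?M * Q = sc C (q i3 ^ 4) * Q * ?M"
      using q_commute_left[OF LQ LQ] by (simp flip: power_add)
    have M1: "?M * F i1 = sc C (inverse (q i3)) * sc C (inverse (q i3)) * sc C (inverse (q i3)) * sc C (inverse
        (q i3)) * F i1 * ?M"
      using q_commute_left[OF LF1 LF1] by (simp add: q2 sc_mult mult.assoc)
    have "\<exists>k. k \<noteq> 0 \<and> lusztig_F C (q i3 * q i3) 1 G ?A * Q = Q * lusztig_F C (q i3 * q i3)
        1 G ?A + sc C k * G"
      using lusztig_F_commutator_B3[OF generic_q AQ A1 MQ M1 k] by simp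
    then show ?thesis by (simp add: P_def q2)
  next
    case False
    then have [simp]: "m = 2" "b = 1" and q3: "q i3 = q i2 * q i2" using rank2_edge_23 mb2 by (auto simp:
        rank2_edge_def)
    have q4: "q i3 ^ 2 = q i2 ^ 4" by (simp add: q3 eval_nat_numeral mult.assoc)
    have S: "uq_serre C (q i2) 3 (F i2) (F i3) = 0" "uq_serre C (q i2 * q i2) 2 (F i3) (F i2) = 0"
      using serre_23 by (simp_all add: q3 eval_nat_numeral)
    have GQ: "G * Q = sc C (inverse (q i2)) * sc C (inverse (q i2)) * Q * G"
      using lusztig_F_q_commute_C3[OF generic_q F12 F1_F3 S] by (simp add: q3)
    have "L' * G = sc C (q i3 ^ 2 * inverse (q i2 ^ 2)) * G * L'"
      using q_commute_lusztig_F[OF LQ LF1, of "q i3" 1] by simp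
    also have "q i3 ^ 2 * inverse (q i2 ^ 2) = q i2 ^ 2" using q_nonzero[of i2] by (simp add: q3 field_simps
        eval_nat_numeral)
    finally have LG: "L' * G = sc C (q i2 ^ 2) * G * L'" .
    have "?M * G = sc C (q i2 ^ 4) * G * ?M"
      using q_commute_left[OF LG LG] by (simp flip: power_add)
    from lusztig_F_commutator_C3[OF generic_q AQ[unfolded q4] GQ this k] show ?thesis by (simp add: P_def)
  qed
qed

end

section \<open>Inequalities satisfied in the cones\<close>

text \<open>The cone imposes its condition for every admissible family of coefficients, so one
  verified expansion with a single monomial already yields an inequality.\<close>

lemma LS_coefficients_single:
  assumes "Poly_Mapping.keys n \<subseteq> {i<..<j}" "k \<noteq> 0"
    and "ev C (pbw_vector C ws j) * ev C (pbw_vector C ws i) =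
      sc C (q_var powi (- root_form C (pbw_root C ws i) (pbw_root C ws j))) *
        ev C (pbw_vector C ws i) * ev C (pbw_vector C ws j) + sc C k * ev C (pbw_monomial C ws i j n)"
  shows "LS_coefficients C ws i j (Poly_Mapping.single n k)"
  unfolding LS_coefficients_def
  using assms by (auto intro!: ev_eqD simp: ev_simps)

lemma quantum_degree_coneD:
  assumes "d \<in> quantum_degree_cone \<Delta>p C ws" "i < j" "j < length ws"
    and "Poly_Mapping.keys n \<subseteq> {i<..<j}" "k \<noteq> 0"
    and "ev C (pbw_vector C ws j) * ev C (pbw_vector C ws i) =
      sc C (q_var powi (- root_form C (pbw_root C ws i) (pbw_root C ws j))) *
        ev C (pbw_vector C ws i) * ev C (pbw_vector C ws j) + sc C k * ev C (pbw_monomial C ws i j n)"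
  shows "(\<Sum>k\<in>{i<..<j}. real (Poly_Mapping.lookup n k) * d (pbw_root C ws k))
    < d (pbw_root C ws i) + d (pbw_root C ws j)"
proof -
  have "LS_coefficients C ws i j (Poly_Mapping.single n k)"
    by (rule LS_coefficients_single[OF assms(4-6)])
  then show ?thesis using assms(1-3,5) unfolding quantum_degree_cone_def by fastforce
qed

definition comb :: "'i \<Rightarrow> 'i \<Rightarrow> 'i \<Rightarrow> int \<Rightarrow> int \<Rightarrow> int
    \<Rightarrow> 'i \<Rightarrow> int" where
  "comb i1 i2 i3 x y z = (\<lambda>j. x * simple_root i1 j + y * simple_root i2 j + z * simple_root i3 j)"

lemma sum_simple_root: "(\<Sum>k\<in>UNIV. f k * simple_root i k) = f (i :: 'i::finite)"
  by (simp add: simple_root_def if_distrib cong: if_cong)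

context cartan_path
begin

abbreviation "cmb \<equiv> comb i1 i2 i3"

lemma sum_cmb: "(\<Sum>k\<in>UNIV. f k * cmb x y z k) = f i1 * x + f i2 * y + f i3 * z" for f :: "'i
    \<Rightarrow> int"
proof -
  have "(\<Sum>k\<in>UNIV. f k * cmb x y z k) =
    (\<Sum>k\<in>UNIV. f k * simple_root i1 k) * x + (\<Sum>k\<in>UNIV. f k * simple_root i2 k) * y +
        (\<Sum>k\<in>UNIV. f k * simple_root i3 k) * z"
    by (simp add: comb_def algebra_simps sum.distrib flip: sum_distrib_left)
  then show ?thesis by (simp only: sum_simple_root)
qed

lemma simple_root_cmb: "simple_root i1 = cmb 1 0 0" "simple_root i2 = cmb 0 1 0" "simple_root i3 = cmb 0 0 1"
  by (simp_all add: comb_def)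

lemma reflection_cmb:
  "simple_reflection C i1 (cmb x y z) = cmb (y - x) y z"
  "simple_reflection C i2 (cmb x y z) = cmb x (x - y + int m * z) z"
  "simple_reflection C i3 (cmb x y z) = cmb x y (int b * y - z)"
  unfolding simple_reflection_def sum_cmb by (auto simp: cartan comb_def algebra_simps)

lemma root_form_cmb: "root_form C (cmb x y z) (cmb x' y' z') =
  int (eps C i2) * (x * (2 * x' - y') + y * (2 * y' - x' - int m * z')) + int (eps C i3) * z * (2 * z' - int b * y')"
proof -
  have "root_form C (cmb x y z) (cmb x' y' z') =
    (\<Sum>i\<in>UNIV. (int (eps C i) * (\<Sum>j\<in>UNIV. C i j * cmb x' y' z' j)) * cmb x y z i)"
    unfolding root_form_def sum_distrib_left sum_distrib_right
    by (intro sum.cong refl) (simp add: algebra_simps)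
  then show ?thesis
    unfolding sum_cmb by (simp add: cartan eps_eqs algebra_simps)
qed

context
  fixes ws rest
  assumes ws: "ws = [i2, i1, i3, i2] @ rest"
begin

lemma W1_roots:
  "pbw_root C ws 0 = cmb 0 1 0" "pbw_root C ws 1 = cmb 1 1 0" "pbw_root C ws 2 = cmb 0 (int m) 1"
  "pbw_root C ws 3 = cmb 1 (int m * int b) (int b)"
  by (simp_all add: ws pbw_root_def weyl_prod_def simple_root_cmb reflection_cmb eval_nat_numeral)

lemma W1_cone:
  assumes d: "d \<in> quantum_degree_cone \<Delta>p C ws"
  shows "d (cmb 1 1 0) + real b * d (cmb 0 (int m) 1) < d (cmb 0 1 0) + d (cmb 1 (int m * int b) (int b))"
proof -
  obtain k where k: "k \<noteq> 0"
    and eq: "G * F i2 = sc C (if m * b = 1 then 1 else inverse (q i2)) * F i2 * G + sc C k * (ev C (T2 (genF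
        i1)) * Q ^ b)"
    using W1_commutator by blast
  \<comment> \<open>The exponent of the monomial for (alpha_1 + alpha_2) + b gamma.\<close>
  define n where "n = Poly_Mapping.single (1::nat) (1::nat) + Poly_Mapping.single 2 b"
  have n: "Poly_Mapping.lookup n 1 = 1" "Poly_Mapping.lookup n 2 = b"
    by (simp_all add: n_def lookup_add lookup_single)
  have v: "pbw_vector C ws 0 = genF i2" "pbw_vector C ws 1 = T2 (genF i1)" "pbw_vector C ws 2 = T2 (T1 (genF i3))"
    "pbw_vector C ws 3 = T2 (T1 (T3 (genF i2)))"
    by (simp_all add: ws pbw_vector_def eval_nat_numeral)
  have mon: "pbw_monomial C ws 0 3 n = pbw_vector C ws 1 * pbw_vector C ws 2 ^ b"
    using n by (simp add: pbw_monomial_def upt_rec eval_nat_numeral)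
  \<comment> \<open>The form takes the value eps_2 (m b - 1) on alpha_2 and theta, which is 0 or
    eps_2.\<close>
  have ex: "q_var powi (- root_form C (pbw_root C ws 0) (pbw_root C ws 3)) =
      (if m * b = 1 then 1 else inverse (q i2))"
    using mb by (auto simp: W1_roots root_form_cmb qi_def power_int_minus)
  have keys: "Poly_Mapping.keys n \<subseteq> {0<..<3}"
    unfolding n_def by (rule order_trans[OF keys_add]) auto
  have "(\<Sum>k\<in>{0<..<3}. real (Poly_Mapping.lookup n k) * d (pbw_root C ws k))
      < d (pbw_root C ws 0) + d (pbw_root C ws 3)"
  proof (rule quantum_degree_coneD[OF d _ _ keys k])
    show "ev C (pbw_vector C ws 3) * ev C (pbw_vector C ws 0) =
      sc C (q_var powi (- root_form C (pbw_root C ws 0) (pbw_root C ws 3))) *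
        ev C (pbw_vector C ws 0) * ev C (pbw_vector C ws 3) + sc C k * ev C (pbw_monomial C ws 0 3 n)"
      unfolding mon ex v ev_mult ev_power W1_vectors(2,3) by (rule eq)
  qed (simp_all add: ws)
  moreover have "{0<..<3} = {1, 2::nat}" by auto
  ultimately show ?thesis using n by (simp add: W1_roots del: One_nat_def)
qed

end

context
  fixes ws rest
  assumes ws: "ws = [i2, i1, i3, i2, i3] @ rest" and mb2: "m * b = 2"
begin

text \<open>For m b = 2, gamma = s_2 alpha_3 is fixed by s_3, and gamma' = s_1 gamma is fixed by
  s_2; so the fifth root is gamma'.\<close>

lemma W1_root4: "pbw_root C ws 4 = cmb (int m) (int m) 1"
  using mb mb2 by (auto simp: ws pbw_root_def weyl_prod_def simple_root_cmb reflection_cmb eval_nat_numeral)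

lemma W1_cone_double_edge:
  assumes d: "d \<in> quantum_degree_cone \<Delta>p C ws"
  shows "real m * d (cmb 1 (int m * int b) (int b)) < d (cmb 0 (int m) 1) + d (cmb (int m) (int m) 1)"
proof -
  let ?P = "lusztig_F C (q i2) m G (- (L' * E23))"
  obtain k where k: "k \<noteq> 0" and eq: "?P * Q = Q * ?P + sc C k * G ^ m"
    using W1_commutator_double_edge[OF mb2] by blast
  have ws': "ws = [i2, i1, i3, i2] @ (i3 # rest)" by (simp add: ws)
  note roots = W1_roots(3,4)[OF ws'] W1_root4
  define n where "n = Poly_Mapping.single (3::nat) m"
  have v: "pbw_vector C ws 2 = T2 (T1 (genF i3))" "pbw_vector C ws 3 = T2 (T1 (T3 (genF i2)))"
    "pbw_vector C ws 4 = T2 (T1 (T3 (T2 (genF i3))))"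
    by (simp_all add: ws pbw_vector_def eval_nat_numeral)
  have P: "ev C (T2 (T1 (T3 (T2 (genF i3))))) = ?P"
    by (simp add: W1_vectors(4) L'_def E23_def)
  have mon: "pbw_monomial C ws 2 4 n = pbw_vector C ws 3 ^ m"
    by (simp add: pbw_monomial_def n_def lookup_single upt_rec eval_nat_numeral)
  have ex: "root_form C (pbw_root C ws 2) (pbw_root C ws 4) = 0"
    using mb mb2 by (auto simp: roots root_form_cmb)
  have keys: "Poly_Mapping.keys n \<subseteq> {2<..<4}"
    unfolding n_def by auto
  have "(\<Sum>k\<in>{2<..<4}. real (Poly_Mapping.lookup n k) * d (pbw_root C ws k))
      < d (pbw_root C ws 2) + d (pbw_root C ws 4)"
  proof (rule quantum_degree_coneD[OF d _ _ keys k])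
    show "ev C (pbw_vector C ws 4) * ev C (pbw_vector C ws 2) =
      sc C (q_var powi (- root_form C (pbw_root C ws 2) (pbw_root C ws 4))) *
        ev C (pbw_vector C ws 2) * ev C (pbw_vector C ws 4) + sc C k * ev C (pbw_monomial C ws 2 4 n)"
      unfolding mon ex v ev_mult ev_power P W1_vectors(2,3) using eq by simp
  qed (simp_all add: ws)
  moreover have "{2<..<4} = {3::nat}" by auto
  ultimately show ?thesis by (simp add: roots n_def lookup_single)
qed

end

context
  fixes ws rest
  assumes ws: "ws = [i1, i2, i1, i3, i2] @ rest"
begin

lemma W2_roots:
  "pbw_root C ws 0 = cmb 1 0 0" 
  "pbw_root C ws 1 = cmb 1 1 0" "pbw_root C ws 2 = cmb 0 1 0" "pbw_root C ws 3 = cmb (int m) (int m) 1"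
  "pbw_root C ws 4 = cmb (int m * int b - 1) (int m * int b) (int b)"
  by (simp_all add: ws pbw_root_def weyl_prod_def simple_root_cmb reflection_cmb eval_nat_numeral)

lemma W2_cone:
  assumes d: "d \<in> quantum_degree_cone \<Delta>p C ws"
  shows "d (cmb 0 1 0) + real b * d (cmb (int m) (int m) 1) < d (cmb 1 1 0) + d (cmb (int m * int b - 1) (int m
      * int b) (int b))"
proof -
  let ?V = "lusztig_F C (q i2) m X2 (F i3)"
  let ?G = "lusztig_F C (q i3) b ?V X1"
  obtain k where k: "k \<noteq> 0"
    and eq: "?G * X2 = sc C (if m * b = 1 then 1 else inverse (q i2)) * X2 * ?G + sc C k * (ev C (T1 (T2 (genF
        i1))) * ?V ^ b)"
    using W2_commutator by blast
  \<comment> \<open>All positions are shifted by one because of the additional first letter.\<close>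
  define n where "n = Poly_Mapping.single (2::nat) (1::nat) + Poly_Mapping.single 3 b"
  have n: "Poly_Mapping.lookup n 2 = 1" "Poly_Mapping.lookup n 3 = b"
    by (simp_all add: n_def lookup_add lookup_single)
  have v: "pbw_vector C ws 1 = T1 (genF i2)" "pbw_vector C ws 2 = T1 (T2 (genF i1))" "pbw_vector C ws 3 = T1
      (T2 (T1 (genF i3)))"
    "pbw_vector C ws 4 = T1 (T2 (T1 (T3 (genF i2))))"
    by (simp_all add: ws pbw_vector_def eval_nat_numeral)
  have mon: "pbw_monomial C ws 1 4 n = pbw_vector C ws 2 * pbw_vector C ws 3 ^ b"
    using n by (simp add: pbw_monomial_def upt_rec eval_nat_numeral)
  have ex: "q_var powi (- root_form C (pbw_root C ws 1) (pbw_root C ws 4)) =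
      (if m * b = 1 then 1 else inverse (q i2))"
    using mb by (auto simp: W2_roots[simplified] root_form_cmb qi_def power_int_minus)
  have keys: "Poly_Mapping.keys n \<subseteq> {1<..<4}"
    unfolding n_def by (rule order_trans[OF keys_add]) auto
  have "(\<Sum>k\<in>{1<..<4}. real (Poly_Mapping.lookup n k) * d (pbw_root C ws k))
      < d (pbw_root C ws 1) + d (pbw_root C ws 4)"
  proof (rule quantum_degree_coneD[OF d _ _ keys k])
    show "ev C (pbw_vector C ws 4) * ev C (pbw_vector C ws 1) =
      sc C (q_var powi (- root_form C (pbw_root C ws 1) (pbw_root C ws 4))) *
        ev C (pbw_vector C ws 1) * ev C (pbw_vector C ws 4) + sc C k * ev C (pbw_monomial C ws 1 4 n)"
      unfolding mon ex v ev_mult ev_power W2_vectors(2,3) by (rule eq)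
  qed (simp_all add: ws)
  moreover have "{1<..<4} = {2, 3::nat}" by auto
  ultimately show ?thesis using n by (simp add: W2_roots del: One_nat_def)
qed

end

text \<open>The letter \<open>i3\<close> is appended for a double edge only; there it supplies the
  third inequality.\<close>

lemma cones_disjoint:
  assumes d1: "d \<in> quantum_degree_cone \<Delta>p C ([i2, i1, i3, i2] @ (if m * b = 2 then [i3] else []) @ r1)"
    and d2: "d \<in> quantum_degree_cone \<Delta>p C ([i1, i2, i1, i3, i2] @ r2)"
  shows False
proof (cases "m * b = 2")
  case True
  then have mb': "int m * int b = 2" by (simp flip: of_nat_mult)
  have "d \<in> quantum_degree_cone \<Delta>p C ([i2, i1, i3, i2, i3] @ r1)" using d1 True by simp
  from W1_cone[OF refl d1] W2_cone[OF refl d2] W1_cone_double_edge[OF refl True this]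
  show False using mb True by (auto simp: mb')
next
  case False
  then have "m = 1" "b = 1" using mb by auto
  with W1_cone[OF refl d1] W2_cone[OF refl d2] show False by simp
qed

end

section \<open>Weyl groups of finite root sets\<close>

lemma sum_simple_root_right: "(\<Sum>i\<in>UNIV. f i * simple_root i k) = f (k :: 'i::finite)"
  by (simp add: simple_root_def if_distrib cong: if_cong)

definition root_linear :: "(('i::finite \<Rightarrow> int) \<Rightarrow> ('i \<Rightarrow> int)) \<Rightarrow>
    bool" where
  "root_linear f \<longleftrightarrow> (\<forall>x k. f x k = (\<Sum>i\<in>UNIV. x i * f (simple_root i) k))"

lemma root_linearD: "root_linear f \<Longrightarrow> f x k = (\<Sum>i\<in>UNIV. x i * f (simple_root i) k)"
  unfolding root_linear_def by blast

lemma root_linear_diff: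
  assumes "root_linear f"
  shows "f (\<lambda>j. x j - c * y j) = (\<lambda>k. f x k - c * f y k)"
proof
  fix k
  have "f (\<lambda>j. x j - c * y j) k = (\<Sum>i\<in>UNIV. x i * f (simple_root i) k) - c *
      (\<Sum>i\<in>UNIV. y i * f (simple_root i) k)"
    unfolding root_linearD[OF assms, of "\<lambda>j. x j - c * y j"]
    by (simp add: left_diff_distrib sum_subtractf sum_distrib_left mult.assoc)
  then show "f (\<lambda>j. x j - c * y j) k = f x k - c * f y k" by (simp flip: root_linearD[OF assms])
qed

lemma root_linear_comp:
  assumes f: "root_linear f" and g: "root_linear g"
  shows "root_linear (f \<circ> g)"
  unfolding root_linear_def
proof (intro allI)
  fix x k
  have "(f \<circ> g) x k = (\<Sum>i\<in>UNIV. (\<Sum>l\<in>UNIV. x l * g (simple_root l) i) * f (simple_root i) k)"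
    using root_linearD[OF f, of "g x" k] by (simp flip: root_linearD[OF g])
  also have "\<dots> = (\<Sum>l\<in>UNIV. x l * (\<Sum>i\<in>UNIV. g (simple_root l) i * f (simple_root i) k))"
    by (simp add: sum_distrib_left sum_distrib_right mult.assoc) (rule sum.swap)
  finally show "(f \<circ> g) x k = (\<Sum>i\<in>UNIV. x i * (f \<circ> g) (simple_root i) k)"
    by (simp flip: root_linearD[OF f])
qed

lemma root_linear_reflection: "root_linear (simple_reflection C j)"
  unfolding root_linear_def simple_reflection_def
  by (simp add: sum_simple_root right_diff_distrib sum_subtractf sum_simple_root_right sum_distrib_right
      mult.assoc mult.left_commute)

lemma weyl_prod_append: "weyl_prod C (u @ v) = weyl_prod C u \<circ> weyl_prod C v"
  by (induction u) (simp_all add: weyl_prod_def)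

lemma weyl_prod_Nil [simp]: "weyl_prod C [] = id"
  and weyl_prod_Cons: "weyl_prod C (i # u) = simple_reflection C i \<circ> weyl_prod C u"
  by (simp_all add: weyl_prod_def)

lemma root_linear_weyl: "root_linear (weyl_prod C u)"
proof (induction u)
  case Nil
  show ?case by (simp add: root_linear_def sum_simple_root_right)
next
  case (Cons j u)
  show ?case
    unfolding weyl_prod_Cons by (rule root_linear_comp[OF root_linear_reflection Cons.IH])
qed

locale root_set =
  fixes C :: "'i::finite \<Rightarrow> 'i \<Rightarrow> int" and \<Delta> :: "('i \<Rightarrow> int) set"
  assumes finite_roots: "finite \<Delta>"
    and simple: "simple_root i \<in> \<Delta>"
    and reflection: "\<beta> \<in> \<Delta> \<Longrightarrow> simple_reflection C i \<beta> \<in> \<Delta>"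
    and sign: "\<beta> \<in> \<Delta> \<Longrightarrow> (\<forall>i. 0 \<le> \<beta> i) \<or> (\<forall>i.
        \<beta> i \<le> 0)"
    and nonzero: "(\<lambda>_. 0) \<notin> \<Delta>"
    and diag: "C i i = 2"
begin

abbreviation "s \<equiv> simple_reflection C"
abbreviation "W \<equiv> weyl_prod C"
abbreviation "pairing i x \<equiv> (\<Sum>k\<in>UNIV. C i k * x k)"

lemma pairing_simple: "pairing i (simple_root j) = C i j"
  by (rule sum_simple_root)

lemma s_simple: "s i (simple_root i) = (\<lambda>k. - simple_root i k)"
  unfolding simple_reflection_def pairing_simple diag by auto

lemma s_s: "s i (s i x) = x"
proof -
  have "pairing i (s i x) = pairing i x - pairing i x * pairing i (simple_root i)"
    unfolding simple_reflection_def
    by (simp add: right_diff_distrib sum_subtractf sum_distrib_left mult.left_commute)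
  then have "pairing i (s i x) = - pairing i x"
    unfolding pairing_simple diag by simp
  then show ?thesis
    unfolding simple_reflection_def[of C i "s i x"] by (auto simp: simple_reflection_def)
qed

lemma W_rev: "W (rev u) (W u x) = x" "W u (W (rev u) x) = x"
proof (induction u arbitrary: x)
  case (Cons i u)
  { case 1 show ?case using Cons.IH(1) by (simp add: weyl_prod_append weyl_prod_Cons s_s) }
  { case 2 show ?case using Cons.IH(2) by (simp add: weyl_prod_append weyl_prod_Cons s_s) }
qed simp_all

lemma W_root: "\<beta> \<in> \<Delta> \<Longrightarrow> W u \<beta> \<in> \<Delta>"
  by (induction u) (simp_all add: weyl_prod_Cons reflection)

text \<open>By linearity an element is determined by its values on the simple roots, which lie in a
  finite set.\<close>

lemma finite_weyl_group: "finite (weyl_group C)"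
proof (rule finite_imageD)
  let ?f = "\<lambda>w i. w (simple_root i)"
  show "finite (?f ` weyl_group C)"
  proof (rule finite_subset)
    show "?f ` weyl_group C \<subseteq> (UNIV \<rightarrow>\<^sub>E \<Delta>)"
      by (auto simp: weyl_group_def intro!: W_root simple)
    show "finite (UNIV \<rightarrow>\<^sub>E \<Delta> :: ('i \<Rightarrow> 'i \<Rightarrow> int) set)"
      using finite_roots by (intro finite_PiE) auto
  qed
  show "inj_on ?f (weyl_group C)"
  proof (rule inj_onI)
    fix v w assume "v \<in> weyl_group C" "w \<in> weyl_group C" and eq: "?f v = ?f w"
    then have l: "root_linear v" "root_linear w" by (auto simp: weyl_group_def root_linear_weyl)
    show "v = w"
    proof (intro ext)
      fix x k show "v x k = w x k"
        using eq unfolding root_linearD[OF l(1), of x] root_linearD[OF l(2), of x] by (metis (no_types, lifting))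
    qed
  qed
qed

text \<open>The standard scalar product of coordinates summed over the finite Weyl group: an
  invariant positive definite form, used in the role of the Killing form. Its integer values also
  provide a symmetrizer.\<close>

definition B :: "('i \<Rightarrow> int) \<Rightarrow> ('i \<Rightarrow> int) \<Rightarrow> int" where
  "B x y = (\<Sum>w\<in>weyl_group C. \<Sum>k\<in>UNIV. w x k * w y k)"

lemma B_commute: "B x y = B y x"
  by (simp add: B_def mult.commute)

lemma B_linear: "B x y = (\<Sum>i\<in>UNIV. x i * B (simple_root i) y)"
proof -
  have "(\<Sum>k\<in>UNIV. w x k * w y k) = (\<Sum>i\<in>UNIV. x i * (\<Sum>k\<in>UNIV. w (simple_root i) k * w y k))"
    if "w \<in> weyl_group C" for w
  proof -
    have "root_linear w" using that by (auto simp: weyl_group_def root_linear_weyl)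
    then have "(\<Sum>k\<in>UNIV. w x k * w y k) = (\<Sum>k\<in>UNIV. (\<Sum>i\<in>UNIV. x i * w (simple_root
        i) k) * w y k)"
      by (simp flip: root_linearD)
    also have "\<dots> = (\<Sum>i\<in>UNIV. x i * (\<Sum>k\<in>UNIV. w (simple_root i) k * w y k))"
      by (simp add: sum_distrib_left sum_distrib_right mult.assoc) (rule sum.swap)
    finally show ?thesis .
  qed
  then have "B x y = (\<Sum>w\<in>weyl_group C. \<Sum>i\<in>UNIV. x i * (\<Sum>k\<in>UNIV. w (simple_root i) k
      * w y k))"
    unfolding B_def by (rule sum.cong[OF refl])
  also have "\<dots> = (\<Sum>i\<in>UNIV. x i * B (simple_root i) y)"
    unfolding B_def sum_distrib_left by (rule sum.swap)
  finally show ?thesis .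
qed

lemma B_pos: 
  assumes "x k \<noteq> 0"
  shows "B x x > 0"
proof -
  have "id \<in> weyl_group C" unfolding weyl_group_def by (metis rangeI weyl_prod_Nil)
  moreover have "0 < (\<Sum>k\<in>UNIV. id x k * id x k)"
    using assms by (intro sum_pos2[of _ k]) (auto simp: zero_less_mult_iff)
  ultimately show ?thesis
    unfolding B_def using finite_weyl_group by (intro sum_pos2[of _ id]) (auto intro: sum_nonneg)
qed

lemma B_simple_pos: "B (simple_root i) (simple_root i) > 0"
  by (rule B_pos[of _ i]) (simp add: simple_root_def)

lemma B_s: "B (s i x) (s i y) = B x y"
  unfolding B_def
proof (rule sum.reindex_bij_witness[where i = "\<lambda>w. w \<circ> s i" and j = "\<lambda>w. w \<circ> s i"])
  fix w assume "w \<in> weyl_group C"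
  then obtain u where "w = W u" by (auto simp: weyl_group_def)
  then have "w \<circ> s i = W (u @ [i])" by (simp add: weyl_prod_append weyl_prod_Cons)
  then show "w \<circ> s i \<in> weyl_group C" "w \<circ> s i \<in> weyl_group C" by (auto simp: weyl_group_def)
qed (auto simp: s_s fun_eq_iff)

lemma B_W: "B (W u x) (W u y) = B x y"
  by (induction u) (simp_all add: weyl_prod_Cons B_s)

lemma B_add: "B (\<lambda>k. a * x k + c * y k) z = a * B x z + c * B y z"
  unfolding B_linear[of "\<lambda>k. a * x k + c * y k"] B_linear[of x] B_linear[of y]
  by (simp add: sum_distrib_left algebra_simps sum.distrib)

text \<open>Reflecting both arguments in alpha_i changes the sign of the first and subtracts a
  multiple of alpha_i from the second.\<close>

lemma B_pairing: "2 * B (simple_root i) x = pairing i x * B (simple_root i) (simple_root i)"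
proof -
  have "B (simple_root i) x = B (s i (simple_root i)) (s i x)" by (rule B_s[symmetric])
  also have "\<dots> = - B (simple_root i) (s i x)"
    using B_add[of "-1" "simple_root i" 0 "simple_root i"] by (simp add: s_simple)
  also have "B (simple_root i) (s i x) = B x (simple_root i) - pairing i x * B (simple_root i) (simple_root i)"
    using B_add[of 1 x "- pairing i x" "simple_root i" "simple_root i"]
    by (subst B_commute) (simp add: simple_reflection_def)
  finally show ?thesis by (simp add: B_commute)
qed

lemma B_simple: "2 * B (simple_root i) (simple_root j) = C i j * B (simple_root i) (simple_root i)"
  using B_pairing[of i "simple_root j"] by (simp add: pairing_simple)

lemma C_nonpos: "i \<noteq> j \<Longrightarrow> C i j \<le> 0"
proof -
  assume "i \<noteq> j"
  have "s i (simple_root j) \<in> \<Delta>" by (intro reflection simple)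
  moreover have *: "s i (simple_root j) j = 1" "s i (simple_root j) i = - C i j"
    unfolding simple_reflection_def pairing_simple using \<open>i \<noteq> j\<close> by (auto simp: simple_root_def)
  ultimately consider "0 \<le> s i (simple_root j) i" | "s i (simple_root j) j \<le> 0" using sign by blast
  then show ?thesis by cases (simp_all add: *)
qed

lemma C_sym: "C i j * B (simple_root i) (simple_root i) = C j i * B (simple_root j) (simple_root j)"
  using B_simple[of i j] B_simple[of j i] B_commute by metis

lemma C_zero: "C i j = 0 \<longleftrightarrow> C j i = 0"
  using C_sym[of i j] B_simple_pos[of i] B_simple_pos[of j] by auto

section \<open>Exchange condition and reduced words of the longest element\<close>

lemma conjugate_reflection:
  assumes "W u (simple_root i) = simple_root j"
  shows "W u (s i x) = s j (W u x)"
proof -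
  have "2 * B (simple_root j) (W u x) = 2 * B (simple_root i) x" "B (simple_root j) (simple_root j) = B
      (simple_root i) (simple_root i)"
    using B_W[of u "simple_root i" x] B_W[of u "simple_root i" "simple_root i"] unfolding assms by simp_all
  then have "pairing j (W u x) = pairing i x"
    using B_pairing[of j "W u x"] B_pairing[of i x] B_simple_pos[of i] by simp
  moreover have "W u (s i x) = (\<lambda>k. W u x k - pairing i x * W u (simple_root i) k)"
    unfolding simple_reflection_def by (rule root_linear_diff[OF root_linear_weyl])
  ultimately show ?thesis by (simp add: assms simple_reflection_def)
qed

text \<open>Reading the word from its right end, the image of alpha_i turns negative at some letter
  j. Just before, it is a positive root made negative by s_j, hence alpha_j itself, and conjugating
  s_i to s_j cancels that letter.\<close>

lemma exchange:
  assumes "\<And>k. W u (simple_root i) k \<le> 0"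
  shows "\<exists>u1 j u2. u = u1 @ [j] @ u2 \<and> W (u @ [i]) = W (u1 @ u2)"
  using assms
proof (induction u)
  case Nil
  from Nil[of i] show ?case by (simp add: simple_root_def)
next
  case (Cons j u)
  let ?g = "W u (simple_root i)"
  show ?case
  proof (cases "\<forall>k. ?g k \<le> 0")
    case True
    with Cons.IH obtain u1 l u2 where "u = u1 @ [l] @ u2" "W (u @ [i]) = W (u1 @ u2)" by blast
    then have "j # u = (j # u1) @ [l] @ u2" "W ((j # u) @ [i]) = W ((j # u1) @ u2)"
      by (simp_all add: weyl_prod_Cons)
    then show ?thesis by blast
  next
    case False
    have "?g \<in> \<Delta>" by (rule W_root[OF simple])
    with False have pos: "0 \<le> ?g k" for k using sign by blast
    have other: "?g k = 0" if "k \<noteq> j" for k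
    proof -
      have "s j ?g k = ?g k" using that by (simp add: simple_reflection_def simple_root_def)
      with Cons.prems[of k] pos[of k] show ?thesis by (simp add: weyl_prod_Cons)
    qed
    then have g: "?g = (\<lambda>k. ?g j * simple_root j k)" by (auto simp: simple_root_def)
    \<comment> \<open>The root is g_j alpha_j; transporting it back to alpha_i writes 1 as g_j times
      an integer, so g_j = 1.\<close>
    have "simple_root i i = W (rev u) ?g i" by (simp add: W_rev)
    also have "\<dots> = (\<Sum>k\<in>UNIV. ?g k * W (rev u) (simple_root k) i)"
      by (rule root_linearD[OF root_linear_weyl])
    also have "\<dots> = (\<Sum>k\<in>UNIV. if k = j then ?g j * W (rev u) (simple_root j) i else 0)"
      by (rule sum.cong) (auto simp: other)
    finally have "?g j * W (rev u) (simple_root j) i = 1" by (simp add: simple_root_def)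
    moreover from this have "0 < ?g j" using pos[of j] by (cases "?g j = 0") auto
    ultimately have "?g j = 1" by (simp add: pos_zmult_eq_1_iff)
    with g have "?g = simple_root j" by simp
    then have "W ((j # u) @ [i]) = W ([] @ u)"
      using conjugate_reflection[of u i j] by (auto simp: weyl_prod_append weyl_prod_Cons s_s)
    moreover have "j # u = [] @ [j] @ u" by simp
    ultimately show ?thesis by blast
  qed
qed

lemma W_inverse_words: "W u = W v \<Longrightarrow> W (rev u) = W (rev v)"
  by (metis W_rev ext)

lemma weyl_length_le: "weyl_length C (W u) \<le> length u"
  unfolding weyl_length_def by (rule Least_le) blast

lemma reduced_word: "\<exists>u. length u = weyl_length C (W v) \<and> W u = W v"
  unfolding weyl_length_def
  by (rule LeastI[of "\<lambda>l. \<exists>u. length u = l \<and> W u = W v" "length v"]) blast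

lemma weyl_length_descent:
  assumes "\<And>k. W u (simple_root i) k \<le> 0"
  shows "weyl_length C (W (u @ [i])) < weyl_length C (W u)"
proof -
  obtain v where v: "W v = W u" "length v = weyl_length C (W u)" using reduced_word by blast
  have "\<exists>v1 j v2. v = v1 @ [j] @ v2 \<and> W (v @ [i]) = W (v1 @ v2)"
    by (rule exchange) (simp add: v assms)
  then obtain v1 j v2 where *: "v = v1 @ [j] @ v2" "W (v @ [i]) = W (v1 @ v2)" by blast
  have "W (u @ [i]) = W (v1 @ v2)" using *(2) v(1) by (simp add: weyl_prod_append)
  then have "weyl_length C (W (u @ [i])) \<le> length (v1 @ v2)" using weyl_length_le by metis
  also have "\<dots> < length v" using *(1) by simp
  finally show ?thesis using v by simp
qed

lemma longest_element: "longest_element C \<in> weyl_group C" "w \<in> weyl_group C \<Longrightarrow>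
    weyl_length C w \<le> weyl_length C (longest_element C)"
proof -
  let ?b = "Suc (Max (weyl_length C ` weyl_group C))"
  have b: "\<forall>w. w \<in> weyl_group C \<longrightarrow> weyl_length C w < ?b"
    using finite_weyl_group by (auto simp: less_Suc_eq_le)
  have i: "id \<in> weyl_group C" unfolding weyl_group_def by (metis rangeI weyl_prod_Nil)
  show "longest_element C \<in> weyl_group C"
    unfolding longest_element_def by (rule arg_max_natI[of "\<lambda>w. w \<in> weyl_group C", OF i b])
  show "weyl_length C w \<le> weyl_length C (longest_element C)" if "w \<in> weyl_group C"
    unfolding longest_element_def by (rule arg_max_nat_le[of "\<lambda>w. w \<in> weyl_group C", OF that b])
qed

text \<open>If w0 alpha_i were positive, w0 s_i would send alpha_i to a negative root, and the
  descent from w0 s_i to w0 would make w0 s_i longer.\<close>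

lemma longest_negative:
  assumes "\<And>k. 0 \<le> x k"
  shows "longest_element C x k \<le> 0"
proof -
  obtain u where u: "longest_element C = W u" using longest_element(1) by (auto simp: weyl_group_def)
  have "W u (simple_root i) k \<le> 0" for i k
  proof (rule ccontr)
    assume "\<not> W u (simple_root i) k \<le> 0"
    then have pos: "0 \<le> W u (simple_root i) k" for k
      using sign[OF W_root[OF simple], of u i] by blast
    have "W (u @ [i]) (simple_root i) = (\<lambda>k. - W u (simple_root i) k)"
    proof
      fix k
      show "W (u @ [i]) (simple_root i) k = - W u (simple_root i) k"
        using root_linear_diff[OF root_linear_weyl, of C u "simple_root i" 2 "simple_root i"]
        by (simp add: weyl_prod_append weyl_prod_Cons s_simple)
    qed
    then have "weyl_length C (W ((u @ [i]) @ [i])) < weyl_length C (W (u @ [i]))"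
      using pos by (intro weyl_length_descent) simp
    moreover have "W ((u @ [i]) @ [i]) = W u"
      by (auto simp: weyl_prod_append weyl_prod_Cons s_s)
    moreover have "weyl_length C (W (u @ [i])) \<le> weyl_length C (W u)"
      using longest_element(2)[of "W (u @ [i])"] u by (simp add: weyl_group_def)
    ultimately show False by simp
  qed
  then show ?thesis
    unfolding u root_linearD[OF root_linear_weyl, of C u x] using assms
    by (intro sum_nonpos mult_nonneg_nonpos) auto
qed

text \<open>Given a completion \<open>v\<close> of \<open>u\<close>, the next letter i is inserted
  after \<open>u\<close>, and exchange removes one letter from \<open>v\<close> in return. One
  positive coefficient of each root suffices, since coefficients of a root share a sign.\<close>

lemma extend_to_longest:
  assumes "\<And>t. t < length u \<Longrightarrow> \<exists>k. pbw_root C u t k > 0"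
  shows "\<exists>v. u @ v \<in> reduced_decompositions C (longest_element C)"
  using assms
proof (induction u rule: rev_induct)
  case Nil
  obtain u where u: "longest_element C = W u" using longest_element(1) by (auto simp: weyl_group_def)
  then show ?case using reduced_word[of u] by (auto simp: reduced_decompositions_def)
next
  case (snoc i u)
  have "\<exists>k. pbw_root C u t k > 0" if "t < length u" for t
    using snoc.prems[of t] that by (simp add: pbw_root_def nth_append)
  then obtain v where "u @ v \<in> reduced_decompositions C (longest_element C)"
    using snoc.IH by blast
  then have v: "W (u @ v) = longest_element C" "length (u @ v) = weyl_length C (longest_element C)"
    by (auto simp: reduced_decompositions_def)
  let ?g = "W u (simple_root i)"
  have g: "?g \<in> \<Delta>" by (rule W_root[OF simple])
  moreover have "\<exists>k. ?g k > 0" using snoc.prems[of "length u"] by (simp add: pbw_root_def)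
  ultimately have gpos: "0 \<le> ?g k" for k using sign by (meson not_le)
  \<comment> \<open>The longest element sends v^{-1} alpha_i to u alpha_i, which is positive, and it
    reverses signs.\<close>
  have "W (rev v) (simple_root i) k \<le> 0" for k
  proof (rule ccontr)
    assume "\<not> W (rev v) (simple_root i) k \<le> 0"
    then have "0 \<le> W (rev v) (simple_root i) k" for k
      using sign[OF W_root[OF simple], of "rev v" i] by blast
    then have "longest_element C (W (rev v) (simple_root i)) k \<le> 0" for k by (rule longest_negative)
    moreover have "longest_element C (W (rev v) (simple_root i)) = ?g"
      unfolding v(1)[symmetric] by (simp add: weyl_prod_append W_rev)
    ultimately have "?g = (\<lambda>_. 0)" using gpos by (metis antisym_conv ext)
    with g nonzero show False by simp
  qed
  from exchange[OF this] obtain a j c where ac: "rev v = a @ [j] @ c" "W (rev v @ [i]) = W (a @ c)" by blast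
  have e: "W (rev (a @ c)) = s i \<circ> W v" using W_inverse_words[OF ac(2)] by (simp add: weyl_prod_Cons)
  have ss: "s i \<circ> (s i \<circ> f) = f" for f :: "('i \<Rightarrow> int) \<Rightarrow> 'i \<Rightarrow>
      int" by (simp add: fun_eq_iff s_s)
  have "W ((u @ [i]) @ rev (a @ c)) = longest_element C"
    unfolding v(1)[symmetric] weyl_prod_append[of C _ "rev (a @ c)"] e
    by (simp add: weyl_prod_append weyl_prod_Cons comp_assoc ss)
  moreover have "length v = Suc (length (rev (a @ c)))" using arg_cong[OF ac(1), of length] by simp
  ultimately have "(u @ [i]) @ rev (a @ c) \<in> reduced_decompositions C (longest_element C)"
    using v(2) by (simp add: reduced_decompositions_def)
  then show ?case by blast
qed

end

section \<open>Rank three paths in Dynkin diagrams\<close>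

definition indecomposable :: "('i \<Rightarrow> 'i \<Rightarrow> int) \<Rightarrow> bool" where
  "indecomposable C \<longleftrightarrow> (\<forall>I. I \<noteq> {} \<longrightarrow> I \<noteq> UNIV
      \<longrightarrow> (\<exists>i\<in>I. \<exists>j. j \<notin> I \<and> C i j \<noteq> 0))"

lemma indecomposableE:
  assumes "indecomposable C" "i \<in> I" "I \<noteq> UNIV"
  obtains a c where "a \<in> I" "c \<notin> I" "C a c \<noteq> 0"
  using assms unfolding indecomposable_def by blast

context root_set
begin

lemma symmetrizer_exists: "symmetrizer C (\<lambda>i. nat (B (simple_root i) (simple_root i)))"
  unfolding symmetrizer_def using B_simple_pos C_sym by (auto simp: mult.commute less_imp_le)

text \<open>The symmetrizer equations carry the ratio at i across every nonzero Cartan entry, so by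
  indecomposability to every index.\<close>

lemma symmetrizer_proportional:
  assumes e: "symmetrizer C e" "symmetrizer C e'" and ind: "indecomposable C"
  shows "e j * e' i = e' j * e i"
proof -
  let ?I = "{j. e j * e' i = e' j * e i}"
  have "?I = UNIV"
  proof (rule ccontr)
    assume "?I \<noteq> UNIV"
    have "i \<in> ?I" by simp
    from ind this \<open>?I \<noteq> UNIV\<close> obtain a c where ac: "a \<in> ?I" "c \<notin> ?I" "C a c \<noteq> 0"
      by (rule indecomposableE)
    have 1: "int (e a) * C a c = int (e c) * C c a" "int (e' a) * C a c = int (e' c) * C c a"
      using e by (simp_all add: symmetrizer_def)
    have "int (e c) * int (e' i) * C c a = int (e a) * int (e' i) * C a c" using 1(1) by (simp add: algebra_simps)
    also have "int (e a) * int (e' i) = int (e' a) * int (e i)" using ac(1) by (simp flip: of_nat_mult)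
    also have "int (e' a) * int (e i) * C a c = int (e' c) * int (e i) * C c a" using 1(2) by (simp add:
        algebra_simps)
    finally have "int (e c) * int (e' i) = int (e' c) * int (e i)" using ac(3) C_zero by auto
    then have "c \<in> ?I" by (simp flip: of_nat_mult)
    then show False using ac by simp
  qed
  then show ?thesis by blast
qed

text \<open>By proportionality, a symmetrizer whose value at one index is minimal is minimal at all
  indices. This makes the \<open>LEAST\<close> in the pointwise order an actual minimum.\<close>

lemma symmetrizer_eps:
  assumes ind: "indecomposable C"
  shows "symmetrizer C (eps C)"
proof -
  fix i :: 'i
  obtain e where e: "symmetrizer C e" and min: "\<And>e'. symmetrizer C e' \<Longrightarrow> e i \<le> e' i"
    using ex_has_least_nat[of "symmetrizer C" _ "\<lambda>e. e i"] symmetrizer_exists by blast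
  have "e \<le> e'" if e': "symmetrizer C e'" for e'
  proof (rule le_funI)
    fix j
    have "e j * e' i = e' j * e i" by (rule symmetrizer_proportional[OF e e' ind])
    moreover have "e' j * e i \<le> e' j * e' i" using min[OF e'] by simp
    ultimately have "e j * e' i \<le> e' j * e' i" by simp
    moreover have "e' i > 0" using e' by (simp add: symmetrizer_def)
    ultimately show "e j \<le> e' j" by simp
  qed
  then have "eps C = e" unfolding eps_def by (intro Least_equality e)
  with e show ?thesis by simp
qed

text \<open>Descent: a simple reflection in \<open>I\<close> with nonzero pairing shrinks the part of \<open>\<beta>\<close> inside \<open>I\<close>
  and keeps the part outside \<open>I\<close>, whose sign forces the new coefficients to keep their sign;
  the inner part can never become \<open>0\<close>.\<close>

lemma root_support:
  assumes I: "\<And>i j. i \<in> I \<Longrightarrow> j \<notin> I \<Longrightarrow> C i j = 0" and "\<beta>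
      \<in> \<Delta>" "j \<notin> I" "\<beta> j \<noteq> 0" "i \<in> I"
  shows "\<beta> i = 0"
  using assms(2-5)
proof (induction "\<Sum>i\<in>I. nat \<bar>\<beta> i\<bar>" arbitrary: \<beta> i rule: less_induct)
  case less
  show ?case
  proof (rule ccontr)
    assume nz: "\<beta> i \<noteq> 0"
    define x where "x k = (if k \<in> I then \<beta> k else 0)" for k
    have "0 < B x x" using less.prems nz by (intro B_pos[of _ i]) (simp add: x_def)
    \<comment> \<open>B x x is the sum of the terms x_l B(alpha_l, x); a positive term supplies the
      reflection for the descent.\<close>
    moreover have "B x x \<le> 0" if "\<And>l. x l * B (simple_root l) x \<le> 0"
      by (subst B_linear) (simp add: that sum_nonpos)
    ultimately obtain l where l: "0 < x l * B (simple_root l) x" by (meson not_le)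
    then have lI: "l \<in> I" by (auto simp: x_def split: if_splits)
    let ?c = "pairing l \<beta>"
    have cx: "?c = pairing l x" by (intro sum.cong refl) (auto simp: x_def I[OF lI])
    have "x l = \<beta> l" using lI by (simp add: x_def)
    then have "\<beta> l * (?c * B (simple_root l) (simple_root l)) = 2 * (x l * B (simple_root l) x)"
      unfolding cx B_pairing[symmetric] by simp
    then have "0 < \<beta> l * ?c * B (simple_root l) (simple_root l)" using l by (simp add: mult.assoc)
    then have c: "0 < \<beta> l * ?c" using B_simple_pos[of l] by (simp add: zero_less_mult_iff)
    let ?\<gamma> = "s l \<beta>"
    have \<gamma>: "?\<gamma> \<in> \<Delta>" by (rule reflection[OF less.prems(1)])
    have \<gamma>l: "?\<gamma> l = \<beta> l - ?c" and \<gamma>k: "k \<noteq> l \<Longrightarrow> ?\<gamma> k =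
        \<beta> k" for k
      by (simp_all add: simple_reflection_def simple_root_def)
    have jl: "j \<noteq> l" using lI less.prems by auto
    have "\<bar>?\<gamma> l\<bar> < \<bar>\<beta> l\<bar>"
    proof (cases "\<beta> j > 0")
      case True
      then have "\<beta> l \<ge> 0" "?\<gamma> l \<ge> 0" using sign[OF less.prems(1)] sign[OF \<gamma>]
          \<gamma>k[OF jl] by (metis not_le)+
      then show ?thesis using c \<gamma>l by (auto simp: zero_less_mult_iff)
    next
      case False
      then have "\<beta> j < 0" using less.prems by simp
      then have "\<beta> l \<le> 0" "?\<gamma> l \<le> 0" using sign[OF less.prems(1)] sign[OF \<gamma>]
          \<gamma>k[OF jl] by (metis not_le)+
      then show ?thesis using c \<gamma>l by (auto simp: zero_less_mult_iff)
    qed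
    then have lt: "nat \<bar>?\<gamma> l\<bar> < nat \<bar>\<beta> l\<bar>" by linarith
    have "(\<Sum>i\<in>I. nat \<bar>?\<gamma> i\<bar>) < (\<Sum>i\<in>I. nat \<bar>\<beta> i\<bar>)"
    proof (rule sum_strict_mono_ex1)
      show "\<forall>k\<in>I. nat \<bar>?\<gamma> k\<bar> \<le> nat \<bar>\<beta> k\<bar>" using lt \<gamma>k
          by (metis le_refl less_imp_le)
      show "\<exists>k\<in>I. nat \<bar>?\<gamma> k\<bar> < nat \<bar>\<beta> k\<bar>" using lt lI by blast
    qed simp
    then have zero: "?\<gamma> k = 0" if "k \<in> I" for k
      using less.hyps[OF _ \<gamma> less.prems(2) _ that] \<gamma>k[OF jl] less.prems(3) by simp
    \<comment> \<open>If the part of s_l beta inside \<open>I\<close> vanishes, then beta is c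
      alpha_l there, and pairing with alpha_l gives c = 2 c.\<close>
    have "\<beta> k = ?c * simple_root l k" if "k \<in> I" for k
      using zero[OF that] \<gamma>l \<gamma>k[of k] by (auto simp: simple_root_def)
    then have "C l k * \<beta> k = C l k * (?c * simple_root l k)" for k
      using I[OF lI, of k] by (cases "k \<in> I") auto
    then have "?c = pairing l (\<lambda>k. ?c * simple_root l k)" by (rule sum.cong[OF refl])
    also have "\<dots> = ?c * pairing l (simple_root l)" by (simp add: sum_distrib_left algebra_simps)
    finally have "?c = 0" by (simp add: pairing_simple diag)
    with c show False by simp
  qed
qed

lemma B_three: 
  fixes x y z :: int and i j k :: 'i
  defines "v \<equiv> \<lambda>l. x * simple_root i l + y * simple_root j l + z * simple_root k l"
  shows "B v v = x\<^sup>2 * B (simple_root i) (simple_root i) + y\<^sup>2 * B (simple_root j) (simple_root j)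
      + z\<^sup>2 * B (simple_root k) (simple_root k)
     + x * y * (2 * B (simple_root i) (simple_root j)) + y * z * (2 * B (simple_root j) (simple_root k)) + x *
         z * (2 * B (simple_root i) (simple_root k))"
proof -
  have B3: "B v w = x * B (simple_root i) w + y * B (simple_root j) w + z * B (simple_root k) w" for w
    using B_add[of 1 "\<lambda>l. x * simple_root i l + y * simple_root j l" z "simple_root k" w]
      B_add[of x "simple_root i" y "simple_root j" w] by (simp add: v_def)
  have "B (simple_root l) v = x * B (simple_root i) (simple_root l) + y * B (simple_root j) (simple_root l) + z
      * B (simple_root k) (simple_root l)" for l
    by (subst B_commute) (rule B3)
  then show ?thesis
    unfolding B3[of v]
    by (simp add: algebra_simps power2_eq_square B_commute[of "simple_root j" "simple_root i"]
      B_commute[of "simple_root k" "simple_root i"] B_commute[of "simple_root k" "simple_root j"])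
qed

text \<open>Otherwise the sum of the three simple roots would have norm at most 0, as for the null
  root of affine type A_2.\<close>

lemma no_triangle:
  assumes d: "i \<noteq> j" "j \<noteq> k" "i \<noteq> k" and "C i j \<noteq> 0" "C j k \<noteq> 0"
  shows "C i k = 0"
proof (rule ccontr)
  assume "C i k \<noteq> 0"
  then have c: "C i j \<le> - 1" "C j k \<le> - 1" "C k i \<le> - 1"
    using assms C_nonpos[of i j] C_nonpos[of j k] C_nonpos[of k i] C_zero[of i k] by auto
  have le: "2 * B (simple_root a) (simple_root a') \<le> - B (simple_root a) (simple_root a)" if "C a a' \<le>
      -1" for a a'
    using mult_right_mono[OF that, of "B (simple_root a) (simple_root a)"] B_simple_pos[of a] B_simple[of a a']
        by simp
  let ?v = "\<lambda>l. 1 * simple_root i l + 1 * simple_root j l + 1 * simple_root k l"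
  have "?v i \<noteq> 0" using d by (simp add: simple_root_def)
  then have "0 < B ?v ?v" by (rule B_pos)
  then show False
    unfolding B_three using le[OF c(1)] le[OF c(2)] le[OF c(3)] B_commute[of "simple_root k" "simple_root i"] by simp
qed

text \<open>The test vector is twice the component of alpha_j orthogonal to alpha_i and alpha_k; its
  positive norm is the inequality.\<close>

lemma path_bound:
  assumes d: "i \<noteq> j" "j \<noteq> k" "i \<noteq> k" and ik: "C i k = 0"
  shows "C i j * C j i + C j k * C k j < 4"
proof -
  let ?v = "\<lambda>l. - C i j * simple_root i l + 2 * simple_root j l + - C k j * simple_root k l"
  let ?b = "\<lambda>i. B (simple_root i) (simple_root i)"
  have "?v j \<noteq> 0" using d by (simp add: simple_root_def)
  then have "0 < B ?v ?v" by (rule B_pos)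
  moreover have "B ?v ?v = ?b j * (4 - C i j * C j i - C j k * C k j)"
    unfolding B_three B_simple ik using C_sym[of i j] C_sym[of k j] by algebra
  ultimately have "0 < ?b j * (4 - C i j * C j i - C j k * C k j)" by simp
  then show ?thesis using B_simple_pos[of j] by (simp add: zero_less_mult_iff)
qed

lemma path_exists:
  assumes ind: "indecomposable C" and card: "card (UNIV :: 'i set) \<ge> 3"
  obtains i j k where "i \<noteq> j" "j \<noteq> k" "i \<noteq> k" "C i j \<noteq> 0" "C j k \<noteq> 0"
proof -
  fix a :: 'i
  have ne: "{a, c} \<noteq> UNIV" for c :: 'i
  proof
    assume "{a, c} = UNIV"
    moreover have "card {a, c} \<le> 2" by (simp add: card_insert_if)
    ultimately show False using card by simp
  qed
  obtain c where c: "c \<noteq> a" "C a c \<noteq> 0"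
    using indecomposableE[OF ind, of a "{a}"] ne[of a] by auto
  obtain x k where xk: "x \<in> {a, c}" "k \<notin> {a, c}" "C x k \<noteq> 0"
    using indecomposableE[OF ind, of a "{a, c}"] ne[of c] by blast
  show thesis
  proof (cases "x = a")
    case True
    then show thesis using that[of c a k] c xk C_zero by auto
  next
    case False
    then show thesis using that[of a c k] c xk by auto
  qed
qed

text \<open>Both edge products are at least 1 and their sum is less than 4, so one is 1 and the
  other at most 2. The path is read in the direction that puts the simple edge first.\<close>

lemma cartan_path_exists:
  assumes ind: "indecomposable C" and card: "card (UNIV :: 'i set) \<ge> 3"
  obtains i1 i2 i3 m b where "cartan_path C i1 i2 i3 m b"
proof -
  obtain i j k where d: "i \<noteq> j" "j \<noteq> k" "i \<noteq> k" and nz: "C i j \<noteq> 0" "C j k \<noteq> 0"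
    using path_exists[OF ind card] .
  have ik: "C i k = 0" by (rule no_triangle[OF d nz])
  note outer = that
  have path: thesis if d: "i \<noteq> j" "j \<noteq> k" "i \<noteq> k" and nz: "C i j \<noteq> 0" "C j k
      \<noteq> 0" and ik: "C i k = 0"
    and 1: "C i j * C j i = 1" and lt: "C j k * C k j < 3" for i j k
  proof -
    define m b where "m = nat (- C j k)" and "b = nat (- C k j)"
    have C: "C j k = - int m" "C k j = - int b" "m > 0" "b > 0"
      using C_nonpos[of j k] C_nonpos[of k j] d nz C_zero[of j k] by (auto simp: m_def b_def)
    then have "m * b < 3" using lt by (simp flip: of_nat_mult)
    moreover have "m \<le> m * b" "b \<le> m * b" using C by simp_all
    ultimately have "m < 3" "b < 3" "m * b < 3" by (blast intro: le_less_trans)+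
    then have "m \<in> {1, 2}" "b \<in> {1, 2}" "m * b < 3" using C(3,4) by auto
    then have mb: "m = 1 \<and> b = 1 \<or> m = 1 \<and> b = 2 \<or> m = 2 \<and> b = 1"
      by auto
    have "C i j = - 1" "C j i = - 1"
      using 1 C_nonpos[of i j] d(1) by (auto simp: zmult_eq_1_iff)
    then have "cartan_path C i j k m b"
      using d ik C(1,2) mb C_zero[of i k] symmetrizer_eps[OF ind] by unfold_locales (auto simp: diag)
    then show thesis by (rule outer)
  qed
  have "C i j \<le> -1" "C j i \<le> -1" "C j k \<le> -1" "C k j \<le> -1"
    using C_nonpos[of i j] C_nonpos[of j i] C_nonpos[of j k] C_nonpos[of k j] nz d C_zero[of i j] C_zero[of j
        k] by auto
  moreover have "1 \<le> x * y" if "x \<le> -1" "y \<le> -1" for x y :: int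
    using mult_mono[of 1 "-x" 1 "-y"] that by simp
  ultimately have "1 \<le> C i j * C j i" "1 \<le> C j k * C k j" by blast+
  then consider "C i j * C j i = 1" "C j k * C k j < 3" | "C k j * C j k = 1" "C j i * C i j < 3"
    using path_bound[OF d ik] by (fastforce simp: mult.commute)
  then show thesis
  proof cases
    case 1
    then show thesis using path[OF d nz ik] by blast
  next
    case 2
    then show thesis using path[of k j i] d nz ik C_zero by blast
  qed
qed

theorem cones_empty:
  assumes ind: "indecomposable C" and card: "card (UNIV :: 'i set) \<ge> 3"
  shows "(\<Inter>ws\<in>reduced_decompositions C (longest_element C). quantum_degree_cone \<Delta>p C ws) = {}"
proof -
  obtain i1 i2 i3 m b where "cartan_path C i1 i2 i3 m b" using cartan_path_exists[OF ind card] .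
  then interpret cartan_path C i1 i2 i3 m b .
  have cmb: "cmb x y z i1 = x" "cmb x y z i2 = y" "cmb x y z i3 = z" for x y z
    using distinct by (simp_all add: comb_def simple_root_def)
  have mb_pos: "m > 0" "b > 0" using mb by auto
  let ?w = "[i2, i1, i3, i2] @ (if m * b = 2 then [i3] else [])"
  have "\<exists>k. pbw_root C ?w t k > 0" if "t < length ?w" for t
  proof -
    note r = W1_roots[OF refl, of "if m * b = 2 then [i3] else []"]
    consider "t = 0" | "t = 1" | "t = 2" | "t = 3" | "t = 4" "m * b = 2" using \<open>t < length ?w\<close> by
        (fastforce split: if_splits)
    then show ?thesis
    proof cases
      case 5
      then show ?thesis using W1_root4[OF _ 5(2), of ?w "[]"] by (intro exI[of _ i3]) (simp add: cmb)
    qed (use r cmb in \<open>auto intro: exI[of _ i2] exI[of _ i1] exI[of _ i3] simp del: One_nat_def\<close>)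
  qed
  then obtain v where v: "?w @ v \<in> reduced_decompositions C (longest_element C)"
    using extend_to_longest by blast
  let ?w' = "[i1, i2, i1, i3, i2]"
  have "\<exists>k. pbw_root C ?w' t k > 0" if "t < length ?w'" for t
  proof -
    note r = W2_roots[OF append_Nil2[symmetric]]
    consider "t = 0" | "t = 1" | "t = 2" | "t = 3" | "t = 4" using \<open>t < length ?w'\<close> by fastforce
    then show ?thesis
      by cases (use r cmb mb_pos in \<open>auto intro: exI[of _ i2] exI[of _ i1] exI[of _ i3] simp del:
          One_nat_def\<close>)
  qed
  \<comment> \<open>Both completed words index the intersection, so a common element would lie in
    two cones that \<open>cones_disjoint\<close> separates.\<close>
  then obtain v' where v': "?w' @ v' \<in> reduced_decompositions C (longest_element C)"
    using extend_to_longest by blast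
  show ?thesis using v v' cones_disjoint by fastforce
qed

end

section \<open>Root systems of simple Lie algebras\<close>

context complex_lie_algebra
begin

lemma bracket_0 [simp]: "bracket x 0 = 0" "bracket 0 x = 0"
  using bracket_add_right[of x 0 0] bracket_add_left[of 0 0 x] by simp_all

lemma bracket_minus_right: "bracket x (- y) = - bracket x y"
  using bracket_add_right[of x y "- y"] by (simp add: eq_neg_iff_add_eq_0 add.commute)

lemma bracket_minus_left: "bracket (- x) y = - bracket x y"
  using bracket_add_left[of x "- x" y] by (simp add: eq_neg_iff_add_eq_0 add.commute)

lemma bracket_diff_right: "bracket x (y - z) = bracket x y - bracket x z"
  using bracket_add_right[of x y "- z"] by (simp add: bracket_minus_right)

lemma bracket_diff_left: "bracket (x - y) z = bracket x z - bracket y z"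
  using bracket_add_left[of x "- y" z] by (simp add: bracket_minus_left)

lemma bracket_sum_right: "bracket x (sum f A) = (\<Sum>a\<in>A. bracket x (f a))"
  by (induction A rule: infinite_finite_induct) (simp_all add: bracket_add_right)

lemma bracket_anticommute: "bracket x y = - bracket y x"
proof -
  have "bracket x y + bracket y x = bracket (x + y) (x + y)"
    by (simp add: bracket_add_left bracket_add_right bracket_self[of x] bracket_self[of y])
  then have "bracket x y + bracket y x = 0" by (simp add: bracket_self)
  then show ?thesis by (simp add: eq_neg_iff_add_eq_0)
qed

lemma bracket_derivation: "bracket h (bracket x y) = bracket (bracket h x) y + bracket x (bracket h y)"
proof -
  have "bracket h (bracket x y) = - bracket x (bracket y h) - bracket y (bracket h x)"
    using jacobi[of h x y] by (simp add: algebra_simps eq_neg_iff_add_eq_0)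
  also have "bracket y h = - bracket h y" by (rule bracket_anticommute)
  also have "bracket y (bracket h x) = - bracket (bracket h x) y" by (rule bracket_anticommute)
  finally show ?thesis by (simp add: bracket_minus_right)
qed

lemma subspace_root_space: "subspace (root_space H \<mu>)"
  unfolding subspace_def root_space_def by (simp add: bracket_add_right bracket_scale_right scale_right_distrib
      mult.commute)

lemma root_space_bracket:
  assumes "x \<in> root_space H \<mu>" "y \<in> root_space H \<nu>"
  shows "bracket x y \<in> root_space H (\<lambda>h. \<mu> h + \<nu> h)"
  using assms unfolding root_space_def
  by (simp add: bracket_derivation bracket_scale_left bracket_scale_right scale_left_distrib)

lemma root_space_cong: "(\<And>h. h \<in> H \<Longrightarrow> \<mu> h = \<nu> h) \<Longrightarrow> root_space H
    \<mu> = root_space H \<nu>"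
  by (auto simp: root_space_def)

lemma is_root_cong: "(\<And>h. h \<in> H \<Longrightarrow> \<mu> h = \<nu> h) \<Longrightarrow> is_root H \<mu>
    = is_root H \<nu>"
  unfolding is_root_def using root_space_cong[of H \<mu> \<nu>] by auto

text \<open>Applying ad h - mu_c(h), with h separating a from c, removes the summand of c and
  multiplies that of a by a nonzero number.\<close>

lemma root_vectors_sum_zero:
  assumes "finite A"
    and "\<And>a. a \<in> A \<Longrightarrow> x a \<in> root_space H (\<mu> a)"
    and "\<And>a c. a \<in> A \<Longrightarrow> c \<in> A \<Longrightarrow> a \<noteq> c \<Longrightarrow>
        \<exists>h\<in>H. \<mu> a h \<noteq> \<mu> c h"
    and "(\<Sum>a\<in>A. x a) = 0" and "a \<in> A"
  shows "x a = 0"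
  using assms
proof (induction A arbitrary: x a rule: finite_induct)
  case (insert c A)
  have zero: "x a = 0" if aA: "a \<in> A" for a
  proof -
    have "a \<noteq> c" using aA insert.hyps by blast
    then obtain h where h: "h \<in> H" "\<mu> a h \<noteq> \<mu> c h" using insert.prems(2)[of a c] aA by blast
    define y where "y a = scale (\<mu> a h - \<mu> c h) (x a)" for a
    have hx: "bracket h (x a) = scale (\<mu> a h) (x a)" if "a \<in> insert c A" for a
      using insert.prems(1)[OF that] h by (simp add: root_space_def)
    have "y a = 0"
    proof (rule insert.IH[OF _ _ _ aA])
      show "y a \<in> root_space H (\<mu> a)" if "a \<in> A" for a
        unfolding y_def using insert.prems(1)[of a] that by (simp add: subspace_scale[OF subspace_root_space])
      show "\<exists>h\<in>H. \<mu> a h \<noteq> \<mu> c h" if "a \<in> A" "c \<in> A" "a \<noteq> c" for a c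
        using insert.prems(2)[of a c] that by simp
      have "(\<Sum>a\<in>insert c A. y a) = bracket h (\<Sum>a\<in>insert c A. x a) - scale (\<mu> c h)
          (\<Sum>a\<in>insert c A. x a)"
        unfolding bracket_sum_right scale_sum_right y_def scale_left_diff_distrib sum_subtractf
        by (intro arg_cong2[of _ _ _ _ "(-)"] sum.cong) (simp_all add: hx)
      then have "(\<Sum>a\<in>insert c A. y a) = 0" using insert.prems(3) by simp
      then show "(\<Sum>a\<in>A. y a) = 0" using insert.hyps by (simp add: y_def)
    qed
    then show ?thesis using h by (simp add: y_def)
  qed
  then have "x c = 0" using insert.prems(3) insert.hyps by simp
  with zero insert.prems(4) show ?case by auto
qed simp

end

context simple_lie_algebra
begin

lemma finitely_many_root_vectors:
  assumes x: "\<And>a. a \<in> A \<Longrightarrow> x a \<in> root_space H (\<mu> a)" and nz: "\<And>a. a \<in>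
      A \<Longrightarrow> x a \<noteq> 0"
    and sep: "\<And>a c. a \<in> A \<Longrightarrow> c \<in> A \<Longrightarrow> a \<noteq> c \<Longrightarrow>
        \<exists>h\<in>H. \<mu> a h \<noteq> \<mu> c h"
  shows "finite A"
proof (rule ccontr)
  assume "infinite A"
  obtain D where D: "finite D" "span D = UNIV" using finite_dimensional by blast
  obtain S where S: "S \<subseteq> A" "finite S" "card S = Suc (card D)"
    using infinite_arbitrarily_large[OF \<open>infinite A\<close>] by blast
  have inj: "inj_on x S"
  proof (rule inj_onI, rule ccontr)
    fix a c assume ac: "a \<in> S" "c \<in> S" "x a = x c" "a \<noteq> c"
    then obtain h where h: "h \<in> H" "\<mu> a h \<noteq> \<mu> c h" using sep[of a c] S by blast
    have A: "a \<in> A" "c \<in> A" using ac S by auto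
    have "bracket h (x a) = scale (\<mu> a h) (x a)" "bracket h (x c) = scale (\<mu> c h) (x c)"
      using x[OF A(1)] x[OF A(2)] h by (auto simp: root_space_def)
    then have "scale (\<mu> a h) (x a) = scale (\<mu> c h) (x a)" unfolding ac(3)[symmetric] by (rule trans[OF sym])
    then show False using nz[OF A(1)] h by simp
  qed
  have "independent (x ` S)"
    unfolding dependent_finite[OF finite_imageI[OF S(2)]]
  proof clarify
    fix u a assume sum: "(\<Sum>v\<in>x ` S. scale (u v) v) = 0" and a: "a \<in> S" "u (x a) \<noteq> 0"
    have "scale (u (x a)) (x a) = 0"
    proof (rule root_vectors_sum_zero[OF S(2) _ _ _ a(1)])
      show "scale (u (x a)) (x a) \<in> root_space H (\<mu> a)" if "a \<in> S" for a
        using x[of a] that S by (auto intro: subspace_scale[OF subspace_root_space])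
      show "\<exists>h\<in>H. \<mu> a h \<noteq> \<mu> c h" if "a \<in> S" "c \<in> S" "a \<noteq> c" for a c
          using sep[of a c] that S by blast
      show "(\<Sum>a\<in>S. scale (u (x a)) (x a)) = 0" using sum by (simp add: sum.reindex[OF inj])
    qed
    then show False using nz[of a] a S by auto
  qed
  then have "card (x ` S) \<le> card D" using independent_span_bound[OF D(1)] D(2) by blast
  then show False using S card_image[OF inj] by simp
qed

text \<open>The single element \<open>h\<close> takes the place of the Cartan subalgebra; the
  eigenvalues along the string are distinct, so finite dimension bounds their number.\<close>

lemma no_infinite_string:
  assumes "\<And>p :: nat. bracket h (v p) = scale (c + of_int k * of_nat p) (v p)" "k \<noteq> 0"
  shows "\<exists>p. v p = 0"
proof (rule ccontr)
  assume nz: "\<nexists>p. v p = 0"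
  have "finite (UNIV :: nat set)"
    by (rule finitely_many_root_vectors[of UNIV v "{h}" "\<lambda>p _. c + of_int k * of_nat p"])
      (use assms nz in \<open>auto simp: root_space_def\<close>)
  then show False by simp
qed

lemma last_nonzero:
  assumes "\<And>p :: nat. bracket h (v p) = scale (c + of_int k * of_nat p) (v p)" "k \<noteq> 0" "v 0 \<noteq> 0"
  obtains p where "v (Suc p) = 0" "\<And>j. j \<le> p \<Longrightarrow> v j \<noteq> 0"
proof -
  let ?P = "LEAST p. v p = 0"
  have z: "v ?P = 0" by (rule LeastI_ex[OF no_infinite_string[OF assms(1,2)]])
  then obtain p where p: "?P = Suc p" using assms(3) by (cases ?P) auto
  show thesis
  proof (rule that)
    show "v (Suc p) = 0" using z p by simp
    show "v j \<noteq> 0" if "j \<le> p" for j using not_less_Least[of j "\<lambda>p. v p = 0"] p that by auto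
  qed
qed

context
  fixes e f h
  assumes ef: "bracket e f = h" and he: "bracket h e = scale 2 e" and hf: "bracket h f = scale (- 2) f"
begin

lemma ad_string:
  assumes "bracket h g = scale (of_int k) g" "bracket h x = scale c x"
  shows "bracket h ((bracket g ^^ p) x) = scale (c + of_int k * of_nat p) ((bracket g ^^ p) x)"
proof (induction p)
  case (Suc p)
  let ?y = "(bracket g ^^ p) x"
  have "bracket h (bracket g ?y) = scale (of_int k) (bracket g ?y) + scale (c + of_int k * of_nat p) (bracket g ?y)"
    unfolding bracket_derivation[of h g] assms(1) Suc.IH by (simp only: bracket_scale_left bracket_scale_right)
  also have "\<dots> = scale (c + of_int k * of_nat (Suc p)) (bracket g ?y)"
    unfolding scale_left_distrib[symmetric] by (rule arg_cong2[of _ _ _ _ scale]) (simp_all add: algebra_simps)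
  finally show ?case by simp
qed (simp add: assms)

lemma e_string: "bracket h x = scale c x \<Longrightarrow> bracket h ((bracket e ^^ p) x) = scale (c + of_int 2
    * of_nat p) ((bracket e ^^ p) x)"
  by (rule ad_string) (simp_all add: he)

lemma f_string: "bracket h x = scale c x \<Longrightarrow> bracket h ((bracket f ^^ p) x) = scale (c + of_int
    (- 2) * of_nat p) ((bracket f ^^ p) x)"
  by (rule ad_string) (simp_all add: hf)

lemma highest_weight_string:
  assumes v: "bracket h v = scale n v" "bracket e v = 0"
  shows "bracket e ((bracket f ^^ Suc k) v) = scale (of_nat (Suc k) * (n - of_nat k)) ((bracket f ^^ k) v)"
proof (induction k)
  case 0
  show ?case by (simp add: bracket_derivation[of e f] ef v)
next
  case (Suc k)
  have "bracket e ((bracket f ^^ Suc (Suc k)) v) = bracket h ((bracket f ^^ Suc k) v) + bracket f (bracket e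
      ((bracket f ^^ Suc k) v))"
    by (simp add: bracket_derivation[of e f] ef)
  also have "\<dots> = scale (n + of_int (- 2) * of_nat (Suc k)) ((bracket f ^^ Suc k) v) + scale (of_nat (Suc
      k) * (n - of_nat k)) ((bracket f ^^ Suc k) v)"
    unfolding f_string[OF v(1)] Suc.IH by (simp add: bracket_scale_right)
  also have "\<dots> = scale (of_nat (Suc (Suc k)) * (n - of_nat (Suc k))) ((bracket f ^^ Suc k) v)"
    unfolding scale_left_distrib[symmetric] by (rule arg_cong2[of _ _ _ _ scale]) (simp_all add: algebra_simps)
  finally show ?case .
qed

text \<open>Raising x by p steps reaches a highest weight vector of weight m + 2p. Its lowering
  string has exactly m + 2p steps, so p + m of them do not reach 0, and they end in weight
  -m.\<close>

lemma sl2_reflect: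
  assumes x: "bracket h x = scale (of_nat m) x" "x \<noteq> 0"
  shows "\<exists>p. (bracket f ^^ (p + m)) ((bracket e ^^ p) x) \<noteq> 0"
proof -
  obtain p where p: "(bracket e ^^ Suc p) x = 0" "\<And>j. j \<le> p \<Longrightarrow> (bracket e ^^ j) x \<noteq> 0"
    using last_nonzero[of h "\<lambda>p. (bracket e ^^ p) x", OF e_string[OF x(1)]] x(2) by auto
  let ?v = "(bracket e ^^ p) x" and ?n = "of_nat m + of_int 2 * of_nat p :: complex"
  have v: "bracket h ?v = scale ?n ?v" "bracket e ?v = 0" "?v \<noteq> 0"
    using e_string[OF x(1)] p by simp_all
  obtain k where k: "(bracket f ^^ Suc k) ?v = 0" "\<And>j. j \<le> k \<Longrightarrow> (bracket f ^^ j) ?v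
      \<noteq> 0"
    using last_nonzero[of h "\<lambda>p. (bracket f ^^ p) ?v", OF f_string[OF v(1)]] v(3) by auto
  have "scale (of_nat (Suc k) * (?n - of_nat k)) ((bracket f ^^ k) ?v) = 0"
    using highest_weight_string[OF v(1,2), of k] k(1) by simp
  then have "?n = of_nat k" using k(2)[of k] by (simp del: of_nat_Suc)
  then have "of_nat (m + 2 * p) = (of_nat k :: complex)" by simp
  then have "k = m + 2 * p" by (simp only: of_nat_eq_iff)
  then show ?thesis using k(2)[of "p + m"] by auto
qed

text \<open>For x nonzero, f e^{p+1} x = -(p+1)(p+2) e^p x would keep the raising string from ever
  ending.\<close>

lemma sl2_weight_two:
  assumes x: "bracket h x = scale 2 x" "bracket e (bracket f x) = 0"
  shows "x = 0"
proof (rule ccontr)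
  assume nz: "x \<noteq> 0"
  have fe: "bracket f (bracket e y) = bracket e (bracket f y) - bracket h y" for y
    using bracket_derivation[of e f y] by (simp add: ef)
  have *: "bracket f ((bracket e ^^ Suc p) x) = scale (- of_nat (Suc p * Suc (Suc p))) ((bracket e ^^ p) x)" for p
  proof (induction p)
    case 0
    show ?case by (simp add: fe x)
  next
    case (Suc p)
    have "bracket f ((bracket e ^^ Suc (Suc p)) x) = bracket e (bracket f ((bracket e ^^ Suc p) x)) - bracket h
        ((bracket e ^^ Suc p) x)"
      by (simp add: fe)
    also have "\<dots> = scale (- of_nat (Suc p * Suc (Suc p))) ((bracket e ^^ Suc p) x) - scale (2 + of_int 2
        * of_nat (Suc p)) ((bracket e ^^ Suc p) x)"
      unfolding Suc.IH e_string[OF x(1)] by (simp add: bracket_scale_right)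
    also have "\<dots> = scale (- of_nat (Suc (Suc p) * Suc (Suc (Suc p)))) ((bracket e ^^ Suc p) x)"
      unfolding scale_left_diff_distrib[symmetric] by (rule arg_cong2[of _ _ _ _ scale]) (simp_all add: algebra_simps)
    finally show ?case .
  qed
  have "(bracket e ^^ p) x \<noteq> 0" for p
  proof (induction p)
    case (Suc p)
    show ?case
    proof
      assume "(bracket e ^^ Suc p) x = 0"
      then have "scale (- of_nat (Suc p * Suc (Suc p))) ((bracket e ^^ p) x) = 0" using *[of p] by simp
      then show False using Suc.IH by (simp del: of_nat_Suc of_nat_mult)
    qed
  qed (simp add: nz)
  then show False using no_infinite_string[of h "\<lambda>p. (bracket e ^^ p) x", OF e_string[OF x(1)]] by auto
qed

end

end

locale cartan_datum = simple_lie_algebra scale bracket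
  for scale :: "complex \<Rightarrow> 'g::ab_group_add \<Rightarrow> 'g" and bracket :: "'g \<Rightarrow> 'g
      \<Rightarrow> 'g" +
  fixes H :: "'g set"
  assumes cartan: "cartan_subalgebra H"
begin

lemma H_subspace: "subspace H"
  and H_abelian: "x \<in> H \<Longrightarrow> y \<in> H \<Longrightarrow> bracket x y = 0"
  and H_maximal: "(\<And>h. h \<in> H \<Longrightarrow> bracket h x = 0) \<Longrightarrow> x \<in> H"
  and H_diagonalizable: "h \<in> H \<Longrightarrow> span {x. \<exists>c. bracket h x = scale c x} = UNIV"
  using cartan unfolding cartan_subalgebra_def ad_diagonalizable_def by blast+

lemma root_spaceD: "x \<in> root_space H \<mu> \<Longrightarrow> h \<in> H \<Longrightarrow> bracket h x =
    scale (\<mu> h) x"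
  by (simp add: root_space_def)

lemma opposite_bracket_in_H:
  assumes "x \<in> root_space H \<mu>" "y \<in> root_space H (\<lambda>h. - \<mu> h)"
  shows "bracket x y \<in> H"
  using root_space_bracket[OF assms] by (intro H_maximal) (simp add: root_space_def)

lemma sl2_root_space_line:
  assumes e: "e \<in> root_space H \<mu>" "e \<noteq> 0" and f: "f \<in> root_space H (\<lambda>h. - \<mu> h)"
    and two: "\<mu> (bracket e f) = 2" and x: "x \<in> root_space H \<mu>"
  shows "\<exists>c. x = scale c e"
proof -
  let ?h = "bracket e f"
  have h: "?h \<in> H" using opposite_bracket_in_H[OF e(1) f] .
  have he: "bracket ?h e = scale 2 e" and hf: "bracket ?h f = scale (- 2) f"
    using root_spaceD[OF e(1) h] root_spaceD[OF f h] two by simp_all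
  let ?t = "bracket x f" 
  have t: "?t \<in> H" using opposite_bracket_in_H[OF x f] .
  \<comment> \<open>Chosen so that ad e ad f annihilates x - c e; then \<open>sl2_weight_two\<close>
    applies to this difference.\<close>
  define c where "c = \<mu> ?t / 2"
  let ?x = "x - scale c e"
  have x': "?x \<in> root_space H \<mu>"
    using subspace_diff[OF subspace_root_space x subspace_scale[OF subspace_root_space e(1)]] .
  have "?x = 0"
  proof (rule sl2_weight_two[OF refl he hf])
    show "bracket ?h ?x = scale 2 ?x" using root_spaceD[OF x' h] two by simp
    have "bracket e (bracket f ?x) = bracket (bracket ?x f) e"
      by (metis bracket_anticommute bracket_minus_right)
    also have "\<dots> = bracket ?t e - scale c (bracket ?h e)"
      by (simp add: bracket_diff_left bracket_scale_left)
    also have "\<dots> = 0" using root_spaceD[OF e(1) t] he by (simp add: c_def)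
    finally show "bracket e (bracket f ?x) = 0" .
  qed
  then show ?thesis by auto
qed

text \<open>The coroot is only given in the span of brackets. A single bracket is normalized, and as
  both root spaces are lines, the span is a line on which the value 2 singles out the
  coroot.\<close>

lemma coroot_triple:
  assumes root: "is_root H \<mu>" and cr: "is_coroot H \<mu> h"
  obtains e f where "e \<in> root_space H \<mu>" "e \<noteq> 0" "f \<in> root_space H (\<lambda>h. - \<mu> h)"
      "f \<noteq> 0" "bracket e f = h" "\<mu> h = 2" "h \<in> H"
proof -
  let ?S = "{bracket x y |x y. x \<in> root_space H \<mu> \<and> y \<in> root_space H (\<lambda>h. - \<mu> h)}"
  have hS: "h \<in> span ?S" and two: "\<mu> h = 2" using cr by (simp_all add: is_coroot_def)
  have SH: "?S \<subseteq> H" using opposite_bracket_in_H by blast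
  have hH: "h \<in> H" using span_minimal[OF SH H_subspace] hS by blast
  obtain u where u: "u \<in> root_space H \<mu>" "u \<noteq> 0" using root by (auto simp: is_root_def)
  \<comment> \<open>Otherwise every bracket, and with them the coroot, would annihilate the root
    vector u.\<close>
  have "\<exists>x\<in>root_space H \<mu>. \<exists>y\<in>root_space H (\<lambda>h. - \<mu> h). \<mu> (bracket
      x y) \<noteq> 0"
  proof (rule ccontr)
    assume no: "\<not> ?thesis"
    have "?S \<subseteq> {t. bracket t u = 0}"
      using no root_spaceD[OF u(1)] SH by fastforce
    moreover have "subspace {t. bracket t u = 0}"
      by (simp add: subspace_def bracket_add_left bracket_scale_left)
    ultimately have "bracket h u = 0" using span_minimal hS by blast
    then show False using root_spaceD[OF u(1) hH] u(2) two by simp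
  qed
  then obtain e f0 where e: "e \<in> root_space H \<mu>" and f0: "f0 \<in> root_space H (\<lambda>h. - \<mu>
      h)" and nz: "\<mu> (bracket e f0) \<noteq> 0" by blast
  let ?t = "bracket e f0"
  have tH: "?t \<in> H" using opposite_bracket_in_H[OF e f0] .
  define f where "f = scale (2 / \<mu> ?t) f0"
  have f: "f \<in> root_space H (\<lambda>h. - \<mu> h)" unfolding f_def by (rule subspace_scale[OF
      subspace_root_space f0])
  let ?h = "bracket e f"
  have h'H: "?h \<in> H" using opposite_bracket_in_H[OF e f] .
  have ht: "?h = scale (2 / \<mu> ?t) ?t" by (simp add: f_def bracket_scale_right)
  \<comment> \<open>Linearity of \<mu> is not among the assumptions; its values are compared through
    the action on u.\<close>
  have "scale (\<mu> ?h) u = scale 2 u"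
    using root_spaceD[OF u(1) h'H] root_spaceD[OF u(1) tH] nz by (simp add: ht bracket_scale_left)
  then have two': "\<mu> ?h = 2" using u(2) by simp
  have "e \<noteq> 0" 
  proof
    assume "e = 0"
    then have "bracket ?h u = 0" by simp
    then show False using root_spaceD[OF u(1) h'H] u(2) two' by simp
  qed
  have "f \<noteq> 0"
  proof
    assume "f = 0"
    then have "bracket ?h u = 0" by simp
    then show False using root_spaceD[OF u(1) h'H] u(2) two' by simp
  qed
  let ?g = "- ?h"
  have "bracket f e = ?g" by (rule bracket_anticommute)
  moreover have "scale (\<mu> ?g) u = scale (- 2) u"
    using root_spaceD[OF u(1) subspace_neg[OF H_subspace h'H]] root_spaceD[OF u(1) h'H] two' by (simp add:
        bracket_minus_left)
  then have "\<mu> ?g = - 2" using u(2) by (simp add: scale_cancel_right del: scale_minus_left)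
  ultimately have two'': "- \<mu> (bracket f e) = 2" by simp
  have e': "e \<in> root_space H (\<lambda>h. - (- \<mu> h))" using e by simp
  have "?S \<subseteq> {t. \<exists>r. t = scale r ?h}"
  proof clarify
    fix x y assume x: "x \<in> root_space H \<mu>" and y: "y \<in> root_space H (\<lambda>h. - \<mu> h)"
    obtain c where c: "x = scale c e" using sl2_root_space_line[OF e \<open>e \<noteq> 0\<close> f two' x] by blast
    obtain c' where c': "y = scale c' f" using sl2_root_space_line[OF f \<open>f \<noteq> 0\<close> e' two'' y]
        by blast
    have "bracket x y = scale (c * c') ?h" unfolding c c' by (simp add: bracket_scale_left bracket_scale_right)
    then show "\<exists>r. bracket x y = scale r ?h" by blast
  qed
  moreover have "subspace {t. \<exists>r. t = scale r ?h}"
    unfolding subspace_def by (auto simp: scale_left_distrib[symmetric] intro: exI[of _ 0])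
  ultimately obtain r where r: "h = scale r ?h" using span_minimal hS by blast
  have "scale 2 u = scale r (scale 2 u)"
    using root_spaceD[OF u(1) hH] root_spaceD[OF u(1) h'H] two two' r by (metis bracket_scale_left)
  then have "r = 1" using u(2) by (simp)
  with r have "bracket e f = h" by simp
  then show thesis using that e \<open>e \<noteq> 0\<close> f \<open>f \<noteq> 0\<close> two hH by blast
qed

lemma ad_power_root_space:
  assumes "e \<in> root_space H \<mu>" "x \<in> root_space H \<nu>"
  shows "(bracket e ^^ p) x \<in> root_space H (\<lambda>h. \<nu> h + of_nat p * \<mu> h)"
proof (induction p)
  case (Suc p)
  have "bracket e ((bracket e ^^ p) x) \<in> root_space H (\<lambda>h. \<mu> h + (\<nu> h + of_nat p * \<mu> h))"
    by (rule root_space_bracket[OF assms(1) Suc.IH])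
  also have "(\<lambda>h. \<mu> h + (\<nu> h + of_nat p * \<mu> h)) = (\<lambda>h. \<nu> h + of_nat (Suc p) *
      \<mu> h)"
    by (auto simp: algebra_simps)
  finally show ?case by simp
qed (simp add: assms(2))

text \<open>Moving through the sl2-string of a root vector for \<nu> reaches the mirrored weight at
  a nonzero vector. For negative m the triple (f, e, -h) replaces (e, f, h).\<close>

lemma root_reflection:
  assumes mu: "is_root H \<mu>" "is_coroot H \<mu> h" and nu: "is_root H \<nu>" "\<nu> h = of_int m"
  shows "is_root H (\<lambda>h. \<nu> h - of_int m * \<mu> h)"
proof -
  obtain e f where ef: "e \<in> root_space H \<mu>" "f \<in> root_space H (\<lambda>h. - \<mu> h)" "bracket e f
      = h" "\<mu> h = 2" "h \<in> H"
    using coroot_triple[OF mu] by metis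
  obtain x where x: "x \<in> root_space H \<nu>" "x \<noteq> 0" using nu by (auto simp: is_root_def)
  have he: "bracket h e = scale 2 e" and hf: "bracket h f = scale (- 2) f" and hx: "bracket h x = scale (of_int m) x"
    using root_spaceD[OF ef(1,5)] root_spaceD[OF ef(2,5)] root_spaceD[OF x(1) ef(5)] ef(4) nu(2) by simp_all
  have "\<exists>y\<in>root_space H (\<lambda>h. \<nu> h - of_int m * \<mu> h). y \<noteq> 0"
  proof (cases "m \<ge> 0")
    case True
    then have "bracket h x = scale (of_nat (nat m)) x" using hx by simp
    from sl2_reflect[OF ef(3) he hf this x(2)] obtain p where p: "(bracket f ^^ (p + nat m)) ((bracket e ^^ p)
        x) \<noteq> 0" ..
    have "(bracket f ^^ (p + nat m)) ((bracket e ^^ p) x) \<in> root_space H (\<lambda>h. \<nu> h + of_nat p *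
        \<mu> h + of_nat (p + nat m) * - \<mu> h)"
      by (rule ad_power_root_space[OF ef(2) ad_power_root_space[OF ef(1) x(1)]])
    also have "(\<lambda>h. \<nu> h + of_nat p * \<mu> h + of_nat (p + nat m) * - \<mu> h) = (\<lambda>h. \<nu>
        h - of_int m * \<mu> h)"
      using True by (auto simp: algebra_simps)
    finally show ?thesis using p by blast
  next
    case False
    then have hx': "bracket (- h) x = scale (of_nat (nat (- m))) x" using hx by (simp add: bracket_minus_left)
    have "bracket f e = - h" "bracket (- h) f = scale 2 f" "bracket (- h) e = scale (- 2) e"
      using ef(3) he hf bracket_anticommute[of f e] by (simp_all add: bracket_minus_left)
    from sl2_reflect[OF this hx' x(2)] obtain p where p: "(bracket e ^^ (p + nat (- m))) ((bracket f ^^ p) x)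
        \<noteq> 0" ..
    have "(bracket e ^^ (p + nat (- m))) ((bracket f ^^ p) x) \<in> root_space H (\<lambda>h. \<nu> h + of_nat
        p * - \<mu> h + of_nat (p + nat (- m)) * \<mu> h)"
      by (rule ad_power_root_space[OF ef(1) ad_power_root_space[OF ef(2) x(1)]])
    also have "(\<lambda>h. \<nu> h + of_nat p * - \<mu> h + of_nat (p + nat (- m)) * \<mu> h) = (\<lambda>h.
        \<nu> h - of_int m * \<mu> h)"
      using False by (auto simp: algebra_simps)
    finally show ?thesis using p by blast
  qed
  moreover have "\<exists>h\<in>H. \<nu> h - of_int m * \<mu> h \<noteq> 0"
  proof (cases "m = 0")
    case True
    then show ?thesis using nu(1) by (simp add: is_root_def)
  next
    case False
    then show ?thesis using ef(4,5) nu(2) by (intro bexI[of _ h]) auto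
  qed
  ultimately show ?thesis by (simp add: is_root_def)
qed

section \<open>Root space decomposition\<close>

lemma eigenvector_sum:
  assumes "x \<in> span {x. \<exists>c. bracket h x = scale c x}"
  shows "\<exists>A y. finite A \<and> (\<forall>c. bracket h (y c) = scale c (y c)) \<and> x = (\<Sum>c\<in>A. y c)"
  using assms
proof (induction rule: span_induct_alt)
  case base
  show ?case by (intro exI[of _ "{}"] exI[of _ "\<lambda>_. 0"]) simp
next
  case (step k x z)
  then obtain c where c: "bracket h x = scale c x" by blast
  from step obtain A y where A: "finite A" "\<forall>c. bracket h (y c) = scale c (y c)" "z = (\<Sum>c\<in>A. y
      c)" by blast
  \<comment> \<open>Outside A the function y may take nonzero values, so it is cut off before the
    new eigenvalue c is adjoined.\<close>
  let ?y = "\<lambda>d. (if d \<in> A then y d else 0) + (if d = c then scale k x else 0)"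
  have "scale k x + z = (\<Sum>d\<in>insert c A. ?y d)"
    using A(1,3) by (simp add: sum.distrib sum.insert_if sum.inter_restrict[symmetric] add.commute Int_absorb1
        subset_insertI)
  moreover have "\<forall>d. bracket h (?y d) = scale d (?y d)"
    using A(2) c by (auto simp: bracket_add_right bracket_scale_right scale_right_distrib mult.commute)
  ultimately show ?case using A(1) by (intro exI[of _ "insert c A"] exI[of _ ?y]) auto
qed

text \<open>A common eigenvector of \<open>B\<close> splits into eigenvectors of the new element h;
  since k in \<open>B\<close> commutes with h, each component stays an eigenvector of k.\<close>

lemma simultaneously_diagonalizable:
  assumes "finite B" "B \<subseteq> H"
  shows "span {x. \<forall>h\<in>B. \<exists>c. bracket h x = scale c x} = UNIV"
  using assms
proof (induction B)
  case (insert h B)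
  have hH: "h \<in> H" "B \<subseteq> H" using insert.prems by auto
  let ?T = "{x. \<forall>h\<in>insert h B. \<exists>c. bracket h x = scale c x}"
  have "{x. \<forall>h\<in>B. \<exists>c. bracket h x = scale c x} \<subseteq> span ?T"
  proof clarify
    fix x assume x: "\<forall>h\<in>B. \<exists>c. bracket h x = scale c x"
    obtain A y where A: "finite A" "\<And>c. bracket h (y c) = scale c (y c)" "x = (\<Sum>c\<in>A. y c)"
      using eigenvector_sum[of x h] H_diagonalizable[OF hH(1)] by auto
    have "y c \<in> ?T" if "c \<in> A" for c
    proof -
      have "\<exists>d. bracket k (y c) = scale d (y c)" if k: "k \<in> B" for k
      proof -
        obtain d where d: "bracket k x = scale d x" using x k by blast
        have hk: "bracket h k = 0" using H_abelian hH k by blast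
        let ?z = "\<lambda>c. bracket k (y c) - scale d (y c)"
        have "?z c = 0"
        proof (rule root_vectors_sum_zero[OF A(1), of ?z "{h}" "\<lambda>c _. c"])
          show "?z a \<in> root_space {h} (\<lambda>_. a)" for a
            by (simp add: root_space_def bracket_diff_right bracket_derivation[of h k] hk A(2) bracket_scale_right
              scale_right_diff_distrib mult.commute)
          show "(\<Sum>c\<in>A. ?z c) = 0"
            using d unfolding A(3) by (simp add: sum_subtractf bracket_sum_right scale_sum_right)
        qed (use that \<open>c \<in> A\<close> in auto)
        then show ?thesis by auto
      qed
      then show ?thesis using A(2)[of c] by blast
    qed
    then show "x \<in> span ?T" unfolding A(3) by (intro span_sum span_base)
  qed
  then have "span {x. \<forall>h\<in>B. \<exists>c. bracket h x = scale c x} \<subseteq> span ?T"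
    by (rule span_minimal[OF _ subspace_span])
  then show ?case using insert.IH[OF hH(2)] by auto
qed simp

text \<open>A common eigenvector of a finite basis of \<open>H\<close> has a weight on all of
  \<open>H\<close>. If the weight vanishes there, the vector lies in \<open>H\<close> by maximality;
  otherwise it is a root vector.\<close>

lemma root_decomposition: "span (H \<union> {x. \<exists>\<mu>. is_root H \<mu> \<and> x \<in> root_space H
    \<mu>}) = UNIV"
proof -
  obtain D where D: "finite D" "span D = UNIV" using finite_dimensional by blast
  obtain B where B: "B \<subseteq> H" "independent B" "H \<subseteq> span B" "card B = dim H" by (rule basis_exists)
  have "finite B" using independent_span_bound[OF D(1) B(2)] D(2) by simp
  let ?T = "{x. \<forall>h\<in>B. \<exists>c. bracket h x = scale c x}"
  let ?U = "H \<union> {x. \<exists>\<mu>. is_root H \<mu> \<and> x \<in> root_space H \<mu>}"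
  have "?T \<subseteq> span ?U"
  proof
    fix x assume x: "x \<in> ?T"
    show "x \<in> span ?U"
    proof (cases "x = 0")
      case True
      then show ?thesis by (simp add: span_zero)
    next
      case False
      have "subspace {h. \<exists>c. bracket h x = scale c x}"
        unfolding subspace_def by (auto simp: bracket_add_left bracket_scale_left scale_left_distrib[symmetric]
            intro: exI[of _ 0])
      then have "span B \<subseteq> {h. \<exists>c. bracket h x = scale c x}" using x by (intro span_minimal) auto
      then have "\<forall>h\<in>H. \<exists>c. bracket h x = scale c x" using B(3) by blast
      then obtain \<mu> where \<mu>: "\<And>h. h \<in> H \<Longrightarrow> bracket h x = scale (\<mu> h) x" by metis
      then have xr: "x \<in> root_space H \<mu>" by (simp add: root_space_def)
      show ?thesis
      proof (cases "\<exists>h\<in>H. \<mu> h \<noteq> 0")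
        case True
        then have "is_root H \<mu>" using xr False by (auto simp: is_root_def)
        then show ?thesis using xr by (intro span_base) blast
      next
        case F: False
        then have "x \<in> H" using \<mu> by (intro H_maximal) simp
        then show ?thesis by (intro span_base) blast
      qed
    qed
  qed
  then have "span ?T \<subseteq> span ?U" by (rule span_minimal[OF _ subspace_span])
  then show ?thesis using simultaneously_diagonalizable[OF \<open>finite B\<close> B(1)] by auto
qed

section \<open>Coordinates of roots and indecomposability\<close>

definition lin_comb :: "('i::finite \<Rightarrow> 'g \<Rightarrow> complex) \<Rightarrow> ('i \<Rightarrow>
    int) \<Rightarrow> 'g \<Rightarrow> complex" where
  "lin_comb \<alpha> \<beta> h = (\<Sum>i\<in>UNIV. of_int (\<beta> i) * \<alpha> i h)"

definition roots :: "('i::finite \<Rightarrow> 'g \<Rightarrow> complex) \<Rightarrow> ('i \<Rightarrow> int)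
    set" where
  "roots \<alpha> = {\<beta>. is_root H (lin_comb \<alpha> \<beta>)}"

context
  fixes \<alpha> :: "'i::finite \<Rightarrow> 'g \<Rightarrow> complex" and C :: "'i \<Rightarrow> 'i
      \<Rightarrow> int"
  assumes simple: "simple_roots H \<alpha>" and cm: "cartan_matrix H \<alpha> C"
begin

lemma lin_comb_add: "lin_comb \<alpha> (\<lambda>i. \<beta> i + \<gamma> i) h = lin_comb \<alpha> \<beta> h +
    lin_comb \<alpha> \<gamma> h"
  by (simp add: lin_comb_def distrib_right sum.distrib)

lemma lin_comb_simple_root: "lin_comb \<alpha> (simple_root i) = \<alpha> i"
  by (auto simp: lin_comb_def simple_root_def of_int_of_bool if_distrib if_distribR cong: if_cong)

lemma lin_comb_eqD:
  assumes "\<And>h. h \<in> H \<Longrightarrow> lin_comb \<alpha> \<beta> h = lin_comb \<alpha> \<gamma> h"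
  shows "\<beta> = \<gamma>"
proof
  fix i
  have "\<forall>h\<in>H. (\<Sum>i\<in>UNIV. (of_int (\<beta> i) - of_int (\<gamma> i)) * \<alpha> i h) = 0"
    using assms by (simp add: lin_comb_def left_diff_distrib sum_subtractf)
  then have "of_int (\<beta> i) - of_int (\<gamma> i) = (0 :: complex)"
    using simple unfolding simple_roots_def by (elim conjE allE[of _ "\<lambda>i. of_int (\<beta> i) - of_int
        (\<gamma> i)"]) blast
  then show "\<beta> i = \<gamma> i" by simp
qed

lemma root_coordinates:
  assumes "is_root H \<mu>"
  obtains \<beta> where "\<beta> \<in> roots \<alpha>" "\<forall>h\<in>H. \<mu> h = lin_comb \<alpha> \<beta>
      h" "(\<forall>i. 0 \<le> \<beta> i) \<or> (\<forall>i. \<beta> i \<le> 0)"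
proof -
  obtain \<beta> :: "'i \<Rightarrow> int" where \<beta>: "(\<forall>i. 0 \<le> \<beta> i) \<or> (\<forall>i.
      \<beta> i \<le> 0)" "\<forall>h\<in>H. \<mu> h = (\<Sum>i\<in>UNIV. of_int (\<beta> i) * \<alpha> i h)"
    using simple assms unfolding simple_roots_def by blast
  then have "\<forall>h\<in>H. \<mu> h = lin_comb \<alpha> \<beta> h" by (simp add: lin_comb_def)
  moreover from this have "\<beta> \<in> roots \<alpha>" unfolding roots_def using assms is_root_cong[of H
      \<mu> "lin_comb \<alpha> \<beta>"] by simp
  ultimately show thesis using \<beta>(1) that by blast
qed

lemma simple_is_root: "is_root H (\<alpha> i)"
  using simple by (simp add: simple_roots_def)

lemma coroot:
  obtains h where "is_coroot H (\<alpha> i) h" "\<And>j. \<alpha> j h = of_int (C i j)"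
  using cm unfolding cartan_matrix_def by blast

lemma root_set_roots: "root_set C (roots \<alpha>)"
proof
  show "finite (roots \<alpha>)"
  proof -
    have "\<forall>\<beta>\<in>roots \<alpha>. \<exists>x. x \<in> root_space H (lin_comb \<alpha> \<beta>)
        \<and> x \<noteq> 0"
      unfolding roots_def is_root_def by blast
    then obtain x where x: "\<And>\<beta>. \<beta> \<in> roots \<alpha> \<Longrightarrow> x \<beta> \<in>
        root_space H (lin_comb \<alpha> \<beta>)" "\<And>\<beta>. \<beta> \<in> roots \<alpha>
        \<Longrightarrow> x \<beta> \<noteq> 0"
      by metis
    show ?thesis by (rule finitely_many_root_vectors[OF x]) (use lin_comb_eqD in blast)+
  qed
  show "simple_root i \<in> roots \<alpha>" for i
    unfolding roots_def using simple_is_root by (simp add: lin_comb_simple_root)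
  show "simple_reflection C i \<beta> \<in> roots \<alpha>" if "\<beta> \<in> roots \<alpha>" for \<beta> i
  proof -
    obtain h where h: "is_coroot H (\<alpha> i) h" "\<And>j. \<alpha> j h = of_int (C i j)" using coroot by blast
    \<comment> \<open>The pairing of \<beta> with alpha_i is the value of the root \<beta> at the
      coroot of alpha_i.\<close>
    let ?m = "\<Sum>k\<in>UNIV. C i k * \<beta> k"
    have lc: "lin_comb \<alpha> \<beta> h = of_int ?m" by (simp add: lin_comb_def h(2) mult.commute)
    have "is_root H (lin_comb \<alpha> \<beta>)" using that by (simp add: roots_def)
    from root_reflection[OF simple_is_root h(1) this lc]
    have "is_root H (\<lambda>h. lin_comb \<alpha> \<beta> h - of_int ?m * \<alpha> i h)" .
    also have "(\<lambda>h. lin_comb \<alpha> \<beta> h - of_int ?m * \<alpha> i h) = lin_comb \<alpha>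
        (simple_reflection C i \<beta>)"
    proof
      fix h
      have "lin_comb \<alpha> (simple_reflection C i \<beta>) h = lin_comb \<alpha> \<beta> h - of_int ?m *
          lin_comb \<alpha> (simple_root i) h"
        unfolding lin_comb_def simple_reflection_def
        by (simp only: of_int_diff of_int_mult left_diff_distrib sum_subtractf sum_distrib_left mult.assoc)
      then show "lin_comb \<alpha> \<beta> h - of_int ?m * \<alpha> i h = lin_comb \<alpha> (simple_reflection
          C i \<beta>) h"
        by (simp only: lin_comb_simple_root)
    qed
    finally show ?thesis by (simp add: roots_def)
  qed
  show "(\<forall>i. 0 \<le> \<beta> i) \<or> (\<forall>i. \<beta> i \<le> 0)" if "\<beta> \<in> roots
      \<alpha>" for \<beta>
  proof -
    have "is_root H (lin_comb \<alpha> \<beta>)" using that by (simp add: roots_def)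
    then obtain \<gamma> where "\<forall>h\<in>H. lin_comb \<alpha> \<beta> h = lin_comb \<alpha> \<gamma> h"
        "(\<forall>i. 0 \<le> \<gamma> i) \<or> (\<forall>i. \<gamma> i \<le> 0)"
      using root_coordinates by blast
    then show ?thesis using lin_comb_eqD by blast
  qed
  show "(\<lambda>_. 0) \<notin> roots \<alpha>"
    by (auto simp: roots_def is_root_def lin_comb_def)
  show "C i i = 2" for i
  proof -
    obtain h where "is_coroot H (\<alpha> i) h" "\<alpha> i h = of_int (C i i)" using coroot by metis
    then have "of_int (C i i) = (of_int 2 :: complex)" by (simp add: is_coroot_def)
    then show ?thesis by (simp only: of_int_eq_iff)
  qed
qed

text \<open>For a decomposition of the Cartan matrix, the elements commuting with all root spaces of one
  part form an ideal.\<close>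

lemma indecomposable_cartan_matrix: "indecomposable C"
  unfolding indecomposable_def
proof (intro allI impI, rule ccontr)
  fix I :: "'i set"
  assume "I \<noteq> {}" "I \<noteq> UNIV" and "\<not> (\<exists>i\<in>I. \<exists>j. j \<notin> I \<and> C i j
      \<noteq> 0)"
  then obtain i j where ij: "i \<in> I" "j \<notin> I" and C: "\<And>i j. i \<in> I \<Longrightarrow> j
      \<notin> I \<Longrightarrow> C i j = 0" by blast
  interpret root_set C "roots \<alpha>" by (rule root_set_roots)
  let ?out = "\<lambda>\<beta>. \<exists>j. j \<notin> I \<and> \<beta> j \<noteq> 0"
  have out_zero: "\<beta> i = 0" if "\<beta> \<in> roots \<alpha>" "?out \<beta>" "i \<in> I" for \<beta> i
    using root_support[OF C that(1)] that by blast
  define Z where "Z = {x. \<forall>\<gamma>\<in>roots \<alpha>. ?out \<gamma> \<longrightarrow>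
      (\<forall>y\<in>root_space H (lin_comb \<alpha> \<gamma>). bracket x y = 0)}"
  have commute: "bracket x y = 0"
    if \<beta>: "\<beta> \<in> roots \<alpha>" "\<not> ?out \<beta>" "x \<in> root_space H (lin_comb \<alpha>
        \<beta>)"
      and \<gamma>: "\<gamma> \<in> roots \<alpha>" "?out \<gamma>" "y \<in> root_space H (lin_comb \<alpha>
          \<gamma>)" for \<beta> \<gamma> x y
  proof (rule ccontr)
    \<comment> \<open>A nonzero bracket would make \<beta> + \<gamma> a root with support on both
      sides of \<open>I\<close>, contrary to \<open>root_support\<close>.\<close>
    assume nz: "bracket x y \<noteq> 0"
    let ?\<delta> = "\<lambda>i. \<beta> i + \<gamma> i"
    have xy: "bracket x y \<in> root_space H (lin_comb \<alpha> ?\<delta>)"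
      using root_space_bracket[OF \<beta>(3) \<gamma>(3)] by (simp add: lin_comb_add[abs_def])
    obtain l where l: "\<beta> l \<noteq> 0" using \<beta>(1) nonzero by (metis ext)
    then have lI: "l \<in> I" using \<beta>(2) by blast
    obtain k where k: "k \<notin> I" "\<gamma> k \<noteq> 0" using \<gamma>(2) by blast
    have "\<exists>h\<in>H. lin_comb \<alpha> ?\<delta> h \<noteq> 0"
    proof (rule ccontr)
      assume "\<not> ?thesis"
      then have "?\<delta> = (\<lambda>_. 0)" by (intro lin_comb_eqD) (auto simp: lin_comb_def)
      then have "?\<delta> l = 0" by meson
      then show False using l out_zero[OF \<gamma>(1,2) lI] by simp
    qed
    then have "?\<delta> \<in> roots \<alpha>" using xy nz by (auto simp: roots_def is_root_def)
    moreover have "?\<delta> k \<noteq> 0" using k \<beta>(2) by auto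
    ultimately have "?\<delta> l = 0" using out_zero[of ?\<delta> l] k(1) lI by blast
    then show False using l out_zero[OF \<gamma>(1,2) lI] by simp
  qed
  have "lie_ideal Z"
    unfolding lie_ideal_def
  proof (intro conjI allI ballI)
    show sub: "subspace Z"
      unfolding Z_def subspace_def by (auto simp: bracket_add_left bracket_scale_left)
    fix u x assume x: "x \<in> Z"
    let ?U = "{u. bracket u x \<in> Z}"
    have "H \<union> {x. \<exists>\<mu>. is_root H \<mu> \<and> x \<in> root_space H \<mu>} \<subseteq> ?U"
    proof (intro Un_least subsetI)
      fix u assume u: "u \<in> H"
      have "bracket (bracket u x) y = 0" if "\<gamma> \<in> roots \<alpha>" "?out \<gamma>" "y \<in> root_space
          H (lin_comb \<alpha> \<gamma>)" for \<gamma> y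
      proof -
        have xy: "bracket x y = 0" using x that by (auto simp: Z_def)
        moreover have "bracket u y = scale (lin_comb \<alpha> \<gamma> u) y" by (rule root_spaceD[OF that(3) u])
        ultimately show ?thesis using bracket_derivation[of u x y] by (simp add: bracket_scale_right)
      qed
      then show "u \<in> ?U" by (auto simp: Z_def)
    next
      fix u assume "u \<in> {x. \<exists>\<mu>. is_root H \<mu> \<and> x \<in> root_space H \<mu>}"
      then obtain \<mu> where \<mu>: "is_root H \<mu>" "u \<in> root_space H \<mu>" by blast
      obtain \<beta> where \<beta>: "\<beta> \<in> roots \<alpha>" "\<forall>h\<in>H. \<mu> h = lin_comb
          \<alpha> \<beta> h"
        using root_coordinates[OF \<mu>(1)] by blast
      have u: "u \<in> root_space H (lin_comb \<alpha> \<beta>)" using \<mu>(2) \<beta>(2) by (simp add: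
          root_space_def)
      show "u \<in> ?U"
      proof (cases "?out \<beta>")
        case True
        then have "bracket x u = 0" using x \<beta>(1) u unfolding Z_def by blast
        then show ?thesis using bracket_anticommute[of u x] subspace_0[OF sub] by simp
      next
        case False
        have "bracket (bracket u x) y = 0" if \<gamma>: "\<gamma> \<in> roots \<alpha>" "?out \<gamma>" "y
            \<in> root_space H (lin_comb \<alpha> \<gamma>)" for \<gamma> y
        proof -
          have "bracket x y = 0" using x \<gamma> unfolding Z_def by blast
          moreover have "bracket u y = 0" by (rule commute[OF \<beta>(1) False u \<gamma>])
          ultimately show ?thesis using bracket_derivation[of u x y] by simp
        qed
        then show ?thesis by (auto simp: Z_def)
      qed
    qed
    moreover have "subspace ?U"
      using sub unfolding subspace_def by (simp add: bracket_add_left bracket_scale_left)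
    ultimately have "span (H \<union> {x. \<exists>\<mu>. is_root H \<mu> \<and> x \<in> root_space H \<mu>})
        \<subseteq> ?U" by (rule span_minimal)
    then show "bracket u x \<in> Z" unfolding root_decomposition by blast
  qed
  then have Z: "Z = {0} \<or> Z = UNIV" by (rule simple_lie_algebra.simple[OF simple_lie_algebra_axioms])
  obtain x where x: "x \<in> root_space H (\<alpha> i)" "x \<noteq> 0" using simple_is_root[of i] by (auto
      simp: is_root_def)
  have "\<not> ?out (simple_root i)" using ij by (auto simp: simple_root_def)
  then have "x \<in> Z"
    unfolding Z_def using commute[OF root_set.simple[OF root_set_roots], of i x] x(1) by (auto simp:
        lin_comb_simple_root)
  \<comment> \<open>A root vector belonging to i in \<open>I\<close> makes \<open>Z\<close>
    everything; then an h with nonzero value under alpha_j would have to commute with the root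
    vector of alpha_j.\<close>
  with x(2) Z have UNIV: "Z = UNIV" by blast
  obtain y where y: "y \<in> root_space H (\<alpha> j)" "y \<noteq> 0" using simple_is_root[of j] by (auto
      simp: is_root_def)
  obtain h where h: "h \<in> H" "\<alpha> j h \<noteq> 0" using simple_is_root[of j] by (auto simp: is_root_def)
  have "?out (simple_root j)" using ij by (auto simp: simple_root_def)
  moreover have "h \<in> Z" using UNIV by simp
  ultimately have "bracket h y = 0"
    unfolding Z_def using root_set.simple[OF root_set_roots, of j] y(1) by (force simp: lin_comb_simple_root)
  then show False using root_spaceD[OF y(1) h(1)] h(2) y(2) by simp
qed

end

end

theorem theorem3:
  fixes scale :: "complex \<Rightarrow> 'g::ab_group_add \<Rightarrow> 'g"
    and bracket :: "'g \<Rightarrow> 'g \<Rightarrow> 'g"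
    and H :: "'g set"
    and \<alpha> :: "'i::finite \<Rightarrow> 'g \<Rightarrow> complex"
    and C :: "'i \<Rightarrow> 'i \<Rightarrow> int"
  assumes "simple_lie_algebra scale bracket"
    and "complex_lie_algebra.cartan_subalgebra scale bracket H"
    and "complex_lie_algebra.simple_roots scale bracket H \<alpha>"
    and "complex_lie_algebra.cartan_matrix scale bracket H \<alpha> C"
    and "card (UNIV :: 'i set) \<ge> 3"
  shows "(\<Inter>ws\<in>reduced_decompositions C (longest_element C).
            quantum_degree_cone (complex_lie_algebra.positive_roots scale bracket H \<alpha>) C ws) = {}"
proof -
  interpret simple_lie_algebra scale bracket by fact
  interpret cartan_datum scale bracket H by standard fact
  show ?thesis
    by (rule root_set.cones_empty[OF root_set_roots indecomposable_cartan_matrix]) (use assms in auto)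
qed

end
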